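(* Let $K$ be a field, let $q\in K$ be a primitive $n$'th root of unity with $n\ge 2$, and let $A_1=K\langle x,y\mid xy-qyx=1\rangle$. Put $h=yx+\frac{1}{q-1}$, $t=x^n$, $r=y^n$, $s=h^n$. Then $$\mathrm{Spec}(A_1)=\mathrm{Spec}_{trs}(A_1)\sqcup \mathrm{Spec}_t(A_1/(r))\sqcup \mathrm{Spec}_r(A_1/(t))\sqcup \mathrm{Spec}(A_1/(t,r))\sqcup\mathrm{Spec}(A_1/(h)),$$ where $$\mathrm{Spec}_{trs}(A_1)=\{A_1\mathfrak{p}\mid \mathfrak{p}\in\mathrm{Spec}(Z(A_1));\ t,r,s\notin\mathfrak{p}\}=\{0\}\sqcup\mathcal{N}''\sqcup\mathbb{M}'',$$ $$\mathrm{Spec}_t(A_1/(r))=\{(r)\}\sqcup\mathbb{R},\quad \mathrm{Spec}_r(A_1/(t))=\{(t)\}\sqcup\mathbb{T},\quad \mathrm{Spec}(A_1/(t,r))=\{(t,r)\},\quad \mathrm{Spec}(A_1/(h))=\{(h)\}\sqcup\mathbb{H}'',$$ and $\mathcal{N}''=\{A_1\mathfrak{n}\mid \mathfrak{n}\in\mathrm{Spec}(Z(A_1)),\ \mathrm{ht}(\mathfrak{n})=1,\ \mathfrak{n}\ne (t),(r),(s)\}$, $\mathbb{M}''=\{A_1\mathfrak{m}\mid \mathfrak{m}\in\mathrm{Max}(Z(A_1));\ t,r,s\notin\mathfrak{m}\}$, $\mathbb{R}=\{(r,f)\mid f\in\mathrm{Irr}_m(K[t])\setminus\{t\}\}$,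 $\mathbb{T}=\{(t,g)\mid g\in\mathrm{Irr}_m(K[r])\setminus\{r\}\}$, $\mathbb{H}''=\{(h,f)\mid f\in\mathrm{Irr}_m(K[x])\setminus\{x\}\}$. The strict inclusions between prime ideals are as follows: $\{0\}$ is contained in every prime ideal; $(t)$ is contained in $(t,r)$ and in every element of $\mathbb{T}$; $(r)$ is contained in $(t,r)$ and in every element of $\mathbb{R}$; $(h)$ is contained in every element of $\mathbb{H}''$; and all remaining strict inclusions are inclusions of an element of $\mathcal{N}''$ in an element of $\mathbb{T}\cup\{(t,r)\}\cup\mathbb{R}\cup\mathbb{M}''\cup\mathbb{H}''$.
   Context: The centre of $A_1$ is the polynomial algebra $Z(A_1)=K[r,t]$ in two variables, and $s=(-1)^{n-1}rt+\frac{1}{(q-1)^n}\in Z(A_1)$. The element $h$ is a regular normal element of $A_1$. $\mathrm{Irr}_m(K[z])$ is the set of monic irreducible polynomials in $K[z]$; $(a,b,\ldots)$ is the two-sided ideal of $A_1$ (or the ideal of $Z(A_1)$, for elements $\mathfrak n$) generated by the listed elements; $\mathrm{ht}$ is the height of a prime ideal. All the spectra on the right-hand side are regarded as subsets of $\mathrm{Spec}(A_1)$: for an ideal $I$, $\mathrm{Spec}(A_1/I)$ is identified with the set of prime ideals of $A_1$ containing $I$; $\mathrm{Spec}_{trs}(A_1)$ is the set of primes of $A_1$ not containing $trs$; $\mathrm{Spec}_t(A_1/(r))$ is the set of primes of $A_1$ containing $r$ and not containing $t$; $\mathrm{Spec}_r(A_1/(t))$ is the set of primes of $A_1$ containing $t$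 and not containing $r$. *)

theory Defs
  imports
    "HOL-Library.Poly_Mapping"
    "HOL-Library.Extended_Nat"
    "HOL-Computational_Algebra.Polynomial"
    "HOL-Algebra.QuotRing"
    "HOL-Algebra.Ideal_Product"
begin

text \<open>
  The free algebra on two generators is the monoid algebra of the free monoid on two letters:
  finitely supported maps from words to the field, with convolution product. Words are a copy of
  the type of lists, written additively because convolution of finitely supported maps adds the
  exponents.
\<close>

datatype letter = Letter_x | Letter_y

datatype word = Word (letters: "letter list")

instantiation word :: monoid_add
begin

definition "0 = Word []"
definition "v + w = Word (letters v @ letters w)"

instance
  by standard (auto simp: zero_word_def plus_word_def)

end

type_synonym 'k free_alg = "word \<Rightarrow>\<^sub>0 'k"

definition free_algebra :: "('k::field) free_alg ring" where
  "free_algebra = \<lparr>carrier = UNIV, mult = (*), one = 1, zero = 0, add = (+)\<rparr>"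

definition gen_x :: "('k::field) free_alg" where
  "gen_x = Poly_Mapping.single (Word [Letter_x]) 1"

definition gen_y :: "('k::field) free_alg" where
  "gen_y = Poly_Mapping.single (Word [Letter_y]) 1"

definition free_const :: "'k::field \<Rightarrow> 'k free_alg" where
  "free_const c = Poly_Mapping.single 0 c"

definition qWeyl_relations :: "'k::field \<Rightarrow> 'k free_alg set" where
  "qWeyl_relations q =
     genideal free_algebra {gen_x * gen_y - free_const q * gen_y * gen_x - 1}"

text \<open>The algebra \<open>K\<langle>x, y | xy - qyx = 1\<rangle>\<close>; its elements are cosets in the free algebra.\<close>

definition qWeyl :: "'k::field \<Rightarrow> 'k free_alg set ring" where
  "qWeyl q = free_algebra Quot qWeyl_relations q"

definition qWeyl_class :: "'k::field \<Rightarrow> 'k free_alg \<Rightarrow> 'k free_alg set" where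
  "qWeyl_class q w = a_r_coset free_algebra (qWeyl_relations q) w"

definition qWeyl_x :: "'k::field \<Rightarrow> 'k free_alg set" where
  "qWeyl_x q = qWeyl_class q gen_x"

definition qWeyl_y :: "'k::field \<Rightarrow> 'k free_alg set" where
  "qWeyl_y q = qWeyl_class q gen_y"

definition qWeyl_const :: "'k::field \<Rightarrow> 'k \<Rightarrow> 'k free_alg set" where
  "qWeyl_const q c = qWeyl_class q (free_const c)"

text \<open>The value \<open>f(a)\<close> of a polynomial over the ground field at an element of the algebra.\<close>

definition qWeyl_eval :: "'k::field \<Rightarrow> 'k poly \<Rightarrow> 'k free_alg set \<Rightarrow> 'k free_alg set" where
  "qWeyl_eval q f a =
     (\<Oplus>\<^bsub>qWeyl q\<^esub>i\<in>{..Polynomial.degree f}.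
        qWeyl_const q (poly.coeff f i) \<otimes>\<^bsub>qWeyl q\<^esub> (a [^]\<^bsub>qWeyl q\<^esub> i))"

definition primitive_root_of_unity :: "nat \<Rightarrow> 'k::field \<Rightarrow> bool" where
  "primitive_root_of_unity n q \<longleftrightarrow> n > 0 \<and> q ^ n = 1 \<and> (\<forall>m. 0 < m \<and> m < n \<longrightarrow> q ^ m \<noteq> 1)"

definition Irr_m :: "'k::field poly set" where
  "Irr_m = {f. Polynomial.lead_coeff f = 1 \<and> Factorial_Ring.irreducible f}"

definition centre_ring :: "('a, 'b) ring_scheme \<Rightarrow> ('a, 'b) ring_scheme" where
  "centre_ring R = R\<lparr>carrier :=
     {z \<in> carrier R. \<forall>a\<in>carrier R. z \<otimes>\<^bsub>R\<^esub> a = a \<otimes>\<^bsub>R\<^esub> z}\<rparr>"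

text \<open>
  Primes of a noncommutative ring, defined through products of two-sided ideals. The library's
  \<open>primeideal\<close> is the elementwise notion and presupposes a commutative ring; it is used below
  for the centre only.
\<close>

definition nc_prime_ideal :: "'a set \<Rightarrow> ('a, 'b) ring_scheme \<Rightarrow> bool" where
  "nc_prime_ideal P R \<longleftrightarrow> ideal P R \<and> P \<noteq> carrier R \<and>
     (\<forall>I J. ideal I R \<and> ideal J R \<and> I \<cdot>\<^bsub>R\<^esub> J \<subseteq> P \<longrightarrow> I \<subseteq> P \<or> J \<subseteq> P)"

definition nc_Spec :: "('a, 'b) ring_scheme \<Rightarrow> 'a set set" where
  "nc_Spec R = {P. nc_prime_ideal P R}"

text \<open>\<open>Spec(R/I)\<close>, regarded as a subset of \<open>Spec(R)\<close>.\<close>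

definition nc_Spec_quot :: "('a, 'b) ring_scheme \<Rightarrow> 'a set \<Rightarrow> 'a set set" where
  "nc_Spec_quot R I = {P \<in> nc_Spec R. I \<subseteq> P}"

definition prime_height :: "('a, 'b) ring_scheme \<Rightarrow> 'a set \<Rightarrow> enat" where
  "prime_height R P =
     (SUP k \<in> {k. \<exists>C :: nat \<Rightarrow> 'a set. (\<forall>i\<le>k. primeideal (C i) R) \<and>
                    (\<forall>i<k. C i \<subset> C (Suc i)) \<and> C k = P}. enat k)"

definition is_disjoint_union :: "'a set \<Rightarrow> 'a set list \<Rightarrow> bool" where
  "is_disjoint_union S Xs \<longleftrightarrow> S = \<Union> (set Xs) \<and>
     (\<forall>i<length Xs. \<forall>j<length Xs. i \<noteq> j \<longrightarrow> Xs ! i \<inter> Xs ! j = {})"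

end

theory Submission
  imports Defs "HOL-Computational_Algebra.Polynomial_Factorial"
begin

text \<open>
  The ring acts faithfully on its normally ordered monomials \<open>y^i x^j\<close>, identified with polynomials
  in \<open>Y\<close> and \<open>X\<close>; this gives the PBW basis, the centre \<open>K[r,t]\<close>, and freeness over the centre on the
  \<open>y^i x^j\<close> with \<open>i, j < n\<close>. After inverting \<open>t\<close> (or \<open>r\<close>) and \<open>s\<close>, the ring is spanned over the centre
  by the monomials \<open>h^i x^j\<close> (or \<open>h^i y^j\<close>), on which conjugation by \<open>h\<close> and \<open>x\<close> acts diagonally with
  distinct characters. Averaging over these conjugations shows that a two-sided ideal is generated,
  up to powers of \<open>s\<close> and \<open>t\<close> (or \<open>r\<close>), by its central elements, so primes avoiding \<open>s\<close> and one of
  \<open>t, r\<close> are extended from the centre. The ideal \<open>(t,r)\<close> is maximal because every element outside it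
  generates, modulo \<open>(t,r)\<close>, the element \<open>y^(n-1) x^(n-1)\<close> and hence \<open>1\<close>. Since
  \<open>h\<close> is normal, a prime containing \<open>s = h^n\<close> contains \<open>h\<close>, and modulo \<open>h\<close> the ring is
  \<open>K[x, 1/x]\<close>. The rest is the dimension theory of \<open>K[r,t]\<close>.
\<close>

section \<open>Ideals of subrings of type-class rings\<close>

text \<open>Cosets of a free algebra are awkward to compute with, so the ring theory takes place in
  a ring of additive operators on polynomials, given as a subset \<open>qw\<close> of a type-class
  ring, and is carried over by \<open>qw_iso\<close>. An operator in \<open>qw\<close> is determined
  by its value at 1, which turns questions about the ring into comparisons of coefficients. The
  averages divide by n; a field with a primitive n-th root of unity cannot have n = 0. They are
  taken inside the ring, where x, y and h are not invertible, and clearing their denominators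
  produces the powers of s and of t (or r). The constant 1/(q-1) in h is the fixed point of c -> qc
  - 1; this makes h commute with x and y up to powers of q. The formula for s comes from y^n x^n
  being the product over j < n of q^(-j) h - 1/(q-1), a polynomial in h with roots q^j/(q-1).
  Averaging is silent at (h), which is not extended from the centre, and at (t,r), where neither t
  nor r can be inverted; these two loci need their own arguments. They do not meet, because s is a
  nonzero constant modulo t and modulo r.\<close>

definition tsubring :: "'a::ring_1 set \<Rightarrow> bool" where
  "tsubring B \<longleftrightarrow> 1 \<in> B \<and> -1 \<in> B \<and> (\<forall>a\<in>B. \<forall>b\<in>B. a + b \<in> B \<and> a * b \<in> B)"

definition tideal :: "'a::ring_1 set \<Rightarrow> 'a set \<Rightarrow> bool" where
  "tideal B I \<longleftrightarrow> I \<subseteq> B \<and> 0 \<in> I \<and> (\<forall>a\<in>I. \<forall>b\<in>I. a + b \<in> I) \<and>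
     (\<forall>a\<in>I. \<forall>b\<in>B. a * b \<in> I \<and> b * a \<in> I)"

definition tgen :: "'a::ring_1 set \<Rightarrow> 'a set \<Rightarrow> 'a set" where
  "tgen B G = \<Inter> {I. tideal B I \<and> G \<subseteq> I}"

text \<open>Primeness tested on elements rather than on pairs of ideals, which suits calculation;
  \<open>nc_prime_image\<close> shows that it agrees with the ideal-product definition.\<close>

definition tprime :: "'a::ring_1 set \<Rightarrow> 'a set \<Rightarrow> bool" where
  "tprime B P \<longleftrightarrow> tideal B P \<and> 1 \<notin> P \<and>
     (\<forall>a\<in>B. \<forall>b\<in>B. (\<forall>c\<in>B. a * c * b \<in> P) \<longrightarrow> a \<in> P \<or> b \<in> P)"

definition cprime :: "'a::comm_ring_1 set \<Rightarrow> bool" where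
  "cprime P \<longleftrightarrow> tideal UNIV P \<and> 1 \<notin> P \<and> (\<forall>a b. a * b \<in> P \<longrightarrow> a \<in> P \<or> b \<in> P)"

definition cmax :: "'a::comm_ring_1 set \<Rightarrow> bool" where
  "cmax P \<longleftrightarrow> tideal UNIV P \<and> 1 \<notin> P \<and> (\<forall>J. tideal UNIV J \<longrightarrow> P \<subseteq> J \<longrightarrow> J = P \<or> 1 \<in> J)"

lemma tsubringD:
  assumes "tsubring B"
  shows "1 \<in> B" "-1 \<in> B" "0 \<in> B" "a \<in> B \<Longrightarrow> b \<in> B \<Longrightarrow> a + b \<in> B"
    "a \<in> B \<Longrightarrow> b \<in> B \<Longrightarrow> a * b \<in> B" "a \<in> B \<Longrightarrow> - a \<in> B" "a \<in> B \<Longrightarrow> b \<in> B \<Longrightarrow> a - b \<in> B"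
proof -
  show *: "1 \<in> B" "-1 \<in> B" "a \<in> B \<Longrightarrow> b \<in> B \<Longrightarrow> a + b \<in> B" "a \<in> B \<Longrightarrow> b \<in> B \<Longrightarrow> a * b \<in> B" for a b
    using assms by (auto simp: tsubring_def)
  from *(3)[OF *(1) *(2)] show "0 \<in> B" by simp
  show m: "a \<in> B \<Longrightarrow> - a \<in> B" for a using *(4)[OF *(2), of a] by simp
  show "a \<in> B \<Longrightarrow> b \<in> B \<Longrightarrow> a - b \<in> B" using *(3)[of a "- b"] m[of b] by simp
qed

lemma tsubring_UNIV [simp]: "tsubring UNIV"
  by (simp add: tsubring_def)

lemma tsubring_power: "tsubring B \<Longrightarrow> a \<in> B \<Longrightarrow> a ^ k \<in> B"
  by (induction k) (auto intro: tsubringD)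

lemma tsubring_sum: "tsubring B \<Longrightarrow> (\<And>i. i \<in> F \<Longrightarrow> f i \<in> B) \<Longrightarrow> sum f F \<in> B"
  by (induction F rule: infinite_finite_induct) (auto intro: tsubringD)

lemma tidealD:
  assumes "tideal B I"
  shows "I \<subseteq> B" "0 \<in> I" "a \<in> I \<Longrightarrow> b \<in> I \<Longrightarrow> a + b \<in> I"
    "a \<in> I \<Longrightarrow> b \<in> B \<Longrightarrow> a * b \<in> I" "a \<in> I \<Longrightarrow> b \<in> B \<Longrightarrow> b * a \<in> I"
  using assms by (auto simp: tideal_def)

lemma tideal_minus:
  assumes "tsubring B" "tideal B I" "a \<in> I"
  shows "- a \<in> I"
  using tidealD(4)[OF assms(2,3) tsubringD(2)[OF assms(1)]] by simp

lemma tideal_diff: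
  assumes "tsubring B" "tideal B I" "a \<in> I" "b \<in> I"
  shows "a - b \<in> I"
  using tidealD(3)[OF assms(2,3) tideal_minus[OF assms(1,2,4)]] by simp

lemma tideal_sum: "tideal B I \<Longrightarrow> (\<And>i. i \<in> F \<Longrightarrow> f i \<in> I) \<Longrightarrow> sum f F \<in> I"
  by (induction F rule: infinite_finite_induct) (auto intro: tidealD)

lemma tideal_whole: "tsubring B \<Longrightarrow> tideal B I \<Longrightarrow> 1 \<in> I \<Longrightarrow> I = B"
  using tidealD(4)[of B I 1] tidealD(1)[of B I] by auto

lemma tideal_self: "tsubring B \<Longrightarrow> tideal B B"
  by (auto simp: tideal_def intro: tsubringD)

lemma tideal_zero: "tsubring B \<Longrightarrow> tideal B {0}"
  by (auto simp: tideal_def intro: tsubringD)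

lemma tideal_tgen:
  assumes "tsubring B" "G \<subseteq> B"
  shows "tideal B (tgen B G)"
proof -
  have "tgen B G \<subseteq> B" using assms tideal_self[OF assms(1)] by (auto simp: tgen_def)
  then show ?thesis by (auto simp: tideal_def[of B "tgen B G"]) (auto simp: tgen_def dest: tidealD)
qed

lemma tgen_incl: "G \<subseteq> tgen B G"
  by (auto simp: tgen_def)

lemma tgen_least: "tideal B I \<Longrightarrow> G \<subseteq> I \<Longrightarrow> tgen B G \<subseteq> I"
  by (auto simp: tgen_def)

lemma tgen_subset_iff: "tsubring B \<Longrightarrow> G \<subseteq> B \<Longrightarrow> tideal B I \<Longrightarrow> tgen B G \<subseteq> I \<longleftrightarrow> G \<subseteq> I"
  using tgen_incl tgen_least by blast

lemma tgen_eqI: "tideal B I \<Longrightarrow> G \<subseteq> I \<Longrightarrow> (\<And>J. tideal B J \<Longrightarrow> G \<subseteq> J \<Longrightarrow> I \<subseteq> J) \<Longrightarrow> tgen B G = I"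
  by (auto simp: tgen_def)

lemma tprimeD:
  assumes "tprime B P"
  shows "tideal B P" "1 \<notin> P"
    "a \<in> B \<Longrightarrow> b \<in> B \<Longrightarrow> (\<And>c. c \<in> B \<Longrightarrow> a * c * b \<in> P) \<Longrightarrow> a \<in> P \<or> b \<in> P"
  using assms by (auto simp: tprime_def)

lemma cprimeD:
  assumes "cprime P"
  shows "tideal UNIV P" "1 \<notin> P" "a * b \<in> P \<Longrightarrow> a \<in> P \<or> b \<in> P"
  using assms by (auto simp: cprime_def)

lemma cideal_mult: "tideal UNIV I \<Longrightarrow> a \<in> I \<Longrightarrow> a * b \<in> I" "tideal UNIV I \<Longrightarrow> a \<in> I \<Longrightarrow> b * a \<in> I"
  by (auto simp: tideal_def)

lemma cideal_diff: "tideal UNIV I \<Longrightarrow> a \<in> I \<Longrightarrow> b \<in> I \<Longrightarrow> a - b \<in> I"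
  using tideal_diff[OF tsubring_UNIV] by blast

lemma cideal_add_left: "tideal UNIV I \<Longrightarrow> b \<in> I \<Longrightarrow> a + b \<in> I \<longleftrightarrow> a \<in> I"
  using cideal_diff[of I "a + b" b] tidealD(3)[of UNIV I a b] by auto

lemma cprime_power: "cprime P \<Longrightarrow> a ^ k \<in> P \<Longrightarrow> a \<in> P"
  by (induction k) (auto dest: cprimeD)

text \<open>If b is outside P, the colon ideal of all c with ca in P contains P and b, so by
  maximality it contains 1.\<close>

lemma cmax_imp_cprime:
  assumes "cmax P"
  shows "cprime P"
  unfolding cprime_def
proof (intro conjI allI impI)
  have P: "tideal UNIV P" "1 \<notin> P" using assms by (auto simp: cmax_def)
  show "tideal UNIV P" "1 \<notin> P" by fact+
  fix a b assume ab: "a * b \<in> P"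
  show "a \<in> P \<or> b \<in> P"
  proof (rule disjCI)
    assume b: "b \<notin> P"
    have J: "tideal UNIV {c. c * a \<in> P}"
      using P unfolding tideal_def by (auto simp: algebra_simps)
    have "P \<subseteq> {c. c * a \<in> P}" using P by (auto intro: cideal_mult)
    moreover have "b \<in> {c. c * a \<in> P}" using ab by (simp add: mult.commute)
    ultimately have "1 \<in> {c. c * a \<in> P}" using assms J b unfolding cmax_def by blast
    then show "a \<in> P" by simp
  qed
qed

text \<open>A proper ideal P is prime exactly when this colon ideal lies in P for every b outside P.
  Primeness can therefore be proved by comparing two-sided ideals.\<close>

lemma tideal_left_colon:
  assumes B: "tsubring B" and P: "tideal B P" and b: "b \<in> B"
  shows "tideal B {a \<in> B. \<forall>c\<in>B. a * c * b \<in> P}"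
  unfolding tideal_def
proof (intro conjI ballI)
  note s = tsubringD[OF B] and p = tidealD[OF P]
  let ?I = "{a \<in> B. \<forall>c\<in>B. a * c * b \<in> P}"
  show "?I \<subseteq> B" "0 \<in> ?I" using s(3) p(2) by auto
  show "a + a' \<in> ?I" if "a \<in> ?I" "a' \<in> ?I" for a a'
    using that s(4) p(3) by (simp add: distrib_right)
  fix a d assume a: "a \<in> ?I" and d: "d \<in> B"
  have "a * d * c * b \<in> P" "d * a * c * b \<in> P" if c: "c \<in> B" for c
  proof -
    have "a * (d * c) * b \<in> P" "a * c * b \<in> P" using a c d s(5) by auto
    then show "a * d * c * b \<in> P" "d * a * c * b \<in> P"
      using p(5)[of "a * c * b" d] d by (simp_all add: mult.assoc)
  qed
  then show "a * d \<in> ?I" "d * a \<in> ?I" using a d s(5) by auto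
qed

section \<open>Transport of ideals and primes along an isomorphism\<close>

locale ring_model = ring R for R :: "('r, 'm) ring_scheme" (structure) +
  fixes B :: "'e::ring_1 set" and g :: "'e \<Rightarrow> 'r"
  assumes sub: "tsubring B" and bij: "bij_betw g B (carrier R)"
    and g_add: "\<And>a b. a \<in> B \<Longrightarrow> b \<in> B \<Longrightarrow> g (a + b) = g a \<oplus> g b"
    and g_mult: "\<And>a b. a \<in> B \<Longrightarrow> b \<in> B \<Longrightarrow> g (a * b) = g a \<otimes> g b"
    and g_one: "g 1 = \<one>"
begin

lemma inj: "inj_on g B" and surj: "g ` B = carrier R"
  using bij by (auto simp: bij_betw_def)

lemma g_closed: "a \<in> B \<Longrightarrow> g a \<in> carrier R"
  using surj by auto

lemma g_zero: "g 0 = \<zero>"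
proof -
  have "g 0 \<oplus> g 0 = g 0"
    using g_add[of 0 0] tsubringD(3)[OF sub] by simp
  then show ?thesis
    using g_closed[OF tsubringD(3)[OF sub]]
    by (metis add.l_cancel_one')
qed

lemma g_uminus: "a \<in> B \<Longrightarrow> g (- a) = \<ominus> g a"
  using g_add[of "- a" a] tsubringD(6)[OF sub] g_closed g_zero
  by (intro minus_equality[symmetric]) auto

lemma g_power: "a \<in> B \<Longrightarrow> g (a ^ k) = g a [^] k"
proof (induction k)
  case (Suc k)
  have "g (a ^ Suc k) = g (a ^ k * a)" by (simp only: power_Suc2)
  also have "\<dots> = g (a ^ k) \<otimes> g a" using Suc tsubring_power[OF sub] by (intro g_mult) auto
  finally show ?case using Suc by simp
qed (simp add: g_one)

lemma g_sum:
  assumes "finite F" "\<And>i. i \<in> F \<Longrightarrow> f i \<in> B"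
  shows "g (sum f F) = (\<Oplus>i\<in>F. g (f i))"
  using assms
proof (induction F)
  case (insert i F)
  have "g (sum f (insert i F)) = g (f i + sum f F)" using insert by simp
  also have "\<dots> = g (f i) \<oplus> g (sum f F)" using insert tsubring_sum[OF sub, of F f] by (intro g_add) auto
  also have "\<dots> = g (f i) \<oplus> (\<Oplus>i\<in>F. g (f i))" using insert by simp
  also have "\<dots> = (\<Oplus>i\<in>insert i F. g (f i))"
    using insert g_closed by (intro finsum_insert[symmetric]) auto
  finally show ?case .
qed (simp add: g_zero)

lemma mem_image: "I \<subseteq> B \<Longrightarrow> a \<in> B \<Longrightarrow> g a \<in> g ` I \<longleftrightarrow> a \<in> I"
  by (rule inj_on_image_mem_iff[OF inj]) auto

lemma image_le_iff: "I \<subseteq> B \<Longrightarrow> J \<subseteq> B \<Longrightarrow> g ` I \<subseteq> g ` J \<longleftrightarrow> I \<subseteq> J"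
proof
  assume IJ: "I \<subseteq> B" "J \<subseteq> B" and s: "g ` I \<subseteq> g ` J"
  show "I \<subseteq> J"
  proof
    fix a assume "a \<in> I"
    then show "a \<in> J" using IJ s mem_image[of J a] by blast
  qed
qed blast

lemma image_psubset_iff: "I \<subseteq> B \<Longrightarrow> J \<subseteq> B \<Longrightarrow> g ` I \<subset> g ` J \<longleftrightarrow> I \<subset> J"
  by (simp add: psubset_eq inj_on_image_eq_iff[OF inj] image_le_iff del: image_subset_iff)

lemma ideal_image:
  assumes "tideal B I"
  shows "ideal (g ` I) R"
proof (rule idealI)
  note I = tidealD[OF assms]
  show "ring R" by (rule ring_axioms)
  show "subgroup (g ` I) (add_monoid R)"
  proof (rule add.subgroupI)
    show "g ` I \<subseteq> carrier R" using I(1) g_closed by auto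
    show "g ` I \<noteq> {}" using I(2) by auto
    fix a assume "a \<in> g ` I"
    then obtain a' where a': "a' \<in> I" "a = g a'" by auto
    then show "\<ominus> a \<in> g ` I"
      using g_uminus[of a'] tideal_minus[OF sub assms a'(1)] I(1) by (metis image_eqI subset_iff)
  next
    fix a b assume "a \<in> g ` I" "b \<in> g ` I"
    then obtain a' b' where *: "a' \<in> I" "a = g a'" "b' \<in> I" "b = g b'" by auto
    then have "g (a' + b') = a \<oplus> b" using I(1) g_add by auto
    then show "a \<oplus> b \<in> g ` I" using * I(3) by (metis image_eqI)
  qed
  fix a x assume "a \<in> g ` I" "x \<in> carrier R"
  then obtain a' where a': "a' \<in> I" "a = g a'" by auto
  have "x \<in> g ` B" using \<open>x \<in> carrier R\<close> surj by simp
  then obtain x' where "x' \<in> B" "x = g x'" by auto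
  note * = a' this
  show "x \<otimes> a \<in> g ` I" using * I(1,5) g_mult[of x' a'] by (metis image_eqI subset_iff)
  show "a \<otimes> x \<in> g ` I" using * I(1,4) g_mult[of a' x'] by (metis image_eqI subset_iff)
qed

lemma ideal_preimage:
  assumes "ideal J R"
  obtains I where "tideal B I" "J = g ` I"
proof
  interpret J: ideal J R by fact
  let ?I = "{a \<in> B. g a \<in> J}"
  show "J = g ` ?I" using surj J.Icarr by auto
  show "tideal B ?I"
    unfolding tideal_def
    using tsubringD[OF sub] g_zero g_add g_mult J.I_l_closed J.I_r_closed J.zero_closed J.a_closed g_closed
    by auto
qed

lemma ideal_image_iff: "I \<subseteq> B \<Longrightarrow> ideal (g ` I) R \<longleftrightarrow> tideal B I"
proof
  assume I: "I \<subseteq> B" and "ideal (g ` I) R"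
  from this(2) obtain I' where I': "tideal B I'" "g ` I = g ` I'" by (rule ideal_preimage)
  then have "I = I'" using inj_on_image_eq_iff[OF inj I tidealD(1)[OF I'(1)]] by simp
  then show "tideal B I" using I' by simp
qed (rule ideal_image)

lemma genideal_image:
  assumes "G \<subseteq> B"
  shows "genideal R (g ` G) = g ` tgen B G"
proof
  show "genideal R (g ` G) \<subseteq> g ` tgen B G"
    using ideal_image[OF tideal_tgen[OF sub assms]] tgen_incl[of G B]
    by (intro genideal_minimal) auto
  have "ideal (genideal R (g ` G)) R"
    using assms g_closed by (intro genideal_ideal) auto
  then obtain I where I: "tideal B I" "genideal R (g ` G) = g ` I" by (rule ideal_preimage)
  have "g ` G \<subseteq> g ` I" using genideal_self[of "g ` G"] assms g_closed I(2) by auto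
  then have "G \<subseteq> I" using image_le_iff[OF assms tidealD(1)[OF I(1)]] by simp
  then show "g ` tgen B G \<subseteq> genideal R (g ` G)"
    unfolding I(2) by (intro image_mono tgen_least I(1))
qed

lemma ideal_prod_subset_iff:
  assumes "tideal B P"
  shows "g ` I \<cdot> g ` J \<subseteq> g ` P \<longleftrightarrow> (\<forall>i\<in>I. \<forall>j\<in>J. g i \<otimes> g j \<in> g ` P)"
proof
  show "\<forall>i\<in>I. \<forall>j\<in>J. g i \<otimes> g j \<in> g ` P" if "g ` I \<cdot> g ` J \<subseteq> g ` P"
  proof (intro ballI)
    fix i j assume "i \<in> I" "j \<in> J"
    then have "g i \<otimes> g j \<in> g ` I \<cdot> g ` J" by (intro ideal_prod.prod imageI)
    then show "g i \<otimes> g j \<in> g ` P" using that by (rule set_rev_mp)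
  qed
  interpret P: ideal "g ` P" R by (rule ideal_image[OF assms])
  assume *: "\<forall>i\<in>I. \<forall>j\<in>J. g i \<otimes> g j \<in> g ` P"
  show "g ` I \<cdot> g ` J \<subseteq> g ` P"
  proof
    fix a assume "a \<in> g ` I \<cdot> g ` J"
    then show "a \<in> g ` P"
    proof (induction rule: ideal_prod.induct)
      case (prod i j)
      then show ?case using * by blast
    next
      case (sum a b)
      then show ?case by (intro P.a_closed)
    qed
  qed
qed

text \<open>The last hypothesis is an induction rule for \<open>T\<close> with an arbitrary
  predicate \<open>Q\<close>: it says that \<open>T\<close> is exhausted by finite sums of products,
  just as the inductive set \<open>ideal_prod\<close> is.\<close>

lemma ideal_prod_image:
  assumes "I \<subseteq> B" "J \<subseteq> B" "T \<subseteq> B"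
    and "\<And>i j. i \<in> I \<Longrightarrow> j \<in> J \<Longrightarrow> i * j \<in> T" "\<And>a b. a \<in> T \<Longrightarrow> b \<in> T \<Longrightarrow> a + b \<in> T"
    and "\<And>Q a. \<lbrakk>\<And>i j. i \<in> I \<Longrightarrow> j \<in> J \<Longrightarrow> Q (i * j); \<And>a b. Q a \<Longrightarrow> Q b \<Longrightarrow> Q (a + b); a \<in> T\<rbrakk> \<Longrightarrow> Q a"
  shows "g ` I \<cdot> g ` J = g ` T"
proof
  have "a \<in> g ` I \<cdot> g ` J \<Longrightarrow> a \<in> g ` T" for a
  proof (induction rule: ideal_prod.induct)
    case (prod i j)
    then show ?case using assms(1,2,4) g_mult by (auto simp: image_iff subset_iff) metis
  next
    case (sum s1 s2)
    then show ?case using assms(3,5) g_add by (auto simp: image_iff subset_iff) metis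
  qed
  then show "g ` I \<cdot> g ` J \<subseteq> g ` T" by (rule subsetI)
  have "g a \<in> g ` I \<cdot> g ` J \<and> a \<in> T" if "a \<in> T" for a
  proof (rule assms(6)[OF _ _ that])
    show "g (i * j) \<in> g ` I \<cdot> g ` J \<and> i * j \<in> T" if "i \<in> I" "j \<in> J" for i j
    proof -
      have "g (i * j) = g i \<otimes> g j" using that assms(1,2) by (intro g_mult) auto
      then show ?thesis using that assms(4) ideal_prod.prod[of "g i" "g ` I" "g j" "g ` J" R] by auto
    qed
    show "g (a + b) \<in> g ` I \<cdot> g ` J \<and> a + b \<in> T"
      if "g a \<in> g ` I \<cdot> g ` J \<and> a \<in> T" "g b \<in> g ` I \<cdot> g ` J \<and> b \<in> T" for a b
    proof -
      have "g (a + b) = g a \<oplus> g b" using that assms(3) by (intro g_add) auto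
      then show ?thesis using that assms(5) ideal_prod.sum[of "g a" R "g ` I" "g ` J" "g b"] by auto
    qed
  qed
  then show "g ` T \<subseteq> g ` I \<cdot> g ` J" by auto
qed

lemma nc_prime_image:
  assumes "P \<subseteq> B"
  shows "nc_prime_ideal (g ` P) R \<longleftrightarrow> tprime B P"
proof
  assume L: "nc_prime_ideal (g ` P) R"
  then have P: "tideal B P" using ideal_image_iff[OF assms] by (simp add: nc_prime_ideal_def)
  show "tprime B P"
    unfolding tprime_def
  proof (intro conjI ballI impI)
    show "tideal B P" by fact
    show "1 \<notin> P"
      using L tideal_whole[OF sub P] surj by (auto simp: nc_prime_ideal_def)
    fix a b assume a: "a \<in> B" and b: "b \<in> B" and ab: "\<forall>c\<in>B. a * c * b \<in> P"
    \<comment> \<open>\<open>I\<close> is the largest ideal with I B b inside P, and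
      \<open>J\<close> the largest with I B J inside P. As a lies in the first and b in the second,
      primeness for ideals decides between a and b.\<close>
    define I where "I = {a \<in> B. \<forall>c\<in>B. a * c * b \<in> P}"
    define J where "J = {b \<in> B. \<forall>a\<in>I. \<forall>c\<in>B. a * c * b \<in> P}"
    note s = tsubringD[OF sub] and p = tidealD[OF P]
    have I: "tideal B I" unfolding I_def by (rule tideal_left_colon[OF sub P b])
    have J: "tideal B J" unfolding tideal_def
    proof (intro conjI ballI)
      fix b d assume b: "b \<in> J" and d: "d \<in> B"
      have "a * c * (b * d) \<in> P" "a * c * (d * b) \<in> P" if a: "a \<in> I" and c: "c \<in> B" for a c
      proof -
        have "a * (c * d) * b \<in> P" "a * c * b \<in> P" using a b c d s(5) by (auto simp: J_def)
        then show "a * c * (b * d) \<in> P" "a * c * (d * b) \<in> P"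
          using p(4)[of "a * c * b" d] d by (simp_all add: mult.assoc)
      qed
      then show "b * d \<in> J" "d * b \<in> J" using b d s(5) by (auto simp: J_def)
    qed (use s p in \<open>auto simp: J_def distrib_left\<close>)
    have "g i \<otimes> g j \<in> g ` P" if "i \<in> I" "j \<in> J" for i j
    proof -
      have "i * 1 * j \<in> P" using that s unfolding J_def by blast
      then have "g (i * j) \<in> g ` P" by simp
      then show ?thesis using g_mult[of i j] that by (simp add: I_def J_def)
    qed
    then have "g ` I \<cdot> g ` J \<subseteq> g ` P" using ideal_prod_subset_iff[OF P] by blast
    then have "g ` I \<subseteq> g ` P \<or> g ` J \<subseteq> g ` P"
      using L ideal_image[OF I] ideal_image[OF J] by (auto simp: nc_prime_ideal_def)
    then have "I \<subseteq> P \<or> J \<subseteq> P"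
      using image_le_iff assms tidealD(1)[OF I] tidealD(1)[OF J] by blast
    moreover have "a \<in> I" "b \<in> J" using a b ab by (auto simp: I_def J_def)
    ultimately show "a \<in> P \<or> b \<in> P" by blast
  qed
next
  assume R: "tprime B P"
  note P = tprimeD[OF this]
  show "nc_prime_ideal (g ` P) R"
    unfolding nc_prime_ideal_def
  proof (intro conjI allI impI)
    show "ideal (g ` P) R" by (rule ideal_image[OF P(1)])
    show "g ` P \<noteq> carrier R"
      using P(2) mem_image[OF assms, of 1] tsubringD(1)[OF sub] g_one by fastforce
    fix I J assume *: "ideal I R \<and> ideal J R \<and> I \<cdot> J \<subseteq> g ` P"
    then obtain I' J' where IJ: "tideal B I'" "I = g ` I'" "tideal B J'" "J = g ` J'"
      by (metis ideal_preimage)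
    show "I \<subseteq> g ` P \<or> J \<subseteq> g ` P"
    proof (rule ccontr)
      assume "\<not> ?thesis"
      then obtain a b where ab: "a \<in> I'" "a \<notin> P" "b \<in> J'" "b \<notin> P" using IJ by blast
      have aB: "a \<in> B" "b \<in> B" using ab IJ tidealD(1) by blast+
      have "a * c * b \<in> P" if "c \<in> B" for c
      proof -
        have ac: "a * c \<in> I'" using ab(1) that tidealD(4)[OF IJ(1)] by blast
        then have "g (a * c) \<otimes> g b \<in> g ` P"
          using * IJ ab ideal_prod_subset_iff[OF P(1)] by blast
        then have "g (a * c * b) \<in> g ` P"
          using g_mult[of "a * c" b] aB that tsubringD(5)[OF sub] by simp
        then show ?thesis using mem_image[OF assms, of "a * c * b"] aB that tsubringD(5)[OF sub] by simp
      qed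
      then show False using P(3)[OF aB] ab by blast
    qed
  qed
qed

lemma nc_Spec_image: "nc_Spec R = (`) g ` {P. tprime B P}"
proof -
  have "P \<in> nc_Spec R \<longleftrightarrow> P \<in> (`) g ` {P. tprime B P}" for P
  proof
    assume P: "P \<in> nc_Spec R"
    then have "ideal P R" by (simp add: nc_Spec_def nc_prime_ideal_def)
    then obtain I where I: "tideal B I" "P = g ` I" by (rule ideal_preimage)
    then have "tprime B I" using nc_prime_image[OF tidealD(1)[OF I(1)]] P by (simp add: nc_Spec_def)
    then show "P \<in> (`) g ` {P. tprime B P}" using I by blast
  next
    assume "P \<in> (`) g ` {P. tprime B P}"
    then obtain Q where Q: "tprime B Q" "P = g ` Q" by blast
    then show "P \<in> nc_Spec R"
      using nc_prime_image[OF tidealD(1)[OF tprimeD(1)[OF Q(1)]]] by (simp add: nc_Spec_def)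
  qed
  then show ?thesis by blast
qed

end

section \<open>Prime ideals, maximal ideals and height in the commutative case\<close>

locale cring_model = ring_model R UNIV g + cring R
  for R :: "('r, 'm) ring_scheme" (structure) and g :: "'e::idom \<Rightarrow> 'r"
begin

lemma primeideal_image: "primeideal (g ` P) R \<longleftrightarrow> cprime P"
proof
  assume L: "primeideal (g ` P) R"
  then interpret P: primeideal "g ` P" R .
  have "tideal UNIV P" using P.is_ideal ideal_image_iff[of P] by simp
  moreover have "1 \<notin> P" using P.I_notcarr P.one_imp_carrier g_one by (metis imageI)
  moreover have "a \<in> P \<or> b \<in> P" if "a * b \<in> P" for a b
    using P.I_prime[of "g a" "g b"] g_mult[of a b] that g_closed mem_image[of P] by (metis UNIV_I imageI subset_UNIV)
  ultimately show "cprime P" by (simp add: cprime_def)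
next
  assume R: "cprime P"
  show "primeideal (g ` P) R"
  proof (rule primeidealI)
    show "ideal (g ` P) R" using ideal_image cprimeD(1)[OF R] by blast
    show "cring R" by (rule is_cring)
    show "carrier R \<noteq> g ` P"
      using cprimeD(2)[OF R] mem_image[of P 1] g_one by fastforce
    fix a b assume "a \<in> carrier R" "b \<in> carrier R" "a \<otimes> b \<in> g ` P"
    then obtain a' b' where "a = g a'" "b = g b'" using surj by blast
    then show "a \<in> g ` P \<or> b \<in> g ` P"
      using cprimeD(3)[OF R, of a' b'] g_mult[of a' b'] mem_image[of P] \<open>a \<otimes> b \<in> g ` P\<close>
      by (metis UNIV_I imageI subset_UNIV)
  qed
qed

lemma primeideal_preimage:
  assumes "primeideal J R"
  obtains P where "cprime P" "J = g ` P"
  using ideal_preimage[of J] assms primeideal_image by (metis primeideal.axioms(1))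

lemma maximalideal_image: "maximalideal (g ` P) R \<longleftrightarrow> cmax P"
proof
  assume L: "maximalideal (g ` P) R"
  then interpret P: maximalideal "g ` P" R .
  have "tideal UNIV P" using P.is_ideal ideal_image_iff[of P] by simp
  moreover have "1 \<notin> P" using P.I_notcarr P.one_imp_carrier g_one by (metis imageI)
  moreover have "J = P \<or> 1 \<in> J" if J: "tideal UNIV J" "P \<subseteq> J" for J
  proof -
    have "g ` J = g ` P \<or> g ` J = carrier R"
      using P.I_maximal[of "g ` J"] ideal_image[OF J(1)] J(2) surj by blast
    then show ?thesis
    proof
      show "?thesis" if "g ` J = g ` P" using that inj_on_image_eq_iff[OF inj, of J P] by simp
      show "?thesis" if "g ` J = carrier R"
      proof -
        have "g 1 \<in> g ` J" using that g_one by simp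
        then show ?thesis using mem_image[of J 1] by simp
      qed
    qed
  qed
  ultimately show "cmax P" by (simp add: cmax_def)
next
  assume R: "cmax P"
  show "maximalideal (g ` P) R"
  proof (rule maximalidealI)
    show "ideal (g ` P) R" using ideal_image R by (simp add: cmax_def)
    show "carrier R \<noteq> g ` P"
      using R mem_image[of P 1] g_one by (fastforce simp: cmax_def)
    fix J assume J: "ideal J R" "g ` P \<subseteq> J" "J \<subseteq> carrier R"
    obtain J' where J': "tideal UNIV J'" "J = g ` J'" using ideal_preimage[OF J(1)] by blast
    have "P \<subseteq> J'" using J(2) J'(2) image_le_iff[of P J'] by simp
    then have "J' = P \<or> J' = UNIV" using R J'(1) tideal_whole[OF tsubring_UNIV J'(1)] by (auto simp: cmax_def)
    then show "J = g ` P \<or> J = carrier R" using J'(2) surj by auto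
  qed
qed

lemma cprime_zero: "cprime {0 :: 'e}"
  using tideal_zero[OF tsubring_UNIV] by (auto simp: cprime_def)

text \<open>The last three members of a chain of length at least 2 give a nonzero prime strictly
  below P. Conversely such a prime, together with {0}, which is prime in a domain, gives a chain of
  length 2.\<close>

lemma prime_height_one_iff:
  assumes P: "cprime P"
  shows "prime_height R (g ` P) = 1 \<longleftrightarrow> P \<noteq> {0} \<and> (\<forall>Q. cprime Q \<longrightarrow> Q \<subset> P \<longrightarrow> Q = {0})"
proof -
  define H where "H = {k. \<exists>C :: nat \<Rightarrow> 'r set. (\<forall>i\<le>k. primeideal (C i) R) \<and>
                    (\<forall>i<k. C i \<subset> C (Suc i)) \<and> C k = g ` P}"
  have ph: "prime_height R (g ` P) = (SUP k\<in>H. enat k)"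
    by (simp add: prime_height_def H_def)
  have z: "{0} \<subseteq> Q" if "cprime Q" for Q :: "'e set" using that cprimeD(1) tidealD(2) by blast
  have one: "1 \<in> H \<longleftrightarrow> P \<noteq> {0}"
  proof
    assume "1 \<in> H"
    then obtain C where "\<forall>i\<le>1. primeideal (C i) R" "\<forall>i<1. C i \<subset> C (Suc i)" "C 1 = g ` P"
      unfolding H_def by blast
    then have C: "primeideal (C 0) R" "C 0 \<subset> g ` P" by (simp_all del: image_subset_iff)
    obtain Q where "cprime Q" "C 0 = g ` Q" using primeideal_preimage[OF C(1)] .
    then show "P \<noteq> {0}" using C(2) image_psubset_iff[of Q P] z[of Q] by auto
  next
    assume "P \<noteq> {0}"
    then have "{0} \<subset> P" using z[OF P] by auto
    then have "g ` {0} \<subset> g ` P" using image_psubset_iff[of "{0}" P] by simp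
    then show "1 \<in> H" unfolding H_def
      using primeideal_image[of "{0}"] primeideal_image[of P] P cprime_zero
      by (intro CollectI exI[of _ "\<lambda>i. if i = 0 then g ` {0} else g ` P"]) (auto simp: le_Suc_eq)
  qed
  show ?thesis
  proof
    assume L: "prime_height R (g ` P) = 1"
    have le: "k \<le> 1" if "k \<in> H" for k
    proof -
      have "enat k \<le> (SUP k\<in>H. enat k)" using that by (rule SUP_upper)
      then show ?thesis using L ph by (simp add: one_enat_def)
    qed
    have "1 \<in> H"
    proof (rule ccontr)
      assume n: "1 \<notin> H"
      have "k = 0" if "k \<in> H" for k using le[OF that] n that by (cases k) auto
      then have "(SUP k\<in>H. enat k) \<le> 0" by (intro SUP_least) (auto simp: zero_enat_def)
      then show False using L ph by simp
    qed
    then have 1: "P \<noteq> {0}" using one by simp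
    have "Q = {0}" if Q: "cprime Q" "Q \<subset> P" for Q
    proof (rule ccontr)
      assume "Q \<noteq> {0}"
      then have "{0} \<subset> Q" using z[OF Q(1)] by auto
      then have s: "g ` {0} \<subset> g ` Q" "g ` Q \<subset> g ` P"
        using image_psubset_iff[of "{0}" Q] image_psubset_iff[of Q P] Q by simp_all
      have "2 \<in> H" unfolding H_def
        using s primeideal_image[of "{0}"] primeideal_image[of P] primeideal_image[of Q] P Q cprime_zero
        by (intro CollectI exI[of _ "\<lambda>i. if i = 0 then g ` {0} else if i = 1 then g ` Q else g ` P"])
           (auto simp: le_Suc_eq numeral_2_eq_2 less_Suc_eq)
      then show False using le[of 2] by simp
    qed
    then show "P \<noteq> {0} \<and> (\<forall>Q. cprime Q \<longrightarrow> Q \<subset> P \<longrightarrow> Q = {0})" using 1 by blast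
  next
    assume R: "P \<noteq> {0} \<and> (\<forall>Q. cprime Q \<longrightarrow> Q \<subset> P \<longrightarrow> Q = {0})"
    have "k \<le> 1" if "k \<in> H" for k
    proof (rule ccontr)
      assume k: "\<not> k \<le> 1"
      from that obtain C where C: "\<And>i. i \<le> k \<Longrightarrow> primeideal (C i) R" "\<And>i. i < k \<Longrightarrow> C i \<subset> C (Suc i)" "C k = g ` P"
        by (auto simp: H_def)
      obtain m where m: "k = Suc (Suc m)" using k by (cases k; cases "k - 1") auto
      obtain Q0 where Q0: "cprime Q0" "C m = g ` Q0" using primeideal_preimage[OF C(1)[of m]] m by auto
      obtain Q1 where Q1: "cprime Q1" "C (Suc m) = g ` Q1" using primeideal_preimage[OF C(1)[of "Suc m"]] m by auto
      have "Q0 \<subset> Q1" "Q1 \<subset> P"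
        using C(2)[of m] C(2)[of "Suc m"] C(3) Q0 Q1 m image_psubset_iff[of Q0 Q1] image_psubset_iff[of Q1 P] by auto
      then show False using R Q1(1) z[OF Q0(1)] by auto
    qed
    then have "(SUP k\<in>H. enat k) \<le> 1" by (intro SUP_least) (auto simp: one_enat_def)
    moreover have "enat 1 \<le> (SUP k\<in>H. enat k)" using one R by (intro SUP_upper) auto
    ultimately show "prime_height R (g ` P) = 1" using ph by (simp add: one_enat_def)
  qed
qed

end

section \<open>Operators on polynomials\<close>

text \<open>As a type of their own, additive maps form a \<open>ring_1\<close> with composition as
  product, so operator identities follow from the ring laws.\<close>

typedef (overloaded) 'a endo = "{f :: 'a::comm_ring_1 \<Rightarrow> 'a. \<forall>a b. f (a + b) = f a + f b}"
  morphisms app Endo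
  by (rule exI[of _ "\<lambda>x. x"]) simp

setup_lifting type_definition_endo

lemma app_add: "app f (a + b) = app f a + app f b"
  using app[of f] by simp

lemma app_zero [simp]: "app f 0 = 0"
  using app_add[of f 0 0] by simp

lemma app_sum: "app f (sum h F) = (\<Sum>i\<in>F. app f (h i))"
  by (induction F rule: infinite_finite_induct) (auto simp: app_add)

lemma endo_eqI: "(\<And>v. app f v = app g v) \<Longrightarrow> f = g"
  by (simp add: app_inject[symmetric] fun_eq_iff)

instantiation endo :: (comm_ring_1) ring_1
begin

lift_definition zero_endo :: "'a endo" is "\<lambda>_. 0" by simp
lift_definition one_endo :: "'a endo" is "\<lambda>v. v" by simp
lift_definition plus_endo :: "'a endo \<Rightarrow> 'a endo \<Rightarrow> 'a endo" is "\<lambda>f g v. f v + g v"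
  by (simp add: algebra_simps)
lift_definition minus_endo :: "'a endo \<Rightarrow> 'a endo \<Rightarrow> 'a endo" is "\<lambda>f g v. f v - g v"
  by (simp add: algebra_simps)
lift_definition uminus_endo :: "'a endo \<Rightarrow> 'a endo" is "\<lambda>f v. - f v"
  by (simp add: algebra_simps)
lift_definition times_endo :: "'a endo \<Rightarrow> 'a endo \<Rightarrow> 'a endo" is "\<lambda>f g v. f (g v)"
  by simp

instance
proof
  show "(0 :: 'a endo) \<noteq> 1"
  proof
    assume "(0 :: 'a endo) = 1"
    then have "app (0 :: 'a endo) 1 = app 1 1" by simp
    then show False by (simp add: zero_endo.rep_eq one_endo.rep_eq)
  qed
qed (transfer; simp add: fun_eq_iff algebra_simps)+

end

lemmas app_simps [simp] = zero_endo.rep_eq one_endo.rep_eq plus_endo.rep_eq minus_endo.rep_eq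
  uminus_endo.rep_eq times_endo.rep_eq

lemma app_endo_sum: "app (sum h F) v = (\<Sum>i\<in>F. app (h i) v)"
  by (induction F rule: infinite_finite_induct) auto

lift_definition mulop :: "'a::comm_ring_1 \<Rightarrow> 'a endo" is "\<lambda>a v. a * v"
  by (simp add: algebra_simps)

lemma app_mulop [simp]: "app (mulop a) v = a * v"
  by (simp add: mulop.rep_eq)

lemma mulop_hom: "mulop (a + b) = mulop a + mulop b" "mulop (a * b) = mulop a * mulop b"
  "mulop 1 = 1" "mulop 0 = 0" "mulop (- a) = - mulop a" "mulop (a - b) = mulop a - mulop b"
  by (rule endo_eqI; simp add: algebra_simps)+

lemma mulop_power: "mulop (a ^ k) = mulop a ^ k"
  by (induction k) (auto simp: mulop_hom)

text \<open>The q-integer [k] = 1 + q + ... + q^(k-1), the coefficient of the correction term when x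
  is moved past y^k.\<close>

definition qint :: "'a::comm_ring_1 \<Rightarrow> nat \<Rightarrow> 'a" where
  "qint q k = (\<Sum>j<k. q ^ j)"

lemma qint_Suc: "qint q (Suc k) = qint q k + q ^ k"
  by (simp add: qint_def)

lemma qint_0 [simp]: "qint q 0 = 0"
  by (simp add: qint_def)

lemma qint_Suc': "qint q (Suc k) = 1 + q * qint q k"
  by (simp add: qint_def lessThan_Suc_eq_insert_0 sum_distrib_left image_iff sum.reindex del: sum.lessThan_Suc)

lemma qint_mult: "(q - 1) * qint q k = q ^ k - 1"
  by (induction k) (auto simp: qint_Suc algebra_simps)

text \<open>
  The ring acts on polynomials in \<open>Y\<close> over polynomials in \<open>X\<close>, where \<open>Y^i X^j\<close> stands for the
  normally ordered monomial; \<open>op_x\<close> is left multiplication by \<open>x\<close>, \<open>rop_y\<close> is right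
  multiplication by \<open>y\<close>.
\<close>

abbreviation cf :: "'a::zero poly poly \<Rightarrow> nat \<Rightarrow> nat \<Rightarrow> 'a" where
  "cf v i j \<equiv> coeff (coeff v i) j"

lemma cf_eqI: "(\<And>i j. cf v i j = cf w i j) \<Longrightarrow> v = w"
  by (simp add: poly_eq_iff)

abbreviation XX :: "'a::comm_ring_1 poly poly" where "XX \<equiv> [:[:0, 1:]:]"
abbreviation YY :: "'a::comm_ring_1 poly poly" where "YY \<equiv> [:0, 1:]"

lemma cf_XX: "cf (XX * v) i j = (if j = 0 then 0 else cf v i (j - 1))"
  by (cases j) (auto simp: coeff_pCons)

lemma cf_YY: "cf (YY * v) i j = (if i = 0 then 0 else cf v (i - 1) j)"
  by (cases i) (auto simp: coeff_pCons)

lift_definition qscale :: "'a::comm_ring_1 \<Rightarrow> 'a poly \<Rightarrow> 'a poly" is "\<lambda>q f i. q ^ i * f i"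
  by (erule eventually_mono) simp

text \<open>Jackson's q-derivative, sending X^k to [k] X^(k-1). With \<open>qscale\<close>, the
  substitution X -> qX, it is applied in Y to encode x y^i = q^i y^i x + [i] y^(i-1), and in X to
  encode x^j y = q^j y x^j + [j] x^(j-1).\<close>

lift_definition qderiv :: "'a::comm_ring_1 \<Rightarrow> 'a poly \<Rightarrow> 'a poly" is
  "\<lambda>q f i. qint q (Suc i) * f (Suc i)"
proof -
  fix q :: 'a and f :: "nat \<Rightarrow> 'a" assume "\<forall>\<^sub>\<infinity>n. f n = 0"
  then have "\<forall>\<^sub>\<infinity>n. f (Suc n) = 0" 
    unfolding MOST_nat by (meson less_Suc_eq)
  then show "\<forall>\<^sub>\<infinity>n. qint q (Suc n) * f (Suc n) = 0" by (rule eventually_mono) simp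
qed

lemma coeff_qscale [simp]: "coeff (qscale q p) i = q ^ i * coeff p i"
  by (simp add: qscale.rep_eq)

lemma coeff_qderiv [simp]: "coeff (qderiv q p) i = qint q (Suc i) * coeff p (Suc i)"
  by (simp add: qderiv.rep_eq)

lemma qscale_0 [simp]: "qscale q 0 = 0" and qderiv_0 [simp]: "qderiv q 0 = 0"
  by (simp_all add: poly_eq_iff)

lemma const_power: "[:q:] ^ i = [:q ^ i:]" for q :: "'a::comm_ring_1"
  by (induction i) auto

lemma const_qint: "qint [:q:] i = [:qint q i:]" for q :: "'a::comm_ring_1"
  by (induction i) (auto simp: qint_Suc const_power)

lift_definition op_x :: "'a::comm_ring_1 \<Rightarrow> 'a poly poly endo" is
  "\<lambda>q v. XX * qscale [:q:] v + qderiv [:q:] v"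
  by (auto intro!: cf_eqI simp: algebra_simps)

lift_definition rop_y :: "'a::comm_ring_1 \<Rightarrow> 'a poly poly endo" is
  "\<lambda>q v. YY * map_poly (qscale q) v + map_poly (qderiv q) v"
  by (auto intro!: cf_eqI simp: algebra_simps coeff_map_poly coeff_pCons split: nat.split)

definition op_y :: "'a::comm_ring_1 poly poly endo" where "op_y = mulop YY"
definition rop_x :: "'a::comm_ring_1 poly poly endo" where "rop_x = mulop XX"
definition op_c :: "'a::comm_ring_1 \<Rightarrow> 'a poly poly endo" where "op_c c = mulop [:[:c:]:]"

lemma cf_op_x: "cf (app (op_x q) v) i j =
    q ^ i * (if j = 0 then 0 else cf v i (j - 1)) + qint q (Suc i) * cf v (Suc i) j"
  by (cases j) (auto simp: op_x.rep_eq coeff_pCons const_power const_qint)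

lemma cf_rop_y: "cf (app (rop_y q) v) i j =
    q ^ j * (if i = 0 then 0 else cf v (i - 1) j) + qint q (Suc j) * cf v i (Suc j)"
  by (cases i) (auto simp: rop_y.rep_eq coeff_pCons coeff_map_poly)

lemma cf_op_y: "cf (app op_y v) i j = (if i = 0 then 0 else cf v (i - 1) j)"
  by (simp add: op_y_def cf_YY del: mult_pCons_left)

lemma cf_rop_x: "cf (app rop_x v) i j = (if j = 0 then 0 else cf v i (j - 1))"
  by (simp add: rop_x_def cf_XX del: mult_pCons_left)

lemma cf_op_c: "cf (app (op_c c) v) i j = c * cf v i j"
  by (simp add: op_c_def)

lemmas cf_ops = cf_op_x cf_rop_y cf_op_y cf_rop_x cf_op_c

lemma op_c_hom: "op_c (a + b) = op_c a + op_c b" "op_c (a * b) = op_c a * op_c b"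
  "op_c 1 = 1" "op_c 0 = 0" "op_c (- a) = - op_c a" "op_c (a - b) = op_c a - op_c b"
  unfolding op_c_def mulop_hom(1,2,5,6)[symmetric] by (simp_all add: mulop_hom pCons_one)

lemma op_c_commute: "op_c c * op_x q = op_x q * op_c c" "op_c c * op_y = op_y * op_c c"
  "op_c c * rop_y q = rop_y q * op_c c" "op_c c * rop_x = rop_x * op_c c"
  by (rule endo_eqI, rule cf_eqI, simp only: app_simps cf_ops, simp add: algebra_simps)+

lemma xy_rel: "op_x q * op_y = op_c q * op_y * op_x q + 1"
proof (intro endo_eqI cf_eqI)
  fix v i j
  show "cf (app (op_x q * op_y) v) i j = cf (app (op_c q * op_y * op_x q + 1) v) i j"
    by (cases i) (auto simp: cf_ops qint_Suc' algebra_simps)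
qed

lemma rop_x_commute: "rop_x * op_x q = op_x q * rop_x" "rop_x * op_y = op_y * rop_x"
  by (rule endo_eqI, rule cf_eqI, simp only: app_simps cf_ops, simp add: algebra_simps)+

lemma rop_y_commute: "rop_y q * op_x q = op_x q * rop_y q" "rop_y q * op_y = op_y * rop_y q"
proof -
  show "rop_y q * op_x q = op_x q * rop_y q"
  proof (intro endo_eqI cf_eqI)
    fix v i j
    show "cf (app (rop_y q * op_x q) v) i j = cf (app (op_x q * rop_y q) v) i j"
      by (cases i; cases j) (auto simp: cf_ops qint_Suc algebra_simps)
  qed
  show "rop_y q * op_y = op_y * rop_y q"
    by (rule endo_eqI, rule cf_eqI, simp only: app_simps cf_ops) auto
qed

inductive_set qw :: "'k::comm_ring_1 \<Rightarrow> 'k poly poly endo set" for q where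
  const: "op_c c \<in> qw q"
| x: "op_x q \<in> qw q"
| y: "op_y \<in> qw q"
| add: "a \<in> qw q \<Longrightarrow> b \<in> qw q \<Longrightarrow> a + b \<in> qw q"
| mult: "a \<in> qw q \<Longrightarrow> b \<in> qw q \<Longrightarrow> a * b \<in> qw q"

lemma tsubring_qw [simp]: "tsubring (qw q)"
  using qw.const[of 1 q] qw.const[of "-1" q] by (auto simp: tsubring_def op_c_hom qw.add qw.mult)

lemmas qwD = tsubringD[OF tsubring_qw]
lemmas qw_power = tsubring_power[OF tsubring_qw]
lemmas qw_sum = tsubring_sum[OF tsubring_qw]

text \<open>The operator form of associativity, (a m) x = a (m x) and (a m) y = a (m y). The
  operators satisfying it are closed under sums and products, so the generators suffice.\<close>

lemma qw_rop_commute: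
  assumes "a \<in> qw q"
  shows "rop_x * a = a * rop_x \<and> rop_y q * a = a * rop_y q \<and> op_c c * a = a * op_c c"
  using assms
proof (induction)
  case (mult a b)
  then show ?case by (metis mult.assoc)
qed (auto simp: op_c_commute rop_x_commute rop_y_commute op_c_hom(2)[symmetric] mult.commute algebra_simps)

lemma qw_const_commute: "a \<in> qw q \<Longrightarrow> op_c c * a = a * op_c c"
  by (simp add: qw_rop_commute)

lemma rop_power_one: "app (rop_x ^ j) (app (rop_y q ^ i) 1) = monom (monom 1 j) i"
proof -
  have "app (rop_y q ^ i) 1 = monom 1 i"
  proof (induction i)
    case (Suc i)
    have "app (rop_y q) (monom 1 i) = monom 1 (Suc i)"
      by (auto intro!: cf_eqI simp: cf_ops coeff_monom one_pCons split: if_splits) (auto simp: coeff_pCons split: nat.splits)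
    then show ?case using Suc by simp
  qed (simp add: monom_0 one_pCons)
  moreover have "app (rop_x ^ j) (monom 1 i) = monom (monom (1::'a) j) i"
  proof (induction j)
    case (Suc j)
    have "app rop_x (monom (monom 1 j) i) = monom (monom (1::'a) (Suc j)) i"
      by (auto intro!: cf_eqI simp: cf_ops coeff_monom split: if_splits)
    then show ?case using Suc by simp
  qed (simp add: monom_0 one_pCons)
  ultimately show ?thesis by simp
qed

lemma sum_cf: "v = (\<Sum>i\<le>degree v. \<Sum>j\<le>degree (coeff v i). app (op_c (cf v i j)) (monom (monom 1 j) i))"
proof -
  have 1: "app (op_c c) (monom (monom 1 j) i) = monom (monom c j) i" for c :: 'a and i j
    by (simp add: op_c_def smult_monom)
  have "v = (\<Sum>i\<le>degree v. monom (coeff v i) i)" by (simp add: poly_as_sum_of_monoms)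
  also have "\<dots> = (\<Sum>i\<le>degree v. monom (\<Sum>j\<le>degree (coeff v i). monom (cf v i j) j) i)"
    by (simp add: poly_as_sum_of_monoms)
  also have "\<dots> = (\<Sum>i\<le>degree v. \<Sum>j\<le>degree (coeff v i). monom (monom (cf v i j) j) i)"
    by (simp add: monom_sum)
  finally show ?thesis by (simp add: 1)
qed

text \<open>Every polynomial is obtained from 1 by right multiplications and scalars, and these
  commute with \<open>qw\<close>; hence the value at 1 determines an element of
  \<open>qw\<close>.\<close>

lemma qw_eqI:
  assumes "a \<in> qw q" "b \<in> qw q" "app a 1 = app b 1"
  shows "a = b"
proof (rule endo_eqI)
  fix v
  have *: "app d v = (\<Sum>i\<le>degree v. \<Sum>j\<le>degree (coeff v i).
      app (op_c (cf v i j)) (app (rop_x ^ j) (app (rop_y q ^ i) (app d 1))))" if "d \<in> qw q" for d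
  proof -
    have com: "d * op_c c = op_c c * d" for c
      using qw_rop_commute[OF that, of c] by (elim conjE) (rule sym)
    have com2: "d * rop_x ^ j = rop_x ^ j * d" for j
      by (rule sym, rule power_commuting_commutes, rule qw_rop_commute[OF that, THEN conjunct1])
    have com3: "d * rop_y q ^ i = rop_y q ^ i * d" for i
      by (rule sym, rule power_commuting_commutes, rule qw_rop_commute[OF that, THEN conjunct2, THEN conjunct1])
    have "app d (app (op_c c) (monom (monom 1 j) i)) =
       app (op_c c) (app (rop_x ^ j) (app (rop_y q ^ i) (app d 1)))" for c i j
    proof -
      have "d * (op_c c * (rop_x ^ j * rop_y q ^ i)) = op_c c * (rop_x ^ j * (rop_y q ^ i * d))"
        by (simp only: mult.assoc[symmetric] com) (simp only: mult.assoc com2 com3)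
      then have "app (d * (op_c c * (rop_x ^ j * rop_y q ^ i))) 1 =
          app (op_c c * (rop_x ^ j * (rop_y q ^ i * d))) 1" by simp
      then show ?thesis by (simp add: rop_power_one)
    qed
    then show ?thesis by (subst sum_cf[of v]) (simp add: app_sum)
  qed
  show "app a v = app b v" using *[OF assms(1)] *[OF assms(2)] assms(3) by simp
qed

text \<open>This gives the independence half of the PBW theorem: distinct ordered monomials have
  distinct basis vectors as values at 1.\<close>

lemma nf_app: "app (op_y ^ i * op_x q ^ j) 1 = monom (monom 1 j) i"
proof -
  have "app (op_x q ^ j) 1 = monom (monom 1 j) 0"
  proof (induction j)
    case (Suc j)
    have "app (op_x q) (monom (monom 1 j) 0) = monom (monom (1::'a) (Suc j)) 0"
      by (auto intro!: cf_eqI simp: cf_ops coeff_monom split: if_splits)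
    then show ?case using Suc by simp
  qed (simp add: monom_0 one_pCons)
  moreover have "app (op_y ^ i) v = monom 1 i * v" for v :: "'a poly poly"
    by (simp add: op_y_def mulop_power[symmetric] monom_altdef)
  ultimately show ?thesis by (simp add: mult_monom)
qed

section \<open>The quotient of the free algebra as an operator ring\<close>

lemma free_alg_induct [case_names single add]:
  fixes f :: "'k::field free_alg"
  assumes "\<And>w c. Q (Poly_Mapping.single w c)" "\<And>f g. Q f \<Longrightarrow> Q g \<Longrightarrow> Q (f + g)"
  shows "Q f"
proof -
  have eq: "f = (\<Sum>w\<in>Poly_Mapping.keys f. Poly_Mapping.single w (Poly_Mapping.lookup f w))"
    by (rule poly_mapping_eqI) (auto simp: lookup_sum lookup_single when_def in_keys_iff)
  have "Q (\<Sum>w\<in>F. Poly_Mapping.single w (Poly_Mapping.lookup f w))" if "finite F" for F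
    using that
  proof (induction F)
    case empty
    show ?case using assms(1)[of 0 0] by simp
  qed (auto intro: assms)
  then show ?thesis by (subst eq) simp
qed

lemma free_const_hom: "free_const (a + b) = free_const a + free_const b"
  "free_const (a * b) = free_const a * free_const b" "free_const 1 = 1" "free_const 0 = 0"
  by (simp_all add: free_const_def single_add mult_single)

lemma free_const_commute: "free_const c * f = f * free_const c"
  by (induction f rule: free_alg_induct) (auto simp: free_const_def mult_single algebra_simps)

definition letter_val :: "'k::field \<Rightarrow> letter \<Rightarrow> 'k poly poly endo" where
  "letter_val q l = (case l of Letter_x \<Rightarrow> op_x q | Letter_y \<Rightarrow> op_y)"

definition word_val :: "'k::field \<Rightarrow> word \<Rightarrow> 'k poly poly endo" where
  "word_val q w = foldr (\<lambda>l a. letter_val q l * a) (letters w) 1"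

lemma word_val_add: "word_val q (v + w) = word_val q v * word_val q w"
proof -
  have "foldr (\<lambda>l a. letter_val q l * a) us b = foldr (\<lambda>l a. letter_val q l * a) us 1 * b" for us b
    by (induction us) (auto simp: mult.assoc)
  from this[of "letters v" "word_val q w"] show ?thesis by (simp add: word_val_def plus_word_def)
qed

lemma word_val_0 [simp]: "word_val q 0 = 1"
  by (simp add: word_val_def zero_word_def)

lemma word_val_in: "word_val q w \<in> qw q"
proof -
  have "foldr (\<lambda>l a. letter_val q l * a) us 1 \<in> qw q" for us
    by (induction us) (auto simp: letter_val_def qwD(1) intro!: qw.mult qw.x qw.y split: letter.splits)
  then show ?thesis by (simp add: word_val_def)
qed

definition rep :: "'k::field \<Rightarrow> 'k free_alg \<Rightarrow> 'k poly poly endo" where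
  "rep q f = (\<Sum>w\<in>Poly_Mapping.keys f. op_c (Poly_Mapping.lookup f w) * word_val q w)"

lemma rep_superset:
  assumes "finite F" "Poly_Mapping.keys f \<subseteq> F"
  shows "rep q f = (\<Sum>w\<in>F. op_c (Poly_Mapping.lookup f w) * word_val q w)"
  unfolding rep_def
  by (rule sum.mono_neutral_left) (use assms in \<open>auto simp: in_keys_iff op_c_hom\<close>)

lemma rep_add: "rep q (f + g) = rep q f + rep q g"
proof -
  let ?F = "Poly_Mapping.keys f \<union> Poly_Mapping.keys g"
  have *: "rep q h = (\<Sum>w\<in>?F. op_c (Poly_Mapping.lookup h w) * word_val q w)"
    if "Poly_Mapping.keys h \<subseteq> ?F" for h
    using that by (intro rep_superset) auto
  show ?thesis
    using *[of f] *[of g] *[of "f + g"] Poly_Mapping.keys_add[of f g]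
    by (auto simp: lookup_add op_c_hom distrib_right sum.distrib)
qed

lemma rep_single: "rep q (Poly_Mapping.single w c) = op_c c * word_val q w"
  by (auto simp: rep_def op_c_hom)

lemma rep_mult: "rep q (f * g) = rep q f * rep q g"
proof (induction f rule: free_alg_induct)
  case (single v c)
  show ?case
  proof (induction g rule: free_alg_induct)
    case (single w d)
    have "op_c c * op_c d * (word_val q v * word_val q w) = op_c c * (op_c d * word_val q v) * word_val q w"
      by (simp add: mult.assoc)
    also have "\<dots> = op_c c * (word_val q v * op_c d) * word_val q w"
      by (simp only: qw_const_commute[OF word_val_in])
    also have "\<dots> = op_c c * word_val q v * (op_c d * word_val q w)"
      by (simp only: mult.assoc)
    finally show ?case
      by (simp add: mult_single rep_single word_val_add op_c_hom)
  qed (simp add: rep_add distrib_left)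
qed (simp add: rep_add distrib_right)

lemma rep_simps [simp]: "rep q gen_x = op_x q" "rep q gen_y = op_y" "rep q (free_const c) = op_c c"
  "rep q 0 = 0" "rep q 1 = 1"
proof -
  show "rep q gen_x = op_x q" "rep q gen_y = op_y"
    by (simp_all add: gen_x_def gen_y_def rep_single word_val_def letter_val_def op_c_hom)
  show *: "rep q (free_const c) = op_c c" for c by (simp add: free_const_def rep_single)
  from *[of 0] *[of 1] show "rep q 0 = 0" "rep q 1 = 1" by (simp_all add: free_const_hom op_c_hom)
qed

lemma rep_diff: "rep q (f - g) = rep q f - rep q g"
  using rep_add[of q "f - g" g] by (simp add: algebra_simps)

lemma rep_in: "rep q f \<in> qw q"
  by (induction f rule: free_alg_induct) (auto simp: rep_single rep_add intro: qw.intros word_val_in)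

lemma rep_surj: "range (rep q) = qw q"
proof
  show "qw q \<subseteq> range (rep q)"
  proof
    fix a assume "a \<in> qw q"
    then show "a \<in> range (rep q)"
    proof (induction)
      case (const c)
      from rangeI[of "rep q" "free_const c"] show ?case by simp
    next
      case x
      from rangeI[of "rep q" gen_x] show ?case by simp
    next
      case y
      from rangeI[of "rep q" gen_y] show ?case by simp
    next
      case (add a b)
      then obtain f g where "a = rep q f" "b = rep q g" by auto
      then show ?case by (simp add: rep_add[symmetric])
    next
      case (mult a b)
      then obtain f g where "a = rep q f" "b = rep q g" by auto
      then show ?case by (simp add: rep_mult[symmetric])
    qed
  qed
qed (auto simp: rep_in)

lemma ring_free_algebra: "ring (free_algebra :: ('k::field) free_alg ring)"
proof -
  have "\<exists>g. g + f = 0" for f :: "'k free_alg" by (rule exI[of _ "- f"]) simp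
  then show ?thesis
    by (intro ringI abelian_groupI monoidI) (auto simp: free_algebra_def algebra_simps)
qed

interpretation FA: ring_model "free_algebra :: ('k::field) free_alg ring" UNIV "\<lambda>f. f"
  using ring_free_algebra
  by (auto simp: ring_model_def ring_model_axioms_def free_algebra_def bij_betw_def)

definition qrel :: "'k::field \<Rightarrow> 'k free_alg" where
  "qrel q = gen_x * gen_y - free_const q * gen_y * gen_x - 1"

lemma qWeyl_relations_tgen: "qWeyl_relations q = tgen UNIV {qrel q}"
  using FA.genideal_image[of "{qrel q}"] by (simp add: qWeyl_relations_def qrel_def)

lemma tideal_relations: "tideal UNIV (qWeyl_relations q)"
  unfolding qWeyl_relations_tgen by (rule tideal_tgen) auto

lemma rep_relations: "f \<in> qWeyl_relations q \<Longrightarrow> rep q f = 0"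
proof -
  have "tideal UNIV {f. rep q f = 0}"
    by (auto simp: tideal_def rep_add rep_mult)
  moreover have "rep q (qrel q) = 0"
    by (simp add: qrel_def rep_diff rep_mult xy_rel)
  ultimately have "qWeyl_relations q \<subseteq> {f. rep q f = 0}"
    unfolding qWeyl_relations_tgen by (intro tgen_least) auto
  then show "f \<in> qWeyl_relations q \<Longrightarrow> rep q f = 0" by blast
qed

definition bnd :: "'a::zero poly poly \<Rightarrow> nat \<Rightarrow> bool" where
  "bnd v N \<longleftrightarrow> (\<forall>i j. N \<le> i \<or> N \<le> j \<longrightarrow> cf v i j = 0)"

lemma bnd_mono: "bnd v N \<Longrightarrow> N \<le> M \<Longrightarrow> bnd v M"
  unfolding bnd_def by (meson order_trans)

lemma ex_bnd: "\<exists>N. bnd v N"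
proof (induction v)
  case 0
  show ?case by (auto simp: bnd_def)
next
  case (pCons a v)
  then obtain N where N: "bnd v N" by blast
  have "bnd (pCons a v) (Suc (max N (degree a)))"
    using N by (auto simp: bnd_def coeff_pCons coeff_eq_0 split: nat.splits)
  then show ?case by blast
qed

text \<open>Lifts a polynomial to a combination of ordered words in the free algebra. The bound is
  an arbitrary choice; by \<open>normal_form_eq\<close> every valid bound gives the same
  lift.\<close>

definition normal_form :: "'k::field poly poly \<Rightarrow> 'k free_alg" where
  "normal_form v = (let N = (SOME N. bnd v N) in
     \<Sum>i<N. \<Sum>j<N. free_const (cf v i j) * (gen_y ^ i * gen_x ^ j))"

lemma double_sum_mono_neutral:
  fixes f :: "nat \<Rightarrow> nat \<Rightarrow> 'b::comm_monoid_add"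
  assumes "N \<le> M" "\<And>i j. N \<le> i \<or> N \<le> j \<Longrightarrow> f i j = 0"
  shows "(\<Sum>i<M. \<Sum>j<M. f i j) = (\<Sum>i<N. \<Sum>j<N. f i j)"
proof -
  have "(\<Sum>i<M. \<Sum>j<M. f i j) = (\<Sum>i<N. \<Sum>j<M. f i j)"
    using assms by (intro sum.mono_neutral_right) auto
  also have "\<dots> = (\<Sum>i<N. \<Sum>j<N. f i j)"
    using assms by (intro sum.cong sum.mono_neutral_right) auto
  finally show ?thesis .
qed

lemma normal_form_eq:
  assumes "bnd v M"
  shows "normal_form v = (\<Sum>i<M. \<Sum>j<M. free_const (cf v i j) * (gen_y ^ i * gen_x ^ j))"
proof -
  define N where "N = (SOME N. bnd v N)"
  have N: "bnd v N" unfolding N_def using ex_bnd by (rule someI_ex)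
  have z: "bnd v K \<Longrightarrow> K \<le> i \<or> K \<le> j \<Longrightarrow> free_const (cf v i j) * (gen_y ^ i * gen_x ^ j) = 0" for K i j
    by (auto simp: bnd_def free_const_hom)
  have "(\<Sum>i<max N M. \<Sum>j<max N M. free_const (cf v i j) * (gen_y ^ i * gen_x ^ j)) =
        (\<Sum>i<K. \<Sum>j<K. free_const (cf v i j) * (gen_y ^ i * gen_x ^ j))" if "K = N \<or> K = M" for K
    using that z N assms by (intro double_sum_mono_neutral) auto
  from this[of N] this[of M] show ?thesis by (simp add: normal_form_def N_def[symmetric] Let_def)
qed

lemma normal_form_add: "normal_form (v + w) = normal_form v + normal_form w"
proof -
  obtain N M where "bnd v N" "bnd w M" using ex_bnd by metis
  then have b: "bnd v (max N M)" "bnd w (max N M)" by (auto intro: bnd_mono)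
  then have "bnd (v + w) (max N M)" by (auto simp: bnd_def)
  then show ?thesis
    using b by (simp add: normal_form_eq free_const_hom distrib_right sum.distrib)
qed

lemma normal_form_monom: "normal_form (monom (monom c j) i) = free_const c * (gen_y ^ i * gen_x ^ j)"
proof -
  have "bnd (monom (monom c j) i) (Suc (max i j))" by (auto simp: bnd_def coeff_monom)
  then have "normal_form (monom (monom c j) i) = (\<Sum>i'<Suc (max i j). \<Sum>j'<Suc (max i j).
      free_const (cf (monom (monom c j) i) i' j') * (gen_y ^ i' * gen_x ^ j'))"
    by (rule normal_form_eq)
  also have "\<dots> = (\<Sum>i'<Suc (max i j). if i = i' then
     (\<Sum>j'<Suc (max i j). if j = j' then free_const c * (gen_y ^ i' * gen_x ^ j') else 0) else 0)"
    by (rule sum.cong[OF refl])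
       (simp add: coeff_monom free_const_hom if_distrib[of free_const] if_distrib[of "\<lambda>a. a * _"] cong: if_cong del: sum.lessThan_Suc)
  also have "\<dots> = free_const c * (gen_y ^ i * gen_x ^ j)"
    by (simp add: sum.delta' less_Suc_eq_le del: sum.lessThan_Suc)
  finally show ?thesis .
qed

lemma bipoly_induct [case_names monom add]:
  fixes v :: "'a::comm_ring_1 poly poly"
  assumes "\<And>c i j. Q (monom (monom c j) i)" "\<And>v w. Q v \<Longrightarrow> Q w \<Longrightarrow> Q (v + w)"
  shows "Q v"
proof -
  have z: "Q 0" using assms(1)[of 0 0 0] by simp
  have s: "(\<And>i. i \<in> F \<Longrightarrow> Q (h i)) \<Longrightarrow> Q (sum h F)" for h :: "nat \<Rightarrow> 'a poly poly" and F
    by (induction F rule: infinite_finite_induct) (auto intro: assms z)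
  have "app (op_c c) (monom (monom 1 j) i) = monom (monom c j) i" for c :: 'a and i j
    by (simp add: op_c_def smult_monom)
  then show ?thesis by (subst sum_cf[of v]) (auto intro!: s assms(1))
qed

lemma free_const_simps:
  "gen_x * (free_const c * f) = free_const c * (gen_x * f)"
  "gen_y * (free_const c * f) = free_const c * (gen_y * f)"
  "gen_x * free_const c = free_const c * gen_x" "gen_y * free_const c = free_const c * gen_y"
  "free_const c * (free_const d * f) = free_const (c * d) * f"
proof -
  have "g * (free_const c * f) = free_const c * (g * f)" for g
    by (metis free_const_commute mult.assoc)
  then show "gen_x * (free_const c * f) = free_const c * (gen_x * f)"
    "gen_y * (free_const c * f) = free_const c * (gen_y * f)" by auto
qed (rule free_const_commute[symmetric], rule free_const_commute[symmetric],
     simp add: free_const_hom mult.assoc)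

text \<open>The straightening rule holds modulo the relation before any quotient is formed. At i = 0
  the truncated exponent i - 1 is harmless, its coefficient [0] being zero.\<close>

lemma x_y_power_mod:
  fixes q :: "'k::field"
  shows "gen_x * gen_y ^ i -
    (free_const (q ^ i) * gen_y ^ i * gen_x + free_const (qint q i) * gen_y ^ (i - 1)) \<in> qWeyl_relations q"
proof (induction i)
  case 0
  show ?case using tidealD(2)[OF tideal_relations] by (simp add: free_const_hom)
next
  case (Suc i)
  let ?J = "qWeyl_relations q"
  let ?e = "gen_x * gen_y ^ i - (free_const (q ^ i) * gen_y ^ i * gen_x + free_const (qint q i) * gen_y ^ (i - 1))"
  have "free_const (q * qint q i) * (gen_y * gen_y ^ (i - 1)) = free_const (q * qint q i) * gen_y ^ i"
    by (cases i) (auto simp: free_const_hom)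
  \<comment> \<open>One use of the relation moves x past the first y; the error from the induction
    hypothesis is then multiplied by q y.\<close>
  then have "gen_x * gen_y ^ Suc i -
    (free_const (q ^ Suc i) * gen_y ^ Suc i * gen_x + free_const (qint q (Suc i)) * gen_y ^ (Suc i - 1)) =
    qrel q * gen_y ^ i + (free_const q * gen_y) * ?e"
    by (simp add: qrel_def algebra_simps qint_Suc' free_const_hom(1,3,4) free_const_simps)
  moreover have "qrel q \<in> ?J" using tgen_incl[of "{qrel q}" UNIV] by (simp add: qWeyl_relations_tgen)
  ultimately show ?case using Suc tidealD[OF tideal_relations[of q]] by simp
qed

text \<open>The f with this property for all v are closed under sums and products, so constants and
  letters suffice, and only x uses the relation. At v = 1 it says that f is congruent to the normal
  form of \<open>app (rep q f) 1\<close>; so the kernel of \<open>rep\<close> is no larger than the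
  relation ideal.\<close>

lemma mult_normal_form:
  fixes q :: "'k::field"
  shows "f * normal_form v - normal_form (app (rep q f) v) \<in> qWeyl_relations q"
proof -
  let ?J = "qWeyl_relations q"
  note J = tidealD[OF tideal_relations[of q]]
  define G where "G = {f. \<forall>v. f * normal_form v - normal_form (app (rep q f) v) \<in> ?J}"
  have add: "f + g \<in> G" if "f \<in> G" "g \<in> G" for f g
  proof -
    have "(f + g) * normal_form v - normal_form (app (rep q (f + g)) v) =
      (f * normal_form v - normal_form (app (rep q f) v)) + (g * normal_form v - normal_form (app (rep q g) v))" for v
      by (simp add: algebra_simps rep_add normal_form_add)
    then show ?thesis using that J(3) by (simp add: G_def)
  qed
  have mult: "f * g \<in> G" if "f \<in> G" "g \<in> G" for f g
  proof -
    have "f * g * normal_form v - normal_form (app (rep q (f * g)) v) =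
      f * (g * normal_form v - normal_form (app (rep q g) v)) +
      (f * normal_form (app (rep q g) v) - normal_form (app (rep q f) (app (rep q g) v)))" for v
      by (simp add: algebra_simps rep_mult)
    then show ?thesis using that J(3,5) by (simp add: G_def)
  qed
  have monoms: "f \<in> G" if "\<And>c i j. f * normal_form (monom (monom c j) i) - normal_form (app (rep q f) (monom (monom c j) i)) \<in> ?J" for f
  proof -
    have "f * normal_form v - normal_form (app (rep q f) v) \<in> ?J" for v
    proof (induction v rule: bipoly_induct)
      case (add v w)
      have "f * normal_form (v + w) - normal_form (app (rep q f) (v + w)) =
       (f * normal_form v - normal_form (app (rep q f) v)) + (f * normal_form w - normal_form (app (rep q f) w))"
        by (simp add: algebra_simps normal_form_add app_add)
      then show ?case using add J(3) by simp
    qed (rule that)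
    then show ?thesis by (simp add: G_def)
  qed
  have const: "free_const d \<in> G" for d
  proof (rule monoms)
    fix c :: 'k and i j
    have "app (op_c d) (monom (monom c j) i) = monom (monom (d * c) j) i"
      by (simp add: op_c_def smult_monom)
    then show "free_const d * normal_form (monom (monom c j) i) - normal_form (app (rep q (free_const d)) (monom (monom c j) i)) \<in> ?J"
      using J(2) by (simp add: normal_form_monom free_const_hom mult.assoc)
  qed
  have y: "gen_y \<in> G"
  proof (rule monoms)
    fix c :: 'k and i j
    have "app op_y (monom (monom c j) i) = monom (monom c j) (Suc i)"
      by (simp add: op_y_def monom_Suc)
    then show "gen_y * normal_form (monom (monom c j) i) - normal_form (app (rep q gen_y) (monom (monom c j) i)) \<in> ?J"
      using J(2) by (simp add: normal_form_monom free_const_simps mult.assoc)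
  qed
  have x: "gen_x \<in> G"
  proof (rule monoms)
    fix d :: 'k and i j
    let ?e = "gen_x * gen_y ^ i - (free_const (q ^ i) * gen_y ^ i * gen_x + free_const (qint q i) * gen_y ^ (i - 1))"
    have "app (op_x q) (monom (monom d j) i) =
       monom (monom (q ^ i * d) (Suc j)) i + monom (monom (qint q i * d) j) (i - 1)"
      by (rule cf_eqI) (cases i; auto simp: cf_ops coeff_monom)
    then have "gen_x * normal_form (monom (monom d j) i) - normal_form (app (rep q gen_x) (monom (monom d j) i)) =
       free_const d * (?e * gen_x ^ j)"
      by (simp add: normal_form_monom normal_form_add algebra_simps free_const_simps)
    then show "gen_x * normal_form (monom (monom d j) i) - normal_form (app (rep q gen_x) (monom (monom d j) i)) \<in> ?J"
      using J(5)[OF J(4)[OF x_y_power_mod UNIV_I] UNIV_I, of "free_const d" i "gen_x ^ j"] by (simp only: rep_simps)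
  qed
  have "f \<in> G"
  proof (induction f rule: free_alg_induct)
    case (single w c)
    have "Poly_Mapping.single (Word us) 1 \<in> G" for us
    proof (induction us)
      case Nil
      show ?case using const[of 1] by (simp add: free_const_def zero_word_def)
    next
      case (Cons l us)
      have "Poly_Mapping.single (Word (l # us)) 1 =
         (Poly_Mapping.single (Word [l]) 1 * Poly_Mapping.single (Word us) 1 :: 'k free_alg)"
        by (simp add: mult_single plus_word_def)
      moreover have "Poly_Mapping.single (Word [l]) 1 \<in> G"
        using x y by (cases l) (auto simp: gen_x_def gen_y_def)
      ultimately show ?case using Cons mult by simp
    qed
    from mult[OF const[of c] this[of "letters w"]] show ?case
      by (simp add: free_const_def mult_single)
  qed (rule add)
  then show ?thesis by (simp add: G_def)
qed

lemma rep_eq_0_iff: "rep q f = 0 \<longleftrightarrow> f \<in> qWeyl_relations q"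
proof
  assume "rep q f = 0"
  moreover have "normal_form 0 = (0 :: 'a free_alg)" using normal_form_add[of "0 :: 'a poly poly" 0] by simp
  moreover have "normal_form 1 = (1 :: 'a free_alg)"
    using normal_form_monom[of "1 :: 'a" 0 0] by (simp add: monom_0 one_pCons free_const_hom)
  ultimately show "f \<in> qWeyl_relations q" using mult_normal_form[of f 1 q] by simp
qed (rule rep_relations)

text \<open>The cosets of the relations are the fibres of \<open>rep\<close>.\<close>

definition qw_iso :: "'k::field \<Rightarrow> 'k poly poly endo \<Rightarrow> 'k free_alg set" where
  "qw_iso q a = {f. rep q f = a}"

lemma qWeyl_class_eq: "qWeyl_class q f = qw_iso q (rep q f)"
proof -
  have "g \<in> qWeyl_class q f \<longleftrightarrow> g - f \<in> qWeyl_relations q" for g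
    by (auto simp: qWeyl_class_def a_r_coset_def' free_algebra_def) (metis add_diff_cancel diff_add_cancel)
  then show ?thesis by (auto simp: qw_iso_def rep_eq_0_iff[symmetric] rep_diff)
qed

lemma ideal_relations: "ideal (qWeyl_relations q) free_algebra"
  using FA.ideal_image[OF tideal_relations[of q]] by simp

lemma qWeyl_model:
  fixes q :: "'k::field"
  shows "ring_model (qWeyl q) (qw q) (qw_iso q)"
proof -
  interpret J: ideal "qWeyl_relations q" free_algebra by (rule ideal_relations)
  have A: "ring (qWeyl q)" unfolding qWeyl_def by (rule J.quotient_is_ring)
  have car: "carrier (qWeyl q) = range (qWeyl_class q)"
    by (auto simp: qWeyl_def FactRing_def A_RCOSETS_def' qWeyl_class_def free_algebra_def)
  have "qw_iso q ` qw q = carrier (qWeyl q)"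
    unfolding car rep_surj[symmetric] by (auto simp: qWeyl_class_eq)
  moreover have "inj_on (qw_iso q) (qw q)"
    unfolding inj_on_def rep_surj[symmetric] by (auto simp: qw_iso_def)
  ultimately have bij: "bij_betw (qw_iso q) (qw q) (carrier (qWeyl q))"
    by (simp add: bij_betw_def)
  have pre: "\<exists>f. a = rep q f" if "a \<in> qw q" for a using that rep_surj[of q] by blast
  have cl: "qw_iso q (rep q f) = a_r_coset free_algebra (qWeyl_relations q) f" for f
    using qWeyl_class_eq[of q f] by (simp add: qWeyl_class_def)
  let ?F = "free_algebra :: 'k free_alg ring"
  have F: "carrier ?F = UNIV" "add ?F = (+)" "mult ?F = (*)" "one ?F = 1"
    by (simp_all add: free_algebra_def)
  show ?thesis
    unfolding ring_model_def ring_model_axioms_def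
  proof (intro conjI allI impI A tsubring_qw bij)
    fix a b assume "a \<in> qw q" "b \<in> qw q"
    then obtain f g where fg: "a = rep q f" "b = rep q g" using pre by metis
    show "qw_iso q (a + b) = qw_iso q a \<oplus>\<^bsub>qWeyl q\<^esub> qw_iso q b"
      using J.a_rcos_sum[of f g] unfolding F
      by (simp add: fg rep_add[symmetric] cl qWeyl_def FactRing_def)
    show "qw_iso q (a * b) = qw_iso q a \<otimes>\<^bsub>qWeyl q\<^esub> qw_iso q b"
      using J.rcoset_mult_add[of f g] unfolding F
      by (simp add: fg rep_mult[symmetric] cl qWeyl_def FactRing_def)
  next
    show "qw_iso q 1 = \<one>\<^bsub>qWeyl q\<^esub>"
      using cl[of 1] F by (simp add: qWeyl_def FactRing_def)
  qed
qed

lemma qw_iso_gens: "qWeyl_x q = qw_iso q (op_x q)" "qWeyl_y q = qw_iso q op_y"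
  "qWeyl_const q c = qw_iso q (op_c c)"
  by (simp_all add: qWeyl_x_def qWeyl_y_def qWeyl_const_def qWeyl_class_eq)

section \<open>Primes of the polynomial ring in two variables\<close>

lemma tideal_dvd: "tideal UNIV {f :: 'a::comm_ring_1. a dvd f}"
  by (auto simp: tideal_def)

lemma tgen_single: "tgen UNIV {a :: 'a::comm_ring_1} = {f. a dvd f}"
proof (rule tgen_eqI[OF tideal_dvd])
  fix J :: "'a set" assume "tideal UNIV J" "{a} \<subseteq> J"
  then show "{f. a dvd f} \<subseteq> J" by (auto elim!: dvdE intro: cideal_mult)
qed simp

lemma dvd_set_nonzero: "a \<noteq> 0 \<Longrightarrow> {f :: 'a::comm_ring_1. a dvd f} \<noteq> {0}"
  by (metis dvd_refl mem_Collect_eq singletonD)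

lemma cprime_dvd: "prime_elem (a :: 'a::idom) \<Longrightarrow> cprime {f. a dvd f}"
  using tideal_dvd[of a] by (auto simp: cprime_def prime_elem_def)

lemma cprime_contract:
  fixes \<phi> :: "'a::comm_ring_1 \<Rightarrow> 'b::comm_ring_1"
  assumes "\<And>a b. \<phi> (a + b) = \<phi> a + \<phi> b" "\<And>a b. \<phi> (a * b) = \<phi> a * \<phi> b" "\<phi> 1 = 1" "\<phi> 0 = 0"
    and "cprime P"
  shows "cprime {a. \<phi> a \<in> P}"
proof -
  note P = cprimeD[OF assms(5)] and T = tidealD[OF cprimeD(1)[OF assms(5)]]
  have "tideal UNIV {a. \<phi> a \<in> P}" using T assms by (auto simp: tideal_def)
  then show ?thesis using P assms by (auto simp: cprime_def)
qed

lemma ideal_plus: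
  fixes I :: "'a::comm_ring_1 set"
  assumes "tideal UNIV I"
  shows "tideal UNIV {e + u * w | e u. e \<in> I}"
proof -
  note I = tidealD[OF assms]
  show ?thesis
    unfolding tideal_def
  proof (intro conjI ballI)
    show "0 \<in> {e + u * w | e u. e \<in> I}" using I(2) by (auto intro!: exI[of _ 0])
  next
    fix a b assume "a \<in> {e + u * w | e u. e \<in> I}" "b \<in> {e + u * w | e u. e \<in> I}"
    then obtain e u e' u' where "a = e + u * w" "b = e' + u' * w" "e \<in> I" "e' \<in> I" by blast
    then have "a + b = (e + e') + (u + u') * w" "e + e' \<in> I" using I by (auto simp: algebra_simps)
    then show "a + b \<in> {e + u * w | e u. e \<in> I}" by blast
  next
    fix a b assume "a \<in> {e + u * w | e u. e \<in> I}"
    then obtain e u where "a = e + u * w" "e \<in> I" by blast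
    then have "a * b = e * b + (u * b) * w" "e * b \<in> I" by (simp add: algebra_simps, intro I(4) UNIV_I)
    then show "a * b \<in> {e + u * w | e u. e \<in> I}" "b * a \<in> {e + u * w | e u. e \<in> I}"
      by (auto simp: mult.commute[of b a])
  qed simp
qed

lemma cmaxI:
  assumes "tideal UNIV P" "1 \<notin> P" "\<And>w. w \<notin> P \<Longrightarrow> \<exists>e u. e \<in> P \<and> 1 = e + u * w"
  shows "cmax P"
  unfolding cmax_def
proof (intro conjI allI impI assms)
  fix J assume J: "tideal UNIV J" "P \<subseteq> J"
  show "J = P \<or> 1 \<in> J"
  proof (cases "J \<subseteq> P")
    case False
    then obtain w where w: "w \<in> J" "w \<notin> P" by blast
    from assms(3)[OF w(2)] obtain e u where "e \<in> P" "1 = e + u * w" by blast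
    moreover from this have "e + u * w \<in> J"
      using J(2) w(1) by (intro tidealD(3,5)[OF J(1)]) auto
    ultimately show ?thesis by simp
  qed (use J in auto)
qed

lemma cmax_coprime:
  assumes "cmax P" "w \<notin> P"
  shows "\<exists>e u. e \<in> P \<and> 1 = e + u * w"
proof -
  have P: "tideal UNIV P" using assms(1) by (simp add: cmax_def)
  let ?J = "{e + u * w | e u. e \<in> P}"
  have "x \<in> ?J" if "x \<in> P" for x using that by (intro CollectI exI[of _ x] exI[of _ 0]) simp
  then have "P \<subseteq> ?J" by (rule subsetI)
  moreover have "w \<in> ?J" using tidealD(2)[OF P] by (intro CollectI exI[of _ 0] exI[of _ 1]) simp
  ultimately have "1 \<in> ?J" using assms ideal_plus[OF P] unfolding cmax_def by blast
  then show ?thesis by blast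
qed

lemma poly_ideal_principal:
  fixes I :: "'k::field poly set"
  assumes I: "tideal UNIV I"
  shows "\<exists>f. I = {g. f dvd g}"
proof (cases "I = {0}")
  case True
  then show ?thesis by (intro exI[of _ 0]) auto
next
  case False
  then have "\<exists>f. f \<in> I \<and> f \<noteq> 0" using tidealD(2)[OF I] by blast
  then obtain f where f: "f \<in> I" "f \<noteq> 0" and min: "\<And>g. degree g < degree f \<Longrightarrow> \<not> (g \<in> I \<and> g \<noteq> 0)"
    using exists_least_iff[of "\<lambda>d. \<exists>f. f \<in> I \<and> f \<noteq> 0 \<and> degree f = d"] by blast
  have "f dvd g" if "g \<in> I" for g
  proof -
    have "g mod f \<in> I"
      using cideal_diff[OF I that cideal_mult(1)[OF I f(1), of "g div f"]]
      by (simp add: minus_mult_div_eq_mod)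
    then have "g mod f = 0" using min[of "g mod f"] degree_mod_less[OF f(2), of g] by blast
    then show ?thesis by (simp add: mod_eq_0_iff_dvd)
  qed
  then show ?thesis using f(1) cideal_mult(1)[OF I] by (intro exI[of _ f]) (auto elim!: dvdE)
qed

lemma Irr_mD: "f \<in> Irr_m \<Longrightarrow> prime_elem f" "f \<in> Irr_m \<Longrightarrow> lead_coeff f = 1" "f \<in> Irr_m \<Longrightarrow> f \<noteq> 0"
  using field_poly_irreducible_imp_prime by (auto simp: Irr_m_def)

lemma Irr_m_dvd_imp_eq:
  assumes "f \<in> Irr_m" "g \<in> Irr_m" "f dvd g"
  shows "f = g"
proof -
  obtain u where u: "g = f * u" using assms(3) by (auto elim: dvdE)
  have "\<not> f dvd 1" "f dvd 1 \<or> u dvd 1"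
    using assms u by (auto simp: Irr_m_def irreducible_def)
  moreover have l: "lead_coeff u = 1" using assms u by (auto simp: Irr_m_def lead_coeff_mult)
  ultimately have "degree u = 0" using is_unit_iff_degree[of u] by (cases "u = 0") auto
  then obtain c where "u = [:c:]" by (elim degree_eq_zeroE)
  moreover note l
  ultimately show ?thesis using u by (simp add: one_pCons[symmetric])
qed

lemma X_Irr_m: "[:0, 1 :: 'k::field:] \<in> Irr_m"
  by (auto simp: Irr_m_def intro: irreducible_linear_field_poly)

lemma irreducible_const_factor:
  fixes f :: "'k::field poly"
  assumes "irreducible f"
  shows "smult (inverse (lead_coeff f)) f \<in> Irr_m" "{g. smult (inverse (lead_coeff f)) f dvd g} = {g. f dvd g}"
proof -
  have "f \<noteq> 0" using assms by auto
  then show "{g. smult (inverse (lead_coeff f)) f dvd g} = {g. f dvd g}" by (simp add: smult_dvd_iff)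
  have "irreducible ([:inverse (lead_coeff f):] * f)"
    using assms \<open>f \<noteq> 0\<close> by (subst irreducible_mult_unit_left) (auto simp: is_unit_const_poly_iff dvd_field_iff)
  then show "smult (inverse (lead_coeff f)) f \<in> Irr_m" using \<open>f \<noteq> 0\<close> by (simp add: Irr_m_def)
qed

lemma cprime_poly_cases:
  fixes P :: "'k::field poly set"
  assumes "cprime P"
  obtains "P = {0}" | f where "f \<in> Irr_m" "P = {g. f dvd g}"
proof -
  note P = cprimeD[OF assms]
  obtain f where f: "P = {g. f dvd g}" using poly_ideal_principal[OF P(1)] by blast
  show ?thesis
  proof (cases "f = 0")
    case True
    then show ?thesis using f that(1) by auto
  next
    case False
    have "prime_elem f" using False P(2,3) f by (auto simp: prime_elem_def)
    then have "irreducible f" by (rule prime_elem_imp_irreducible)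
    then show ?thesis using irreducible_const_factor[of f] f that(2) by blast
  qed
qed

lemma exists_irreducible_factor:
  fixes f :: "'k::field poly"
  assumes "degree f > 0"
  shows "\<exists>p. irreducible p \<and> p dvd f"
  using assms
proof (induction "degree f" arbitrary: f rule: less_induct)
  case less
  show ?case
  proof (cases "irreducible f")
    case False
    then obtain a b where ab: "f = a * b" "\<not> a dvd 1" "\<not> b dvd 1"
      using less.prems is_unit_iff_degree[of f] by (cases "f = 0") (auto simp: irreducible_def)
    then have "a \<noteq> 0" "b \<noteq> 0" using less.prems by auto
    then have "degree a > 0" "degree b > 0" using ab by (auto simp: is_unit_iff_degree)
    then have "\<exists>p. irreducible p \<and> p dvd a"
      using less.hyps[of a] ab \<open>a \<noteq> 0\<close> \<open>b \<noteq> 0\<close> by (simp add: degree_mult_eq)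
    then show ?thesis using ab by (auto intro: dvd_mult2)
  qed auto
qed

lemma irreducible_bezout:
  fixes p :: "'k::field poly"
  assumes "irreducible p" "\<not> p dvd a"
  shows "\<exists>b e. a * b + p * e = 1"
proof -
  have I: "tideal UNIV {e + u * a | e u. p dvd e}" using ideal_plus[OF tideal_dvd[of p], of a] by simp
  then obtain d where d: "{e + u * a | e u. p dvd e} = {g. d dvd g}" using poly_ideal_principal[OF I] by auto
  have "p \<in> {e + u * a | e u. p dvd e}"
    by (intro CollectI exI[of _ p] exI[of _ 0]) simp
  moreover have "a \<in> {e + u * a | e u. p dvd e}"
    by (intro CollectI exI[of _ 0] exI[of _ 1]) simp
  ultimately have da: "d dvd p" "d dvd a" unfolding d by simp_all
  have "d dvd 1"
  proof (rule ccontr)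
    assume "\<not> d dvd 1"
    then have "p dvd d" using da(1) assms(1) irreducibleD' by blast
    then show False using da(2) assms(2) by (blast intro: dvd_trans)
  qed
  then have "1 \<in> {e + u * a | e u. p dvd e}" unfolding d by simp
  then obtain u k where "1 = p * k + u * a" by (blast elim: dvdE)
  then have "a * u + p * k = 1" by (simp add: algebra_simps)
  then show ?thesis by blast
qed

text \<open>The coefficients do not form a field, so division by g is possible only after
  multiplying by a power of its leading coefficient. The pseudo-remainder lies in I and has smaller
  degree, so it vanishes.\<close>

lemma pseudo_generator:
  fixes I :: "'k::field poly poly set"
  assumes I: "tideal UNIV I" and g: "g \<in> I" "g \<noteq> 0"
    and min: "\<And>h. h \<in> I \<Longrightarrow> degree h < degree g \<Longrightarrow> h = 0" and f: "f \<in> I"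
  shows "\<exists>k u. [:lead_coeff g:] ^ k * f = g * u"
proof -
  obtain u w where uw: "pseudo_divmod f g = (u, w)" by fastforce
  note pd = pseudo_divmod[OF g(2) uw]
  let ?k = "Suc (degree f) - degree g"
  have e: "[:lead_coeff g:] ^ ?k * f = g * u + w"
    using pd(1) by (simp add: const_power)
  then have "w = [:lead_coeff g:] ^ ?k * f - g * u" by simp
  then have "w \<in> I" using cideal_diff[OF I cideal_mult(2)[OF I f] cideal_mult(1)[OF I g(1)]] by simp
  then have "w = 0" using pd(2) min by blast
  then show ?thesis using e by auto
qed

lemma exists_min_degree:
  assumes "\<exists>f. f \<in> A"
  shows "\<exists>f. f \<in> A \<and> (\<forall>g\<in>A. degree f \<le> degree g)"
  using assms exists_least_iff[of "\<lambda>d. \<exists>f. f \<in> A \<and> degree f = d"] by (metis not_le)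

lemma cprime_const: "cprime P \<Longrightarrow> cprime {c. [:c:] \<in> P}" for P :: "'a::comm_ring_1 poly set"
  by (rule cprime_contract) (auto simp: one_pCons)

text \<open>Modulo p the coefficients form a field, so the image of I is principal with a monic
  generator. Here f is a monic lift of that generator, found without forming the quotient.\<close>

lemma monic_generator:
  fixes I :: "'k::field poly poly set"
  assumes I: "tideal UNIV I" and p: "irreducible p" "[:p:] \<in> I" and ne: "f0 \<in> I" "\<not> [:p:] dvd f0"
  shows "\<exists>f. f \<in> I \<and> lead_coeff f = 1 \<and> (\<forall>h\<in>I. degree h < degree f \<longrightarrow> [:p:] dvd h) \<and>
    (\<forall>h\<in>I. \<exists>u w. h = f * u + w \<and> [:p:] dvd w \<and> (w = 0 \<or> degree w < degree f))"
proof -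
  have ex: "\<exists>f. f \<in> {f \<in> I. \<not> [:p:] dvd f}" using ne by blast
  obtain g where g': "g \<in> {f \<in> I. \<not> [:p:] dvd f}"
    and min': "\<forall>h\<in>{f \<in> I. \<not> [:p:] dvd f}. degree g \<le> degree h"
    using exists_min_degree[OF ex] by auto
  have g: "g \<in> I" "\<not> [:p:] dvd g" using g' by simp_all
  have min: "degree g \<le> degree h" if "h \<in> I" "\<not> [:p:] dvd h" for h using min' that by simp
  define a d where "a = lead_coeff g" and "d = degree g"
  have mon: "[:p:] * h \<in> I" for h using cideal_mult(1)[OF I p(2)] .
  \<comment> \<open>Otherwise removing the leading term would leave a member of I of smaller degree
    that is still not divisible by p.\<close>
  have "\<not> p dvd a"
  proof
    assume pa: "p dvd a"
    define h where "h = g - monom a d"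
    have pm: "[:p:] dvd monom a d" using pa by (auto simp: const_poly_dvd_iff coeff_monom)
    then have h1: "h \<in> I" using cideal_diff[OF I g(1)] mon by (auto simp: h_def elim!: dvdE)
    have h2: "\<not> [:p:] dvd h" using g(2) pm unfolding h_def by (metis diff_add_cancel dvd_add)
    have "coeff h d = 0" by (simp add: h_def a_def d_def)
    moreover have "degree h \<le> d" unfolding h_def d_def by (intro degree_diff_le) (auto simp: degree_monom_le)
    ultimately have "degree h < d \<or> h = 0" by (metis le_neq_implies_less leading_coeff_0_iff)
    then show False using min[OF h1 h2] h2 by (auto simp: d_def)
  qed
  then obtain b e where be: "a * b + p * e = 1" using irreducible_bezout[OF p(1)] by blast
  \<comment> \<open>From ab + pe = 1: multiplying g by b makes the leading coefficient 1 modulo p,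
    and the second summand corrects it to exactly 1.\<close>
  define f where "f = [:b:] * g + [:p:] * monom e d"
  have fI: "f \<in> I" unfolding f_def using tidealD(3)[OF I cideal_mult(2)[OF I g(1)] mon] by blast
  have cfd: "coeff f d = 1" using be by (simp add: f_def a_def d_def mult.commute)
  have "degree f \<le> d" unfolding f_def d_def
    by (intro degree_add_le) (auto intro: degree_smult_le order_trans[OF degree_monom_le] order_trans[OF degree_smult_le] simp: smult_monom)
  moreover have "d \<le> degree f" using cfd by (intro le_degree) simp
  ultimately have df: "degree f = d" by simp
  then have lf: "lead_coeff f = 1" using cfd by simp
  have minf: "[:p:] dvd h" if "h \<in> I" "degree h < degree f" for h
    using min[OF that(1)] that(2) df by (auto simp: d_def)
  show ?thesis
  proof (rule exI[of _ f], intro conjI ballI impI)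
    show "f \<in> I" "lead_coeff f = 1" by fact+
    show "[:p:] dvd h" if "h \<in> I" "degree h < degree f" for h using minf that .
    fix h assume h: "h \<in> I"
    have "f \<noteq> 0" using lf by auto
    obtain u w where uw: "pseudo_divmod h f = (u, w)" by fastforce
    note pd = pseudo_divmod[OF \<open>f \<noteq> 0\<close> uw]
    have e: "h = f * u + w" using pd(1) lf by simp
    then have "w = h - f * u" by simp
    then have "w \<in> I" using cideal_diff[OF I h cideal_mult(1)[OF I fI]] by simp
    then show "\<exists>u w. h = f * u + w \<and> [:p:] dvd w \<and> (w = 0 \<or> degree w < degree f)"
      using e pd(2) minf by auto
  qed
qed

lemma cprime_const_dvd: "irreducible p \<Longrightarrow> cprime {f. [:p:] dvd f}" for p :: "'k::field poly"
  by (intro cprime_dvd) (simp add: prime_elem_const_poly_iff field_poly_irreducible_imp_prime)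

text \<open>Work modulo p, over a field. Let f and v be monic generators of P and of P + (w); then f
  = vu. If v is in P, so is w, which is excluded. If u is in P, minimality of the degree of f forces
  deg v = 0, so v = 1.\<close>

lemma cmax_above_const:
  fixes P :: "'k::field poly poly set"
  assumes P: "cprime P" and p: "irreducible p" "[:p:] \<in> P" and ne: "P \<noteq> {f. [:p:] dvd f}"
  shows "cmax P"
proof (rule cmaxI)
  note PI = cprimeD(1)[OF P]
  show "tideal UNIV P" "1 \<notin> P" using cprimeD[OF P] by auto
  have J0: "f \<in> P" if "[:p:] dvd f" for f using that p(2) cideal_mult[OF PI] by (auto elim!: dvdE)
  have "\<exists>f0\<in>P. \<not> [:p:] dvd f0" using ne J0 by auto
  then obtain f0 where f0: "f0 \<in> P" "\<not> [:p:] dvd f0" by auto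
  obtain f where f: "f \<in> P" "lead_coeff f = 1" "\<forall>h\<in>P. degree h < degree f \<longrightarrow> [:p:] dvd h"
    using monic_generator[OF PI p f0] by auto
  have f_ndvd: "\<not> [:p:] dvd f"
  proof
    assume "[:p:] dvd f"
    then have "p dvd lead_coeff f" by (auto simp: const_poly_dvd_iff)
    then show False using f(2) p(1) by (auto simp: irreducible_def)
  qed
  fix w assume w: "w \<notin> P"
  define I where "I = {e + u * w | e u. e \<in> P}"
  have I: "tideal UNIV I" unfolding I_def by (rule ideal_plus[OF PI])
  have "x \<in> I" if "x \<in> P" for x
    unfolding I_def using that by (intro CollectI exI[of _ x] exI[of _ 0]) simp
  then have PsubI: "P \<subseteq> I" by (rule subsetI)
  have wI: "w \<in> I" using tidealD(2)[OF PI] unfolding I_def by (intro CollectI exI[of _ 0] exI[of _ 1]) simp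
  have pf: "[:p:] \<in> I" "f0 \<in> I" using PsubI p f0 by auto
  obtain v where v: "v \<in> I" "lead_coeff v = 1"
    "\<forall>h\<in>I. \<exists>u w. h = v * u + w \<and> [:p:] dvd w \<and> (w = 0 \<or> degree w < degree v)"
    using monic_generator[OF I p(1) pf f0(2)] by auto
  obtain u s where us: "f = v * u + s" "[:p:] dvd s" "s = 0 \<or> degree s < degree v"
    using bspec[OF v(3) subsetD[OF PsubI f(1)]] by auto
  have "v * u \<in> P" using cideal_diff[OF PI f(1) J0[OF us(2)]] us(1) by simp
  then have "v \<in> P \<or> u \<in> P" by (rule cprimeD(3)[OF P])
  then have "1 \<in> I"
  proof
    assume vP: "v \<in> P"
    obtain u' s' where "w = v * u' + s'" "[:p:] dvd s'" using bspec[OF v(3) wI] by auto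
    then have "w \<in> P" using tidealD(3)[OF PI cideal_mult(1)[OF PI vP] J0] by blast
    then show ?thesis using w by blast
  next
    assume uP: "u \<in> P"
    have nd: "\<not> [:p:] dvd u" using f_ndvd us(1,2) by (auto intro: dvd_add)
    then have du: "degree f \<le> degree u" using bspec[OF f(3) uP] by force
    have nz: "u \<noteq> 0" "v \<noteq> 0" using nd v(2) by auto
    then have dvu: "degree (v * u) = degree v + degree u" by (simp add: degree_mult_eq)
    have "degree f = degree v + degree u"
      using us(1,3) dvu degree_add_eq_left[of s "v * u"] by auto
    then have "degree v = 0" using du by simp
    then have "v = 1" using v(2) by (metis degree_eq_zeroE lead_coeff_pCons(2) one_pCons)
    then show ?thesis using v(1) by simp
  qed
  then show "\<exists>e u. e \<in> P \<and> 1 = e + u * w" unfolding I_def by blast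
qed

text \<open>The contraction of P to K[T] is prime, hence zero or generated by an irreducible p. The
  arguments about dimension split along these two cases.\<close>

lemma const_contraction_cases:
  fixes P :: "'k::field poly poly set"
  assumes "cprime P"
  obtains "\<And>c. [:c:] \<in> P \<Longrightarrow> c = 0" | p where "irreducible p" "[:p:] \<in> P"
proof (cases rule: cprime_poly_cases[OF cprime_const[OF assms]])
  case 1
  have "c = 0" if "[:c:] \<in> P" for c
  proof -
    have "c \<in> {c. [:c:] \<in> P}" using that by simp
    then show ?thesis unfolding 1 by simp
  qed
  then show ?thesis by (rule that(1))
next
  case (2 f)
  have "f \<in> {c. [:c:] \<in> P}" unfolding 2(2) by simp
  then have "[:f:] \<in> P" by simp
  moreover have "irreducible f" using 2(1) by (simp add: Irr_m_def)
  ultimately show ?thesis using that(2) by simp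
qed

text \<open>Let P2 meet K[T] in zero, and let f in P2 and g in P1 be nonzero of least degree. Some
  a^k g equals fu with a the leading coefficient of f. As f is not in P1, u is, so deg u >= deg g
  and f is constant, a contradiction. If p lies in P2, it remains to exclude P2 = (p), by a descent
  in P1.\<close>

lemma dim_two:
  fixes P1 P2 :: "'k::field poly poly set"
  assumes P1: "cprime P1" "P1 \<noteq> {0}" and P2: "cprime P2" and sub: "P1 \<subset> P2"
  shows "cmax P2"
proof (cases rule: const_contraction_cases[OF P2])
  note I1 = cprimeD(1)[OF P1(1)] and I2 = cprimeD(1)[OF P2]
  have ex1: "\<exists>f. f \<in> P1 - {0}" using P1 tidealD(2)[OF I1] by blast
  case 1
  obtain g where g': "g \<in> P1 - {0}" and ming: "\<forall>h\<in>P1 - {0}. degree g \<le> degree h"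
    using exists_min_degree[OF ex1] by auto
  then have g: "g \<in> P1" "g \<noteq> 0" by auto
  have ex: "\<exists>f. f \<in> P2 - {0}" using ex1 sub by blast
  obtain f where f': "f \<in> P2 - {0}" and minf: "\<forall>h\<in>P2 - {0}. degree f \<le> degree h"
    using exists_min_degree[OF ex] by auto
  then have f: "f \<in> P2" "f \<noteq> 0" by auto
  have gen: "\<exists>k u. [:lead_coeff f:] ^ k * h = f * u" if "h \<in> P2" for h
  proof (rule pseudo_generator[OF I2 f _ that])
    show "h' \<in> P2 \<Longrightarrow> degree h' < degree f \<Longrightarrow> h' = 0" for h' using minf by force
  qed
  have lc: "[:lead_coeff f:] \<notin> P2" using 1[of "lead_coeff f"] f(2) by auto
  have "f \<notin> P1"
  proof
    assume "f \<in> P1"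
    have "h \<in> P1" if "h \<in> P2" for h
    proof -
      obtain k u where "[:lead_coeff f:] ^ k * h = f * u" using gen[OF \<open>h \<in> P2\<close>] by blast
      then have "[:lead_coeff f:] ^ k * h \<in> P1" using cideal_mult(1)[OF I1 \<open>f \<in> P1\<close>] by simp
      then have "[:lead_coeff f:] ^ k \<in> P1 \<or> h \<in> P1" by (rule cprimeD(3)[OF P1(1)])
      then show ?thesis using cprime_power[OF P1(1)] lc sub by blast
    qed
    then show False using sub by blast
  qed
  obtain k u where u: "[:lead_coeff f:] ^ k * g = f * u" using gen g sub by blast
  then have "f * u \<in> P1" using cideal_mult(2)[OF I1 g(1)] by metis
  then have uP: "u \<in> P1" using cprimeD(3)[OF P1(1)] \<open>f \<notin> P1\<close> by blast
  have "[:lead_coeff f:] ^ k * g \<noteq> 0" using f g by simp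
  then have "u \<noteq> 0" using u by auto
  then have "degree g \<le> degree u" using ming uP by simp
  moreover have "degree g = degree f + degree u"
    using arg_cong[OF u, of degree] f g \<open>u \<noteq> 0\<close> by (simp add: degree_mult_eq const_power)
  ultimately have "degree f = 0" by simp
  then obtain c where "f = [:c:]" by (elim degree_eq_zeroE)
  then show ?thesis using 1 f by auto
next
  note I1 = cprimeD(1)[OF P1(1)] and I2 = cprimeD(1)[OF P2]
  have ex1: "\<exists>f. f \<in> P1 - {0}" using P1 tidealD(2)[OF I1] by blast
  case (2 p)
  show ?thesis
  proof (rule cmax_above_const[OF P2 2], rule notI)
    assume eq: "P2 = {f. [:p:] dvd f}"
    have np: "[:p:] \<notin> P1"
    proof
      assume pP: "[:p:] \<in> P1"
      have "P2 \<subseteq> P1" unfolding eq by (auto elim!: dvdE simp del: mult_pCons_left intro: cideal_mult(1)[OF I1 pP])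
      then show False using sub by blast
    qed
    \<comment> \<open>Every nonzero member of P1 is divisible by p, and the quotient is again in P1;
      its leading coefficient has smaller degree, so the descent never ends.\<close>
    have "\<not> (\<exists>g \<in> P1 - {0}. degree (lead_coeff g) = d)" for d
    proof (induction d rule: less_induct)
      case (less d)
      show ?case
      proof
        assume "\<exists>g\<in>P1 - {0}. degree (lead_coeff g) = d"
        then obtain g where g: "g \<in> P1" "g \<noteq> 0" "degree (lead_coeff g) = d" by blast
        have "[:p:] dvd g" using eq sub g(1) by blast
        then obtain g' where g': "g = [:p:] * g'" by (rule dvdE)
        have "g' \<in> P1" using cprimeD(3)[OF P1(1)] np g(1) g' by blast
        have "p \<noteq> 0" "degree p \<noteq> 0" using 2(1) by (auto simp: irreducible_def is_unit_iff_degree)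
        moreover have "g' \<noteq> 0" "lead_coeff g = p * lead_coeff g'"
          using g g' by (auto simp: lead_coeff_mult)
        ultimately have "degree (lead_coeff g') < d" using g(3) by (simp add: degree_mult_eq)
        then show False using less.IH \<open>g' \<in> P1\<close> \<open>g' \<noteq> 0\<close> by blast
      qed
    qed
    then show False using ex1 by blast
  qed
qed

text \<open>If M contains p from K[T], then (p) lies strictly below M, since adjoining Y to (p)
  still gives a proper ideal. If M meets K[T] in zero, take f in M of least degree with leading
  coefficient a, and p prime to a: comaximality of M and (p) makes f a unit modulo p, although its
  degree stays positive there.\<close>

lemma cmax_not_height_one:
  fixes M :: "'k::field poly poly set"
  assumes M: "cmax M"
  shows "\<exists>P. cprime P \<and> P \<noteq> {0} \<and> P \<subset> M"
proof -
  note P = cmax_imp_cprime[OF M] and I = cprimeD(1)[OF cmax_imp_cprime[OF M]]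
  have coeff0: "tideal UNIV {f. p dvd coeff f 0}" for p :: "'k poly"
    by (auto simp: tideal_def coeff_mult)
  have not_small: "M \<noteq> {f. [:p:] dvd f}" if "\<not> p dvd 1" for p
  proof
    assume eq: "M = {f. [:p:] dvd f}"
    let ?J = "{f. p dvd coeff f 0}"
    have "M \<subseteq> ?J" unfolding eq by (auto simp: const_poly_dvd_iff)
    moreover have "YY \<in> ?J" "1 \<notin> ?J" using that by auto
    moreover have "YY \<notin> M" using that unfolding eq by (auto simp: const_poly_dvd_iff coeff_pCons split: nat.splits)
    ultimately show False using M coeff0[of p] unfolding cmax_def by blast
  qed
  show ?thesis
  proof (cases rule: const_contraction_cases[OF P])
    case (2 p)
    have "{f. [:p:] dvd f} \<subseteq> M" using 2(2) cideal_mult(1)[OF I] by (auto elim!: dvdE)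
    moreover have "{f. [:p:] dvd f} \<noteq> M" using not_small[of p] 2(1) by (auto simp: irreducible_def)
    moreover have "{f. [:p:] dvd f} \<noteq> {0}" using dvd_set_nonzero[of "[:p:]"] 2(1) by (auto simp: irreducible_def)
    ultimately show ?thesis using cprime_const_dvd[OF 2(1)] by blast
  next
    case 1
    have "M \<noteq> {0}" using not_small[of 0] by auto
    then have ex: "\<exists>f. f \<in> M - {0}" using tidealD(2)[OF I] by blast
    obtain f where f': "f \<in> M - {0}" and minf: "\<forall>h\<in>M - {0}. degree f \<le> degree h"
      using exists_min_degree[OF ex] by auto
    then have f: "f \<in> M" "f \<noteq> 0" by auto
    define a where "a = lead_coeff f"
    have "a \<noteq> 0" using f a_def by simp
    have df: "degree f > 0" using 1 f by (metis degree_eq_zeroE gr_zeroI pCons_0_0)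
    \<comment> \<open>The polynomial 1 + Ta is nonconstant and prime to a, so any irreducible factor
      of it avoids a, over a finite field as well.\<close>
    have "degree (1 + [:0, 1:] * a) > 0"
    proof -
      have "degree ([:0, 1:] * a) = Suc (degree a)" using \<open>a \<noteq> 0\<close> by simp
      then show ?thesis using degree_add_eq_right[of 1 "[:0, 1:] * a"] by simp
    qed
    then obtain p where p: "irreducible p" "p dvd 1 + [:0, 1:] * a"
      using exists_irreducible_factor by blast
    have pa: "\<not> p dvd a"
    proof
      assume "p dvd a"
      then have "p dvd 1" using p(2) by (metis dvd_add_left_iff dvd_mult)
      then show False using p(1) by (auto simp: irreducible_def)
    qed
    have pp: "prime_elem p" using p(1) by (rule field_poly_irreducible_imp_prime)
    have "p \<noteq> 0" using p(1) by (auto simp: irreducible_def)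
    then have "[:p:] \<notin> M" using 1 by blast
    from cmax_coprime[OF M this] obtain g w where g: "g \<in> M" "1 = g + w * [:p:]" by blast
    obtain k u where u: "[:a:] ^ k * g = f * u"
    proof -
      have "\<exists>k u. [:lead_coeff f:] ^ k * g = f * u"
      proof (rule pseudo_generator[OF I f _ g(1)])
        show "h' \<in> M \<Longrightarrow> degree h' < degree f \<Longrightarrow> h' = 0" for h' using minf by force
      qed
      then show ?thesis using that by (auto simp: a_def)
    qed
    have "[:a ^ k:] = [:a:] ^ k * (g + w * [:p:])" using g(2) by (simp add: const_power)
    also have "\<dots> = f * u + [:p:] * ([:a:] ^ k * w)" using u by (simp add: algebra_simps)
    finally have "f * u - [:a ^ k:] = [:p:] * (- ([:a:] ^ k * w))" by simp
    then have "[:p:] dvd f * u - [:a ^ k:]" by (metis dvd_triv_left)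
    then have ex: "\<exists>u. u \<in> {u. [:p:] dvd f * u - [:a ^ k:]}" by blast
    \<comment> \<open>An inverse of f modulo p, up to a^k, of least degree: its leading coefficient
      survives modulo p, so the top coefficient of fv does too.\<close>
    obtain v where v': "v \<in> {u. [:p:] dvd f * u - [:a ^ k:]}"
      and minv': "\<forall>h\<in>{u. [:p:] dvd f * u - [:a ^ k:]}. degree v \<le> degree h"
      using exists_min_degree[OF ex] by auto
    have v: "[:p:] dvd f * v - [:a ^ k:]" using v' by simp
    have minv: "degree v \<le> degree h" if "[:p:] dvd f * h - [:a ^ k:]" for h using minv' that by simp
    have pak: "\<not> p dvd a ^ k" using pa pp by (meson prime_elem_dvd_power)
    have "v \<noteq> 0"
    proof
      assume "v = 0"
      then show False using pak v by simp
    qed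
    have nlv: "\<not> p dvd lead_coeff v"
    proof
      assume d: "p dvd lead_coeff v"
      let ?h = "v - monom (lead_coeff v) (degree v)"
      have "[:p:] dvd monom (lead_coeff v) (degree v)" using d by (auto simp: const_poly_dvd_iff coeff_monom)
      from dvd_diff[OF v dvd_mult[OF this]]
      have "[:p:] dvd (f * v - [:a ^ k:]) - f * monom (lead_coeff v) (degree v)"
        .
      then have hh: "[:p:] dvd f * ?h - [:a ^ k:]" by (simp add: algebra_simps)
      then have "degree v \<le> degree ?h" by (rule minv)
      moreover have "degree ?h \<le> degree v" by (intro degree_diff_le) (auto simp: degree_monom_le)
      ultimately have "coeff ?h (degree ?h) = 0" by simp
      then have "?h = 0" by (simp only: leading_coeff_0_iff)
      then show False using hh pak by (simp add: dvd_minus_iff)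
    qed
    have "coeff (f * v - [:a ^ k:]) (degree f + degree v) = a * lead_coeff v"
      using df by (simp add: coeff_mult_degree_sum a_def coeff_pCons split: nat.splits)
    then have "p dvd a * lead_coeff v" using v by (metis const_poly_dvd_iff)
    then show ?thesis using pa nlv pp by (auto simp: prime_elem_dvd_mult_iff)
  qed
qed

definition height_one :: "'a::idom set \<Rightarrow> bool" where
  "height_one P \<longleftrightarrow> cprime P \<and> P \<noteq> {0} \<and> (\<forall>Q. cprime Q \<longrightarrow> Q \<subset> P \<longrightarrow> Q = {0})"

lemma prime_trichotomy:
  fixes P :: "'k::field poly poly set"
  assumes "cprime P"
  shows "P = {0} \<or> height_one P \<or> cmax P"
  using assms dim_two by (auto simp: height_one_def)

lemma cmax_imp_not_height_one: "cmax P \<Longrightarrow> \<not> height_one P \<and> P \<noteq> {0}" for P :: "'k::field poly poly set"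
proof -
  assume "cmax P"
  then obtain Q where Q: "cprime Q" "Q \<noteq> {0}" "Q \<subset> P" using cmax_not_height_one by blast
  have "0 \<in> Q" using tidealD(2)[OF cprimeD(1)[OF Q(1)]] .
  then show ?thesis using Q by (auto simp: height_one_def)
qed

lemma height_one_eq_dvd:
  assumes "height_one P" "prime_elem a" "a \<in> P"
  shows "P = {f. a dvd f}"
proof (rule ccontr)
  assume "P \<noteq> {f. a dvd f}"
  moreover have "{f. a dvd f} \<subseteq> P"
    using assms cideal_mult(1) by (auto simp: height_one_def cprime_def elim!: dvdE)
  ultimately have "{f. a dvd f} = {0}" using assms cprime_dvd unfolding height_one_def by blast
  then show False using dvd_set_nonzero[of a] assms(2) by (simp add: prime_elem_def)
qed

text \<open>Treats s = c + eTY without first proving it prime. P contains no nonzero element of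
  K[T]: an irreducible p in P would generate it and divide c. So s has least degree in P,
  pseudo-division gives s | (eT)^k f, and the factors eT cancel.\<close>

lemma height_one_linear:
  fixes P :: "'k::field poly poly set"
  assumes P: "height_one P" and s: "s = [:[:c:], [:0, e:]:]" "s \<in> P" and ce: "c \<noteq> 0" "e \<noteq> 0"
  shows "P = {f. s dvd f}"
proof -
  have cp: "cprime P" using P by (simp add: height_one_def)
  note I = cprimeD(1)[OF cp]
  have con: "a = 0" if a: "[:a:] \<in> P" for a
  proof (rule const_contraction_cases[OF cp])
    fix p assume p: "irreducible p" "[:p:] \<in> P"
    then have "P = {f. [:p:] dvd f}"
      by (intro height_one_eq_dvd[OF P]) (auto simp: prime_elem_const_poly_iff field_poly_irreducible_imp_prime)
    then have "p dvd [:c:]" using s by (auto simp: const_poly_dvd_iff coeff_pCons split: nat.splits)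
    moreover have "[:c:] dvd 1" using ce by (simp add: is_unit_const_poly_iff dvd_field_iff)
    ultimately have "p dvd 1" by (blast intro: dvd_trans)
    then show ?thesis using p by (auto simp: irreducible_def)
  qed (use a in blast)
  have min: "h = 0" if "h \<in> P" "degree h < degree s" for h
  proof -
    have "degree h = 0" using that(2) s(1) ce by simp
    then obtain a where "h = [:a:]" by (elim degree_eq_zeroE)
    then show ?thesis using con that by auto
  qed
  \<comment> \<open>The prime eT does not divide s, whose constant coefficient is c; it therefore
    divides the cofactor and can be cancelled.\<close>
  have reg: "s dvd f" if "s dvd [:[:0, e:]:] ^ k * f" for k f
    using that
  proof (induction k)
    case (Suc k)
    obtain g where g: "[:[:0, e:]:] * ([:[:0, e:]:] ^ k * f) = s * g"
      using Suc.prems by (auto simp: mult.assoc elim!: dvdE)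
    have pr: "prime_elem [:[:0, e:]:]" using ce
      by (simp add: prime_elem_const_poly_iff field_poly_irreducible_imp_prime irreducible_linear_field_poly)
    have "[:[:0, e:]:] dvd s * g" using g by (metis dvd_triv_left)
    moreover have "\<not> [:[:0, e:]:] dvd s"
    proof
      assume "[:[:0, e:]:] dvd s"
      then have "[:0, e:] dvd [:c:]" using s(1) by (auto simp: const_poly_dvd_iff coeff_pCons split: nat.splits)
      then have "degree [:0, e:] \<le> degree [:c:]" using ce by (intro dvd_imp_degree_le) auto
      then show False using ce by simp
    qed
    ultimately have "[:[:0, e:]:] dvd g" using prime_elem_dvd_multD[OF pr] by blast
    then obtain g' where "g = [:[:0, e:]:] * g'" by (rule dvdE)
    then have "[:[:0, e:]:] * ([:[:0, e:]:] ^ k * f) = [:[:0, e:]:] * (s * g')"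
      using g by (metis mult.left_commute)
    then have "[:[:0, e:]:] ^ k * f = s * g'" using ce by (metis mult_left_cancel pCons_eq_0_iff)
    then show ?case using Suc.IH by simp
  qed simp
  have lc: "lead_coeff s = [:0, e:]" and "s \<noteq> 0" using s(1) ce by simp_all
  have "s dvd f" if "f \<in> P" for f
    using pseudo_generator[OF I s(2) \<open>s \<noteq> 0\<close> min that] reg lc by (metis dvd_triv_left)
  then show ?thesis using s(2) cideal_mult(1)[OF I] by (auto elim!: dvdE)
qed

text \<open>A quotient of the two-variable ring by \<open>a\<close> that is a polynomial ring in one
  variable, with a ring section \<sigma> of the quotient map \<rho>. This treats the primes above r
  and above t at once.\<close>

locale retraction =
  fixes \<rho> :: "'k::field poly poly \<Rightarrow> 'k poly" and \<sigma> :: "'k poly \<Rightarrow> 'k poly poly" and a :: "'k poly poly"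
  assumes \<rho>: "\<And>f g. \<rho> (f + g) = \<rho> f + \<rho> g" "\<And>f g. \<rho> (f * g) = \<rho> f * \<rho> g" "\<rho> 1 = 1"
    and \<sigma>: "\<And>f g. \<sigma> (f + g) = \<sigma> f + \<sigma> g" "\<And>f g. \<sigma> (f * g) = \<sigma> f * \<sigma> g" "\<sigma> 1 = 1"
    and \<rho>\<sigma>: "\<And>f. \<rho> (\<sigma> f) = f"
    and a_nz: "a \<noteq> 0" and ker: "\<And>f. \<rho> f = 0 \<longleftrightarrow> a dvd f"
begin

lemma zero: "\<rho> 0 = 0" "\<sigma> 0 = 0"
proof -
  have "\<rho> 0 + \<rho> 0 = \<rho> 0 + 0" "\<sigma> 0 + \<sigma> 0 = \<sigma> 0 + 0"
    using \<rho>(1)[of 0 0] \<sigma>(1)[of 0 0] by simp_all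
  then show "\<rho> 0 = 0" "\<sigma> 0 = 0" by (simp_all only: add_left_cancel)
qed

lemma diff: "\<rho> (f - g) = \<rho> f - \<rho> g"
  using \<rho>(1)[of "f - g" g] by (simp add: algebra_simps)

lemma dvd_diff_section: "a dvd f - \<sigma> (\<rho> f)"
  using ker[of "f - \<sigma> (\<rho> f)"] by (simp add: diff \<rho>\<sigma>)

lemma \<rho>a: "\<rho> a = 0"
  using ker[of a] by simp

lemma mem_ideal_iff:
  assumes I: "tideal UNIV I" and a: "a \<in> I"
  shows "f \<in> I \<longleftrightarrow> \<sigma> (\<rho> f) \<in> I"
proof -
  have d: "f - \<sigma> (\<rho> f) \<in> I"
    using dvd_diff_section[of f] cideal_mult(1)[OF I a] by (auto elim!: dvdE)
  show ?thesis using cideal_add_left[OF I d, of "\<sigma> (\<rho> f)"] by simp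
qed

lemma tgen_eq: "tgen UNIV {a, \<sigma> f} = {g. f dvd \<rho> g}"
proof (rule tgen_eqI)
  show "tideal UNIV {g. f dvd \<rho> g}" by (auto simp: tideal_def \<rho> zero)
  show "{a, \<sigma> f} \<subseteq> {g. f dvd \<rho> g}" by (simp add: \<rho>a \<rho>\<sigma>)
  fix J assume J: "tideal UNIV J" "{a, \<sigma> f} \<subseteq> J"
  then have aJ: "a \<in> J" "\<sigma> f \<in> J" by auto
  show "{g. f dvd \<rho> g} \<subseteq> J"
  proof
    fix g assume "g \<in> {g. f dvd \<rho> g}"
    then obtain k where "\<rho> g = f * k" by (auto elim: dvdE)
    then have "\<sigma> (\<rho> g) \<in> J" using cideal_mult(1)[OF J(1) aJ(2)] by (simp add: \<sigma>)
    then show "g \<in> J" using mem_ideal_iff[OF J(1) aJ(1)] by simp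
  qed
qed

lemma tgen_a: "tgen UNIV {a} = {g. \<rho> g = 0}"
  by (simp add: tgen_single ker)

lemma cprime_tgen: "f \<in> Irr_m \<Longrightarrow> cprime (tgen UNIV {a, \<sigma> f})"
  unfolding tgen_eq using cprime_contract[OF \<rho> zero(1) cprime_dvd[OF Irr_mD(1)]] by simp

lemma cprime_tgen_a: "cprime (tgen UNIV {a})"
proof -
  have "cprime ({0} :: 'k poly set)" using tideal_zero[OF tsubring_UNIV] by (auto simp: cprime_def)
  from cprime_contract[OF \<rho> zero(1) this] show ?thesis by (simp add: tgen_a)
qed

text \<open>Primes containing a correspond through \<rho> to primes of K[z], which are zero or
  generated by a monic irreducible. As b is the image of z, excluding b removes exactly the
  generator z.\<close>

lemma primes_above:
  assumes b: "b = \<sigma> [:0, 1:]"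
  shows "{P. cprime P \<and> a \<in> P \<and> b \<notin> P} =
      {tgen UNIV {a}} \<union> {tgen UNIV {a, \<sigma> f} | f. f \<in> Irr_m - {[:0, 1:]}}"
proof (intro equalityI subsetI)
  fix P assume "P \<in> {P. cprime P \<and> a \<in> P \<and> b \<notin> P}"
  then have P: "cprime P" "a \<in> P" "b \<notin> P" by auto
  note I = cprimeD(1)[OF P(1)]
  have q: "cprime {f. \<sigma> f \<in> P}" by (rule cprime_contract[OF \<sigma> zero(2) P(1)])
  have eq: "P = {g. \<rho> g \<in> Q}" if "{f. \<sigma> f \<in> P} = Q" for Q
    unfolding that[symmetric] using mem_ideal_iff[OF I P(2)] by blast
  show "P \<in> {tgen UNIV {a}} \<union> {tgen UNIV {a, \<sigma> f} | f. f \<in> Irr_m - {[:0, 1:]}}"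
  proof (cases rule: cprime_poly_cases[OF q])
    case 1
    then have "P = tgen UNIV {a}" using eq[OF 1] unfolding tgen_a by simp
    then show ?thesis by simp
  next
    case (2 f)
    then have "P = tgen UNIV {a, \<sigma> f}" using eq[OF 2(2)] unfolding tgen_eq by simp
    moreover have "f \<noteq> [:0, 1:]"
    proof
      assume "f = [:0, 1:]"
      then have "[:0, 1:] \<in> {f. \<sigma> f \<in> P}" unfolding 2(2) by simp
      then show False using P(3) b by simp
    qed
    ultimately show ?thesis using 2(1) by blast
  qed
next
  have ainc: "a \<in> tgen UNIV {a, \<sigma> f}" "a \<in> tgen UNIV {a}" for f using tgen_incl by blast+
  fix P assume "P \<in> {tgen UNIV {a}} \<union> {tgen UNIV {a, \<sigma> f} | f. f \<in> Irr_m - {[:0, 1:]}}"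
  then consider "P = tgen UNIV {a}" | f where "P = tgen UNIV {a, \<sigma> f}" "f \<in> Irr_m" "f \<noteq> [:0, 1:]" by blast
  then show "P \<in> {P. cprime P \<and> a \<in> P \<and> b \<notin> P}"
  proof cases
    case 1
    then show ?thesis using cprime_tgen_a ainc by (simp add: tgen_a b \<rho>\<sigma>)
  next
    case 2
    then show ?thesis using cprime_tgen[OF 2(2)] ainc Irr_m_dvd_imp_eq[OF 2(2) X_Irr_m]
      by (auto simp: tgen_eq b \<rho>\<sigma>)
  qed
qed

lemma tgen_strict: "f \<in> Irr_m \<Longrightarrow> tgen UNIV {a} \<subset> tgen UNIV {a, \<sigma> f}"
proof (intro psubsetI notI)
  assume f: "f \<in> Irr_m" and eq: "tgen UNIV {a} = tgen UNIV {a, \<sigma> f}"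
  have "\<sigma> f \<in> tgen UNIV {a}" unfolding eq using tgen_incl by blast
  then show False using Irr_mD(3)[OF f] by (simp add: tgen_a \<rho>\<sigma>)
qed (auto simp: tgen_a tgen_eq)

lemma cmax_tgen:
  assumes "f \<in> Irr_m"
  shows "cmax (tgen UNIV {a, \<sigma> f})"
proof (rule dim_two[OF cprime_tgen_a _ cprime_tgen[OF assms] tgen_strict[OF assms]])
  show "tgen UNIV {a} \<noteq> {0}" using tgen_incl[of "{a}" UNIV] a_nz by auto
qed

end


lemma map_poly_hom:
  fixes \<phi> :: "'a::comm_ring_1 \<Rightarrow> 'b::comm_ring_1"
  assumes "\<And>a b. \<phi> (a + b) = \<phi> a + \<phi> b" "\<And>a b. \<phi> (a * b) = \<phi> a * \<phi> b" "\<phi> 1 = 1"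
  shows "map_poly \<phi> (f + g) = map_poly \<phi> f + map_poly \<phi> g"
    "map_poly \<phi> (f * g) = map_poly \<phi> f * map_poly \<phi> g" "map_poly \<phi> 1 = 1"
proof -
  have "\<phi> 0 + \<phi> 0 = \<phi> 0 + 0" using assms(1)[of 0 0] by simp
  then have 0: "\<phi> 0 = 0" by (simp only: add_left_cancel)
  have sum: "\<phi> (sum h F) = (\<Sum>i\<in>F. \<phi> (h i))" for h :: "nat \<Rightarrow> 'a" and F
    by (induction F rule: infinite_finite_induct) (simp_all add: 0 assms)
  show "map_poly \<phi> (f + g) = map_poly \<phi> f + map_poly \<phi> g"
    "map_poly \<phi> (f * g) = map_poly \<phi> f * map_poly \<phi> g"
    by (simp_all add: poly_eq_iff coeff_map_poly 0 assms coeff_mult sum)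
  show "map_poly \<phi> 1 = 1" by (simp add: one_pCons map_poly_pCons 0 assms)
qed

interpretation ret_R: retraction "\<lambda>f. coeff f 0" "\<lambda>c. [:c:]" YY
proof
  show "coeff f 0 = 0 \<longleftrightarrow> YY dvd f" for f :: "'a poly poly"
    using monom_1_dvd_iff'[of 1 f] by (simp add: monom_altdef)
qed (auto simp: coeff_mult one_pCons)

text \<open>\<open>XX\<close>, the model of t, is the inner variable, so setting it to zero and
  embedding K[r] both work coefficient by coefficient.\<close>

interpretation ret_T: retraction "map_poly (\<lambda>c. coeff c 0)" "map_poly (\<lambda>c. [:c:])" XX
proof
  show "map_poly (\<lambda>c. coeff c 0) f = 0 \<longleftrightarrow> XX dvd f" for f :: "'a poly poly"
  proof -
    have "coeff c 0 = 0 \<longleftrightarrow> [:0, 1:] dvd c" for c :: "'a poly"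
      using monom_1_dvd_iff'[of 1 c] by (simp add: monom_altdef)
    then show ?thesis by (simp add: const_poly_dvd_iff poly_eq_iff[of "map_poly _ f"] coeff_map_poly)
  qed
qed (auto simp: map_poly_hom one_pCons coeff_mult map_poly_map_poly o_def map_poly_pCons)

section \<open>Commutation rules at a root of unity\<close>

text \<open>Horner form, suited to induction on \<open>pCons\<close>; \<open>qWeyl_eval_eq\<close>
  identifies it with the sum of powers in \<open>qWeyl_eval\<close>.\<close>

definition peval :: "'k::comm_ring_1 poly poly endo \<Rightarrow> 'k poly \<Rightarrow> 'k poly poly endo" where
  "peval a f = fold_coeffs (\<lambda>c e. op_c c + a * e) f 0"

lemma peval_0 [simp]: "peval a 0 = 0"
  by (simp add: peval_def)

lemma peval_pCons [simp]: "peval a (pCons c f) = op_c c + a * peval a f"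
  by (cases "c = 0 \<and> f = 0") (auto simp: peval_def op_c_hom)

lemma peval_add: "peval a (f + g) = peval a f + peval a g"
proof (induction f arbitrary: g)
  case (pCons c f)
  show ?case
  proof (cases g)
    case (pCons d g')
    then show ?thesis using pCons.IH[of g'] by (simp add: op_c_hom algebra_simps)
  qed
qed simp

lemma peval_smult:
  assumes "a \<in> qw q"
  shows "peval a (smult c f) = op_c c * peval a f"
proof (induction f)
  case (pCons d f)
  have "a * (op_c c * peval a f) = op_c c * (a * peval a f)"
    using qw_const_commute[OF assms, of c] by (simp add: mult.assoc[symmetric])
  then show ?case using pCons by (simp add: op_c_hom distrib_left)
qed simp

lemma peval_mult:
  assumes "a \<in> qw q"
  shows "peval a (f * g) = peval a f * peval a g"
proof (induction f)
  case (pCons d f)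
  then show ?case by (simp add: peval_add peval_smult[OF assms] op_c_hom distrib_right mult.assoc)
qed simp

lemma peval_in: "a \<in> qw q \<Longrightarrow> peval a f \<in> qw q"
  by (induction f) (auto intro: qw.intros qwD(3))

lemma peval_1 [simp]: "peval a 1 = 1"
  by (simp add: one_pCons op_c_hom)

lemma peval_monom: "a \<in> qw q \<Longrightarrow> peval a (monom c i) = op_c c * a ^ i"
proof (induction i)
  case (Suc i)
  have "a * (op_c c * a ^ i) = op_c c * (a * a ^ i)"
    using qw_const_commute[OF Suc.prems, of c] by (simp add: mult.assoc[symmetric])
  then show ?case using Suc by (simp add: monom_Suc op_c_hom)
qed (simp add: monom_0)

lemma peval_altdef:
  assumes "a \<in> qw q"
  shows "peval a f = (\<Sum>i\<le>degree f. op_c (coeff f i) * a ^ i)"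
proof -
  have s: "peval a (sum h F) = (\<Sum>i\<in>F. peval a (h i))" for h :: "nat \<Rightarrow> 'a poly" and F
    by (induction F rule: infinite_finite_induct) (simp_all add: peval_add)
  have "peval a f = peval a (\<Sum>i\<le>degree f. monom (coeff f i) i)" by (simp add: poly_as_sum_of_monoms)
  then show ?thesis by (simp add: s peval_monom[OF assms])
qed

lemma poly_zero_by_roots:
  fixes f :: "'k::field poly"
  assumes "finite A" "degree f < card A" "\<And>a. a \<in> A \<Longrightarrow> poly f a = 0"
  shows "f = 0"
proof (rule ccontr)
  assume f: "f \<noteq> 0"
  have "card A \<le> card {a. poly f a = 0}"
    using assms(3) poly_roots_finite[OF f] by (intro card_mono) auto
  also have "\<dots> \<le> degree f" by (rule card_poly_roots_bound[OF f])
  finally show False using assms(2) by simp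
qed

locale root_of_unity =
  fixes q :: "'k::field" and n :: nat
  assumes n2: "n \<ge> 2" and prim: "primitive_root_of_unity n q"
begin

lemma qn: "q ^ n = 1" and q_power_ne: "0 < m \<Longrightarrow> m < n \<Longrightarrow> q ^ m \<noteq> 1"
  using prim by (auto simp: primitive_root_of_unity_def)

lemma n_pos: "n > 0" using n2 by simp

lemma q_ne_1: "q \<noteq> 1" using q_power_ne[of 1] n2 by simp

lemma q_ne_0: "q \<noteq> 0" using qn n_pos by (auto simp: power_0_left)

lemma qint_eq: "qint q k = (q ^ k - 1) / (q - 1)"
  using qint_mult[of q k] q_ne_1 by (simp add: field_simps)

lemma qint_n [simp]: "qint q n = 0"
  by (simp add: qint_eq qn)

lemma qint_ne_0: "0 < k \<Longrightarrow> k < n \<Longrightarrow> qint q k \<noteq> 0"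
  using q_power_ne q_ne_1 by (simp add: qint_eq)

lemma q_power_inj: "i < n \<Longrightarrow> j < n \<Longrightarrow> q ^ i = q ^ j \<Longrightarrow> i = j"
proof (induction i j rule: linorder_wlog)
  case (le i j)
  have "q ^ i * q ^ (j - i) = q ^ j" using le(1) by (simp add: power_add[symmetric])
  then have "q ^ i * q ^ (j - i) = q ^ i * 1" using le(4) by simp
  then have "q ^ (j - i) = 1" using q_ne_0 mult_left_cancel[of "q ^ i"] by auto
  then show ?case using q_power_ne[of "j - i"] le by (cases "i = j") auto
qed auto

lemma card_roots: "card ((\<lambda>j. c * q ^ j) ` {..<n}) = n" if "c \<noteq> 0"
  using that by (subst card_image) (auto simp: inj_on_def dest: q_power_inj)

text \<open>If n were 0 in K, then 1 as well as the other powers of q would be roots of 1 + z + ...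
  + z^(n-1): n distinct roots in degree below n.\<close>

lemma of_nat_n_ne_0: "(of_nat n :: 'k) \<noteq> 0"
proof
  assume n0: "(of_nat n :: 'k) = 0"
  let ?f = "\<Sum>i<n. monom (1 :: 'k) i"
  have "poly ?f (1 * q ^ j) = 0" if "j < n" for j
  proof -
    have "poly ?f (q ^ j) = (\<Sum>i<n. (q ^ j) ^ i)" by (simp add: poly_sum poly_monom)
    also have "\<dots> = 0"
    proof (cases "j = 0")
      case False
      have "((q ^ j) - 1) * (\<Sum>i<n. (q ^ j) ^ i) = (q ^ j) ^ n - 1" by (simp add: power_diff_1_eq)
      also have "\<dots> = 0" using qn by (simp flip: power_mult add: mult.commute[of j]) (simp add: power_mult)
      finally show ?thesis using q_power_ne[of j] False that by simp
    qed (simp add: n0)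
    finally show ?thesis by simp
  qed
  moreover have "degree ?f < n" using n_pos by (intro degree_sum_less) (auto simp: degree_monom_eq)
  ultimately have "?f = 0" using card_roots[of 1] by (intro poly_zero_by_roots[of "(\<lambda>j. 1 * q ^ j) ` {..<n}"]) auto
  then have "coeff ?f 0 = 0" by simp
  moreover have "coeff ?f 0 = 1" using n_pos by (simp add: coeff_sum coeff_monom)
  ultimately show False by simp
qed

abbreviation "B \<equiv> qw q"
abbreviation "x \<equiv> op_x q"
abbreviation "y \<equiv> op_y :: 'k poly poly endo"
abbreviation "c0 \<equiv> 1 / (q - 1)"

definition h :: "'k poly poly endo" where "h = y * x + op_c c0"

lemma c0_ne_0: "c0 \<noteq> 0" using q_ne_1 by simp

lemma h_in: "h \<in> B" unfolding h_def by (intro qw.intros)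

lemmas B_intros = qw.intros h_in qwD(1,3,6,7) qw_power

lemma const_comm: "a \<in> B \<Longrightarrow> a * op_c c = op_c c * a"
  by (simp add: qw_const_commute)

lemma const_comm2: "a \<in> B \<Longrightarrow> a * (op_c c * b) = op_c c * (a * b)"
  by (simp only: mult.assoc[symmetric] const_comm)

lemma x_ypow: "x * y ^ m = op_c (q ^ m) * (y ^ m * x) + op_c (qint q m) * y ^ (m - 1)"
proof (induction m)
  case (Suc m)
  have e: "op_c (q * qint q m) * (y * y ^ (m - 1)) = op_c (q * qint q m) * y ^ m"
    by (cases m) (auto simp: op_c_hom)
  have "x * y ^ Suc m = (x * y) * y ^ m" by (simp add: mult.assoc)
  also have "\<dots> = (op_c q * y * x + 1) * y ^ m" by (simp only: xy_rel)
  also have "\<dots> = op_c q * (y * (x * y ^ m)) + y ^ m" by (simp add: algebra_simps)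
  also have "\<dots> = op_c (q ^ Suc m) * (y ^ Suc m * x) + op_c (q * qint q m) * (y * y ^ (m - 1)) + y ^ m"
    unfolding Suc by (simp add: op_c_hom distrib_left mult.assoc const_comm2[OF qw.y])
  also have "\<dots> = op_c (q ^ Suc m) * (y ^ Suc m * x) + op_c (qint q (Suc m)) * y ^ (Suc m - 1)"
    unfolding e by (simp add: qint_Suc' op_c_hom algebra_simps)
  finally show ?case .
qed (simp add: op_c_hom)

lemma xpow_y: "x ^ m * y = op_c (q ^ m) * (y * x ^ m) + op_c (qint q m) * x ^ (m - 1)"
proof (induction m)
  case (Suc m)
  have e: "op_c (q * qint q m) * (x ^ (m - 1) * x) = op_c (q * qint q m) * x ^ m"
    by (cases m) (auto simp: op_c_hom power_commutes)
  have xm: "x ^ m \<in> B" by (intro B_intros)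
  have "x ^ Suc m * y = x ^ m * (x * y)" by (simp add: mult.assoc power_Suc2 del: power_Suc)
  also have "\<dots> = x ^ m * (op_c q * y * x + 1)" by (simp only: xy_rel)
  also have "\<dots> = op_c q * (x ^ m * y * x) + x ^ m"
    by (simp add: distrib_left mult.assoc const_comm2[OF xm])
  also have "\<dots> = op_c (q ^ Suc m) * (y * x ^ Suc m) + op_c (q * qint q m) * (x ^ (m - 1) * x) + x ^ m"
    unfolding Suc by (simp add: op_c_hom distrib_left distrib_right mult.assoc power_commutes)
  also have "\<dots> = op_c (q ^ Suc m) * (y * x ^ Suc m) + op_c (qint q (Suc m)) * x ^ (Suc m - 1)"
    unfolding e by (simp add: qint_Suc' op_c_hom algebra_simps)
  finally show ?case .
qed (simp add: op_c_hom)

text \<open>The correction term carries the factor [n] = 0, and q^n = 1.\<close>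

lemma yn_x: "x * y ^ n = y ^ n * x" and xn_y: "x ^ n * y = y * x ^ n"
  using x_ypow[of n] xpow_y[of n] by (simp_all add: qn op_c_hom)

text \<open>The equation that fixes the constant in h. Since yx = h - c0, it gives xy = qh - c0 with
  the same constant, and then hy = q yh and xh = q hx follow.\<close>

lemma c0_eq: "q * c0 - 1 = c0"
  using q_ne_1 by (simp add: field_simps)

lemma yx: "y * x = h - op_c c0" by (simp add: h_def)

lemma xy: "x * y = op_c q * h - op_c c0"
proof -
  have "x * y = op_c q * (h - op_c c0) + 1" by (simp add: xy_rel mult.assoc yx)
  also have "\<dots> = op_c q * h - op_c (q * c0 - 1)"
    by (simp only: op_c_hom(2,3,6) right_diff_distrib) simp
  finally show ?thesis by (simp only: c0_eq)
qed

lemma hy: "h * y = op_c q * (y * h)"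
proof -
  have "h * y = y * (x * y) + y * op_c c0" by (simp add: h_def distrib_right mult.assoc const_comm[OF qw.y])
  also have "\<dots> = y * (op_c q * h)" by (simp only: xy distrib_left[symmetric]) simp
  finally show ?thesis by (simp add: const_comm2[OF qw.y])
qed

lemma xh: "x * h = op_c q * (h * x)"
proof -
  have "x * h = (x * y) * x + op_c c0 * x" by (simp add: h_def distrib_left mult.assoc const_comm[OF qw.x])
  also have "\<dots> = op_c q * h * x" by (simp only: xy distrib_right[symmetric]) simp
  finally show ?thesis by (simp add: mult.assoc)
qed

lemma op_c_cancel: "a \<noteq> 0 \<Longrightarrow> op_c (inverse a) * (op_c a * e) = e" for a :: 'k
  by (simp only: mult.assoc[symmetric] op_c_hom(2)[symmetric]) (simp add: op_c_hom)

lemma hx: "h * x = op_c (inverse q) * (x * h)"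
  unfolding xh by (rule op_c_cancel[OF q_ne_0, symmetric])

lemma yh: "y * h = op_c (inverse q) * (h * y)"
  unfolding hy by (rule op_c_cancel[OF q_ne_0, symmetric])

text \<open>x^n commutes with right multiplication by x, with left multiplication by y and with
  scalars, and these generate all polynomials from 1; so it acts as multiplication by its value X^n
  at 1.\<close>

lemma xn_mulop: "x ^ n = mulop [:monom 1 n:]"
proof (rule endo_eqI)
  fix v
  show "app (x ^ n) v = app (mulop [:monom 1 n:]) v"
  proof (induction v rule: bipoly_induct)
    case (monom c i j)
    have "app (op_c c * (rop_x ^ j * y ^ i)) 1 = app (op_c c) (app (rop_x ^ j) (monom 1 i))"
      using nf_app[of i q 0] by (simp add: monom_0 one_pCons[symmetric])
    also have "\<dots> = monom (monom c j) i"
    proof -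
      have "app (rop_x ^ j) (monom 1 i) = monom (monom (1 :: 'k) j) i"
        by (simp add: rop_x_def mulop_power[symmetric] smult_monom monom_altdef[of 1 j] const_power)
      then show ?thesis by (simp add: op_c_def smult_monom)
    qed
    finally have v: "monom (monom c j) i = app (op_c c * (rop_x ^ j * y ^ i)) 1" ..
    have xr: "x ^ n * rop_x ^ j = rop_x ^ j * x ^ n"
      by (rule power_commuting_commutes, rule power_commuting_commutes[symmetric], rule rop_x_commute(1))
    have xy': "x ^ n * y ^ i = y ^ i * x ^ n"
      by (rule power_commuting_commutes[symmetric], rule xn_y[symmetric])
    have "x ^ n * (op_c c * (rop_x ^ j * y ^ i)) = op_c c * ((x ^ n * rop_x ^ j) * y ^ i)"
      by (simp only: const_comm2[OF qw_power[OF qw.x]] mult.assoc)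
    also have "\<dots> = op_c c * (rop_x ^ j * (x ^ n * y ^ i))" by (simp only: xr mult.assoc)
    also have "\<dots> = op_c c * (rop_x ^ j * y ^ i) * x ^ n" by (simp only: xy' mult.assoc)
    finally have "x ^ n * (op_c c * (rop_x ^ j * y ^ i)) = op_c c * (rop_x ^ j * y ^ i) * x ^ n" .
    then have "app (x ^ n) (monom (monom c j) i) = app (op_c c * (rop_x ^ j * y ^ i)) (app (x ^ n) 1)"
      unfolding v by (metis app_simps(6))
    also have "app (x ^ n) 1 = [:monom 1 n:]" using nf_app[of 0 q n] by (simp add: monom_0)
    also have "app (op_c c * (rop_x ^ j * y ^ i)) [:monom 1 n:] = [:monom 1 n:] * app (op_c c * (rop_x ^ j * y ^ i)) 1"
      by (simp add: op_c_def rop_x_def op_y_def mulop_power[symmetric] algebra_simps)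
    finally show ?case unfolding v by simp
  qed (simp add: app_add distrib_left)
qed

text \<open>
  Polynomials in \<open>R\<close> over polynomials in \<open>T\<close> model the centre: \<open>zm\<close> sends \<open>T = XX\<close> to \<open>t = x^n\<close>
  and \<open>R = YY\<close> to \<open>r = y^n\<close>, and central elements act on the module by multiplication operators.
\<close>

definition subst_n :: "'k poly poly \<Rightarrow> 'k poly poly" where
  "subst_n z = pcompose (map_poly (\<lambda>c. pcompose c (monom 1 n)) z) (monom 1 n)"

definition zm :: "'k poly poly \<Rightarrow> 'k poly poly endo" where
  "zm z = mulop (subst_n z)"

lemma subst_n_hom: "subst_n (z + w) = subst_n z + subst_n w" "subst_n (z * w) = subst_n z * subst_n w"
  "subst_n 1 = 1"
  by (simp_all add: subst_n_def map_poly_hom pcompose_add pcompose_mult pcompose_1)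

lemma zm_hom: "zm (z + w) = zm z + zm w" "zm (z * w) = zm z * zm w" "zm 1 = 1" "zm 0 = 0"
  "zm (z - w) = zm z - zm w" "zm (- z) = - zm z"
proof -
  show *: "zm (z + w) = zm z + zm w" "zm (z * w) = zm z * zm w" "zm 1 = 1" for z w
    by (simp_all add: zm_def subst_n_hom mulop_hom)
  show 0: "zm 0 = 0" by (simp add: zm_def subst_n_def mulop_hom)
  show "zm (z - w) = zm z - zm w" using *(1)[of "z - w" w] by simp
  show "zm (- z) = - zm z" using *(1)[of z "- z"] 0 by (simp add: eq_neg_iff_add_eq_0 add.commute)
qed

lemma zm_power: "zm (z ^ k) = zm z ^ k"
  by (induction k) (auto simp: zm_hom)

lemma pcompose_monom: "pcompose (monom c k) (monom 1 m) = monom (c :: 'a::comm_ring_1) (m * k)"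
proof (induction k)
  case (Suc k)
  have "pcompose (monom c (Suc k)) (monom 1 m) = monom 1 m * pcompose (monom c k) (monom 1 m)"
    by (simp add: monom_Suc pcompose_pCons)
  then show ?case using Suc by (simp add: mult_monom)
qed (simp add: monom_0)

lemma subst_n_monom: "subst_n (monom (monom c j) i) = monom (monom c (n * j)) (n * i)"
  by (simp add: subst_n_def map_poly_monom pcompose_monom)

lemma monom_eq_ops: "mulop (monom (monom c (n * j)) (n * i)) = op_c c * ((y ^ n) ^ i * (x ^ n) ^ j)"
proof -
  have "monom (monom c (n * j)) (n * i) = [:[:c:]:] * (YY ^ n) ^ i * [:monom 1 n:] ^ j"
    by (simp add: const_power monom_altdef[of _ "n * i"] monom_altdef[of c "n * j"]
        monom_altdef[of _ n] power_mult)
  then show ?thesis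
    by (simp only: xn_mulop op_y_def op_c_def mulop_hom mulop_power mult.assoc)
qed

lemma zm_monom: "zm (monom (monom c j) i) = op_c c * ((y ^ n) ^ i * (x ^ n) ^ j)"
  by (simp only: zm_def subst_n_monom monom_eq_ops)

lemma zm_simps: "zm XX = x ^ n" "zm YY = y ^ n" "zm [:[:c:]:] = op_c c"
proof -
  show "zm XX = x ^ n" using zm_monom[of 1 1 0] by (simp add: monom_altdef op_c_hom)
  show "zm YY = y ^ n" using zm_monom[of 1 0 1] by (simp add: monom_altdef op_c_hom one_pCons[symmetric])
  show "zm [:[:c:]:] = op_c c" using zm_monom[of c 0 0] by (simp add: monom_altdef)
qed

lemma zm_in: "zm z \<in> B"
  by (induction z rule: bipoly_induct) (auto simp: zm_monom zm_hom intro!: B_intros)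

lemma power_commute_right: "a * b = b * a \<Longrightarrow> a * b ^ k = b ^ k * a" for a b :: "'k poly poly endo"
  by (metis power_commuting_commutes)

lemma zm_central:
  assumes "a \<in> B"
  shows "a * zm z = zm z * a"
  using assms
proof (induction)
  case (const c)
  show ?case by (rule qw_const_commute[OF zm_in])
next
  case x
  show ?case
  proof (induction z rule: bipoly_induct)
    case (monom c i j)
    have 1: "x * (y ^ n) ^ i = (y ^ n) ^ i * x" by (rule power_commute_right, rule yn_x)
    have 2: "x * (x ^ n) ^ j = (x ^ n) ^ j * x" by (simp flip: power_mult add: power_commutes)
    show ?case unfolding zm_monom const_comm2[OF qw.x]
      by (simp only: mult.assoc[symmetric] 1) (simp only: mult.assoc 2)
  qed (simp add: zm_hom algebra_simps)
next
  case y
  show ?case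
  proof (induction z rule: bipoly_induct)
    case (monom c i j)
    have 1: "y * (y ^ n) ^ i = (y ^ n) ^ i * y" by (simp flip: power_mult add: power_commutes)
    have 2: "y * (x ^ n) ^ j = (x ^ n) ^ j * y" by (rule power_commute_right, rule xn_y[symmetric])
    show ?case unfolding zm_monom const_comm2[OF qw.y]
      by (simp only: mult.assoc[symmetric] 1) (simp only: mult.assoc 2)
  qed (simp add: zm_hom algebra_simps)
next
  case (add a b)
  then show ?case by (simp add: algebra_simps)
next
  case (mult a b)
  have "a * b * zm z = a * (zm z * b)" by (simp only: mult.assoc mult.IH(2))
  also have "\<dots> = zm z * (a * b)" by (simp only: mult.assoc[symmetric] mult.IH(1))
  finally show ?case .
qed

lemma zm_left: "a \<in> B \<Longrightarrow> a * (zm z * b) = zm z * (a * b)"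
  by (simp only: mult.assoc[symmetric] zm_central)

end

section \<open>Extension and contraction of ideals\<close>

text \<open>Picks the coefficients in one residue class modulo n. The guard for n = 0 preserves
  finite support, since the index would otherwise be constant.\<close>

lift_definition decim :: "nat \<Rightarrow> nat \<Rightarrow> 'a::zero poly \<Rightarrow> 'a poly" is
  "\<lambda>n i f k. if n = 0 then 0 else f (i + n * k)"
proof -
  fix n i :: nat and f :: "nat \<Rightarrow> 'a" assume "\<forall>\<^sub>\<infinity>k. f k = 0"
  then obtain m where m: "\<And>k. k > m \<Longrightarrow> f k = 0" unfolding MOST_nat by blast
  have "(if n = 0 then 0 else f (i + n * k)) = 0" if "k > m" for k
  proof (cases "n = 0")
    case False
    then have "k \<le> n * k" by simp
    then have "m < i + n * k" using that by linarith
    then show ?thesis using m by simp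
  qed simp
  then show "\<forall>\<^sub>\<infinity>k. (if n = 0 then 0 else f (i + n * k)) = 0" unfolding MOST_nat by blast
qed

lemma coeff_decim: "coeff (decim n i f) k = (if n = 0 then 0 else coeff f (i + n * k))"
  by (simp add: decim.rep_eq)

lemma tprime_central:
  assumes B: "tsubring B" and P: "tprime B P" and ab: "a \<in> B" "b \<in> B" "a * b \<in> P"
    and central: "\<And>c. c \<in> B \<Longrightarrow> a * c = c * a"
  shows "a \<in> P \<or> b \<in> P"
proof (rule tprimeD(3)[OF P ab(1,2)])
  fix c assume c: "c \<in> B"
  have "a * c * b = c * (a * b)" using central[OF c] by (simp add: mult.assoc)
  then show "a * c * b \<in> P" using tidealD(5)[OF tprimeD(1)[OF P] ab(3) c] by simp
qed

lemma tideal_image_ideal: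
  assumes "tideal B I" "\<phi> 0 = 0" "\<And>a b. \<phi> (a + b) = \<phi> a + \<phi> b" "\<And>a b. \<phi> (a * b) = \<phi> a * \<phi> b"
    and "\<And>a. \<phi> a \<in> B"
  shows "tideal UNIV {a. \<phi> a \<in> I}"
  using tidealD[OF assms(1)] assms(2-5) by (auto simp: tideal_def)

context root_of_unity
begin

text \<open>The coordinate of y^i x^j over the centre: the part whose Y-exponents are i and whose
  X-exponents are j modulo n, with the exponents divided by n.\<close>

definition comp :: "nat \<Rightarrow> nat \<Rightarrow> 'k poly poly \<Rightarrow> 'k poly poly" where
  "comp i j v = map_poly (decim n j) (decim n i v)"

lemma cf_comp: "cf (comp i j v) k l = cf v (i + n * k) (j + n * l)"
proof -
  have "decim n j (0 :: 'k poly) = 0" by (simp add: poly_eq_iff coeff_decim)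
  then show ?thesis using n_pos by (simp add: comp_def coeff_map_poly coeff_decim)
qed

lemma comp_add: "comp i j (v + w) = comp i j v + comp i j w"
  by (rule cf_eqI) (simp add: cf_comp)

lemma block_le: "i < n \<Longrightarrow> n * k \<le> i + n * k' \<longleftrightarrow> k \<le> k'"
proof
  assume i: "i < n" and le: "n * k \<le> i + n * k'"
  show "k \<le> k'"
  proof (rule ccontr)
    assume "\<not> k \<le> k'"
    then have "n * Suc k' \<le> n * k" by (intro mult_le_mono2) simp
    then show False using i le by simp
  qed
qed (simp add: trans_le_add2)

lemma block_diff: "k \<le> k' \<Longrightarrow> i + n * k' - n * k = i + n * (k' - k)"
  by (simp add: diff_mult_distrib2)

lemma block_eq: "i < n \<Longrightarrow> a = i + n * k \<longleftrightarrow> a mod n = i \<and> a div n = k"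
  by auto

lemma cf_monom_mult: "cf (monom (monom c b) a * w) i j = (if a \<le> i \<and> b \<le> j then c * cf w (i - a) (j - b) else 0)"
  by (auto simp: coeff_monom_mult not_le)

lemma comp_subst:
  assumes "i < n" "j < n"
  shows "comp i j (subst_n z * v) = z * comp i j v"
proof (induction z rule: bipoly_induct)
  case (monom c l k)
  show ?case
    by (rule cf_eqI) (simp add: cf_comp subst_n_monom cf_monom_mult block_le assms block_diff)
qed (simp add: subst_n_hom distrib_right comp_add)

lemma comp_monom:
  assumes "i < n" "j < n"
  shows "comp i j (monom (monom c b) a) =
    (if a mod n = i \<and> b mod n = j then monom (monom c (b div n)) (a div n) else 0)"
proof (rule cf_eqI)
  fix k l
  have "cf (comp i j (monom (monom c b) a)) k l = (if a = i + n * k \<and> b = j + n * l then c else 0)"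
    by (auto simp: cf_comp coeff_monom)
  then show "cf (comp i j (monom (monom c b) a)) k l =
    cf (if a mod n = i \<and> b mod n = j then monom (monom c (b div n)) (a div n) else 0) k l"
    using block_eq[OF assms(1), of a k] block_eq[OF assms(2), of b l] by (auto simp: coeff_monom)
qed

lemma comp_expansion:
  "v = (\<Sum>i<n. \<Sum>j<n. subst_n (comp i j v) * monom (monom 1 j) i)"
proof (induction v rule: bipoly_induct)
  case (monom c a b)
  have z: "subst_n 0 = 0" by (simp add: subst_n_def)
  have "(\<Sum>i<n. \<Sum>j<n. subst_n (comp i j (monom (monom c b) a)) * monom (monom 1 j) i) =
    (\<Sum>i<n. \<Sum>j<n. if a mod n = i \<and> b mod n = j then monom (monom c b) a else 0)"
    by (intro sum.cong refl) (auto simp: comp_monom subst_n_monom mult_monom z)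
  also have "\<dots> = (\<Sum>i<n. if a mod n = i then \<Sum>j<n. if b mod n = j then monom (monom c b) a else 0 else 0)"
    by (intro sum.cong refl) auto
  also have "\<dots> = monom (monom c b) a" using n_pos by (simp add: sum.delta')
  finally show ?case by simp
next
  case (add v w)
  have "(\<Sum>i<n. \<Sum>j<n. subst_n (comp i j (v + w)) * monom (monom 1 j) i) =
    (\<Sum>i<n. \<Sum>j<n. subst_n (comp i j v) * monom (monom 1 j) i) +
    (\<Sum>i<n. \<Sum>j<n. subst_n (comp i j w) * monom (monom 1 j) i)"
    by (simp add: comp_add subst_n_hom distrib_right sum.distrib)
  then show ?case using add by simp
qed

lemma zm_app: "app (zm z) v = subst_n z * v"
  by (simp add: zm_def)

text \<open>The coordinates over the centre are read off from the value at 1.\<close>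

lemma expansion:
  assumes "b \<in> B"
  shows "b = (\<Sum>i<n. \<Sum>j<n. zm (comp i j (app b 1)) * (y ^ i * x ^ j))"
proof (rule qw_eqI[OF assms])
  show "(\<Sum>i<n. \<Sum>j<n. zm (comp i j (app b 1)) * (y ^ i * x ^ j)) \<in> B"
    by (intro qw_sum qw.mult zm_in qw_power qw.x qw.y)
  have "app (\<Sum>i<n. \<Sum>j<n. zm (comp i j (app b 1)) * (y ^ i * x ^ j)) 1 =
    (\<Sum>i<n. \<Sum>j<n. subst_n (comp i j (app b 1)) * monom (monom 1 j) i)"
    unfolding app_endo_sum times_endo.rep_eq zm_app nf_app[simplified] using nf_app by simp
  then show "app b 1 = app (\<Sum>i<n. \<Sum>j<n. zm (comp i j (app b 1)) * (y ^ i * x ^ j)) 1"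
    using comp_expansion[of "app b 1"] by simp
qed

text \<open>The extension of p to the whole ring, described by coordinates: the ring is free over
  its centre. \<open>carrier_prod\<close> identifies it with the ideal product.\<close>

definition ext :: "'k poly poly set \<Rightarrow> 'k poly poly endo set" where
  "ext p = {b \<in> B. \<forall>i<n. \<forall>j<n. comp i j (app b 1) \<in> p}"

definition con :: "'k poly poly endo set \<Rightarrow> 'k poly poly set" where
  "con P = {z. zm z \<in> P}"

lemma tideal_con: "tideal B I \<Longrightarrow> tideal UNIV (con I)"
  unfolding con_def by (rule tideal_image_ideal) (auto simp: zm_hom zm_in)

lemma cprime_con:
  assumes "tprime B P"
  shows "cprime (con P)"
  unfolding cprime_def
proof (intro conjI allI impI)
  show "tideal UNIV (con P)" using tideal_con tprimeD(1)[OF assms] .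
  show "1 \<notin> con P" using tprimeD(2)[OF assms] by (simp add: con_def zm_hom)
  fix a b assume "a * b \<in> con P"
  then show "a \<in> con P \<or> b \<in> con P"
    unfolding con_def
    using tprime_central[OF tsubring_qw assms zm_in zm_in, of a b] zm_central by (simp add: zm_hom)
qed

lemma comp_0 [simp]: "comp i j 0 = 0"
  by (rule cf_eqI) (simp add: cf_comp)

lemma comp_one: "comp 0 0 1 = 1" "i < n \<Longrightarrow> j < n \<Longrightarrow> i \<noteq> 0 \<or> j \<noteq> 0 \<Longrightarrow> comp i j 1 = 0"
  using comp_monom[of _ _ 1 0 0] n_pos by (auto simp: monom_0 one_pCons[symmetric])

lemma zm_mult_ext: "tideal UNIV p \<Longrightarrow> z \<in> p \<Longrightarrow> b \<in> B \<Longrightarrow> zm z * b \<in> ext p"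
  by (auto simp: ext_def zm_app comp_subst intro: qw.mult zm_in cideal_mult)

lemma ext_add: "tideal UNIV p \<Longrightarrow> a \<in> ext p \<Longrightarrow> b \<in> ext p \<Longrightarrow> a + b \<in> ext p"
  by (auto simp: ext_def comp_add intro: qw.add tidealD(3))

lemma ext_zero: "tideal UNIV p \<Longrightarrow> 0 \<in> ext p"
  by (auto simp: ext_def qwD(3) intro: tidealD(2))

lemma ext_sum: "tideal UNIV p \<Longrightarrow> (\<And>i. i \<in> F \<Longrightarrow> f i \<in> ext p) \<Longrightarrow> sum f F \<in> ext p"
  by (induction F rule: infinite_finite_induct) (auto intro: ext_add ext_zero)

lemma tideal_ext:
  assumes p: "tideal UNIV p"
  shows "tideal B (ext p)"
  unfolding tideal_def
proof (intro conjI ballI)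
  show "ext p \<subseteq> B" by (auto simp: ext_def)
  show "0 \<in> ext p" by (rule ext_zero[OF p])
  show "a + b \<in> ext p" if "a \<in> ext p" "b \<in> ext p" for a b using ext_add[OF p that] .
  fix a b assume a: "a \<in> ext p" and b: "b \<in> B"
  then have aB: "a \<in> B" and c: "\<And>i j. i < n \<Longrightarrow> j < n \<Longrightarrow> comp i j (app a 1) \<in> p" by (auto simp: ext_def)
  have "a * b = (\<Sum>i<n. \<Sum>j<n. zm (comp i j (app a 1)) * (y ^ i * x ^ j * b))"
    by (subst expansion[OF aB]) (simp add: sum_distrib_right mult.assoc)
  also have "\<dots> \<in> ext p"
    using c by (intro ext_sum[OF p] zm_mult_ext[OF p] B_intros b) auto
  finally show "a * b \<in> ext p" .
  have "b * a = (\<Sum>i<n. \<Sum>j<n. zm (comp i j (app a 1)) * (b * (y ^ i * x ^ j)))"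
    by (subst expansion[OF aB]) (simp add: sum_distrib_left zm_left[OF b])
  also have "\<dots> \<in> ext p"
    using c by (intro ext_sum[OF p] zm_mult_ext[OF p] B_intros b) auto
  finally show "b * a \<in> ext p" .
qed

lemma ext_least:
  assumes "tideal B I" "p \<subseteq> con I"
  shows "ext p \<subseteq> I"
proof
  fix a assume a: "a \<in> ext p"
  then have aB: "a \<in> B" and c: "\<And>i j. i < n \<Longrightarrow> j < n \<Longrightarrow> comp i j (app a 1) \<in> p" by (auto simp: ext_def)
  have "zm (comp i j (app a 1)) * (y ^ i * x ^ j) \<in> I" if "i < n" "j < n" for i j
    using c[OF that] assms(2) by (intro tidealD(4)[OF assms(1)] B_intros) (auto simp: con_def)
  then have "(\<Sum>i<n. \<Sum>j<n. zm (comp i j (app a 1)) * (y ^ i * x ^ j)) \<in> I"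
    by (intro tideal_sum[OF assms(1)]) auto
  then show "a \<in> I" using expansion[OF aB] by simp
qed

lemma con_ext:
  assumes "tideal UNIV p"
  shows "con (ext p) = p"
proof -
  have "z \<in> con (ext p) \<longleftrightarrow> z \<in> p" for z
  proof
    assume "z \<in> con (ext p)"
    then have "comp 0 0 (app (zm z) 1) \<in> p" using n_pos by (simp add: con_def ext_def)
    then show "z \<in> p" using n_pos comp_subst[of 0 0 z 1] by (simp add: zm_def comp_one)
  next
    assume "z \<in> p"
    then show "z \<in> con (ext p)" using zm_mult_ext[OF assms, of z 1] by (simp add: con_def qwD)
  qed
  then show ?thesis by blast
qed

text \<open>The quotient by the extension is free over the domain of the centre modulo p, hence
  torsion-free.\<close>

lemma ext_torsion_free:
  assumes "cprime p" "zm z * b \<in> ext p" "b \<in> B" "z \<notin> p"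
  shows "b \<in> ext p"
proof -
  have "comp i j (app b 1) \<in> p" if "i < n" "j < n" for i j
  proof -
    have "comp i j (app (zm z * b) 1) \<in> p" using assms(2) that by (simp add: ext_def)
    then have "z * comp i j (app b 1) \<in> p" using comp_subst[OF that] by (simp add: zm_app)
    then show ?thesis using cprimeD(3)[OF assms(1)] assms(4) by blast
  qed
  then show ?thesis using assms(3) by (simp add: ext_def)
qed

lemma ext_mono: "p \<subseteq> p' \<Longrightarrow> ext p \<subseteq> ext p'"
  by (auto simp: ext_def)

lemma con_mono: "P \<subseteq> P' \<Longrightarrow> con P \<subseteq> con P'"
  by (auto simp: con_def)

lemma ext_zero_ideal: "ext {0} = {0}"
proof
  show "ext {0} \<subseteq> {0}"
    by (rule ext_least[OF tideal_zero[OF tsubring_qw]]) (auto simp: con_def zm_hom)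
qed (use ext_zero[OF tideal_zero[OF tsubring_UNIV]] in auto)

lemma tgen_zm:
  assumes p: "p = tgen UNIV G"
  shows "tgen B (zm ` G) = ext p"
proof (rule tgen_eqI)
  have tp: "tideal UNIV p" unfolding p by (rule tideal_tgen) auto
  show "tideal B (ext p)" by (rule tideal_ext[OF tp])
  have "G \<subseteq> p" unfolding p by (rule tgen_incl)
  then have "G \<subseteq> con (ext p)" using con_ext[OF tp] by simp
  then show "zm ` G \<subseteq> ext p" by (auto simp: con_def)
  fix J assume J: "tideal B J" "zm ` G \<subseteq> J"
  have "p \<subseteq> con J" unfolding p using J tideal_con[OF J(1)] by (intro tgen_least) (auto simp: con_def)
  then show "ext p \<subseteq> J" by (rule ext_least[OF J(1)])
qed

text \<open>
  The averages over conjugation by \<open>v\<close> extract the eigencomponents of an element of an ideal.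
\<close>

lemma eigencomponent:
  assumes I: "tideal B I" and v: "v \<in> B" and e: "\<And>i. i < n \<Longrightarrow> e i \<in> B"
    and \<theta>: "\<theta> ^ n = 1" "\<And>k. 0 < k \<Longrightarrow> k < n \<Longrightarrow> \<theta> ^ k \<noteq> 1"
    and eig: "\<And>i. i < n \<Longrightarrow> v * e i = op_c (\<theta> ^ i) * (e i * v)"
    and sum: "(\<Sum>i<n. e i) \<in> I" and k: "k < n"
  shows "e k * v ^ n \<in> I"
proof -
  have \<theta>0: "\<theta> \<noteq> 0" using \<theta>(1) n_pos by (auto simp: power_0_left)
  have pw: "v ^ m * e i = op_c ((\<theta> ^ i) ^ m) * (e i * v ^ m)" if "i < n" for i m
  proof (induction m)
    case (Suc m)
    have "v ^ Suc m * e i = v ^ m * (v * e i)" by (simp add: mult.assoc power_Suc2 del: power_Suc)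
    also have "\<dots> = op_c (\<theta> ^ i) * (v ^ m * e i * v)"
      by (simp only: eig[OF that] const_comm2[OF qw_power[OF v]] mult.assoc)
    also have "\<dots> = op_c ((\<theta> ^ i) ^ Suc m) * (e i * v ^ Suc m)"
      unfolding Suc power_Suc2[of v] power_Suc[of "\<theta> ^ i"] by (simp only: op_c_hom(2) mult.assoc)
    finally show ?case .
  qed (simp add: op_c_hom)
  \<comment> \<open>The ratio of the i-th and k-th eigenvalues. It is an n-th root of unity, equal
    to 1 only for i = k, so its powers sum to zero unless i = k.\<close>
  define \<mu> where "\<mu> i = \<theta> ^ i * inverse (\<theta> ^ k)" for i
  have geo: "(\<Sum>m<n. \<mu> i ^ m) = (if i = k then of_nat n else 0)" if "i < n" for i
  proof (cases "i = k")
    case True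
    then show ?thesis using \<theta>0 by (simp add: \<mu>_def)
  next
    case False
    have "\<mu> i \<noteq> 1"
    proof
      assume "\<mu> i = 1"
      then have eq: "\<theta> ^ i = \<theta> ^ k" using \<theta>0 by (simp add: \<mu>_def field_simps)
      have "\<theta> ^ (max i k - min i k) = 1"
      proof -
        have "\<theta> ^ min i k * \<theta> ^ (max i k - min i k) = \<theta> ^ max i k" by (simp flip: power_add)
        also have "\<dots> = \<theta> ^ min i k * 1" using eq by (auto simp: max_def min_def)
        finally show ?thesis using \<theta>0 by simp
      qed
      moreover have "0 < max i k - min i k" "max i k - min i k < n" using False that k by linarith+
      ultimately show False using \<theta>(2) by blast
    qed
    moreover have "\<mu> i ^ n = 1"
    proof -
      have "(\<theta> ^ i) ^ n = (\<theta> ^ n) ^ i" "(\<theta> ^ k) ^ n = (\<theta> ^ n) ^ k" by (simp_all add: power_mult[symmetric] mult.commute)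
      then show ?thesis using \<theta>(1) by (simp add: \<mu>_def power_mult_distrib power_inverse)
    qed
    moreover have "(\<mu> i - 1) * (\<Sum>m<n. \<mu> i ^ m) = \<mu> i ^ n - 1" by (simp add: power_diff_1_eq)
    ultimately show ?thesis using False by simp
  qed
  let ?S = "\<Sum>i<n. e i"
  \<comment> \<open>In place of the conjugate v^m S v^(-m) stands v^m S v^(n-m), which makes sense
    without an inverse of v; this is the source of the factor v^n.\<close>
  define A where "A = (\<Sum>m<n. op_c (inverse (\<theta> ^ k) ^ m) * (v ^ m * ?S * v ^ (n - m)))"
  have "A \<in> I" unfolding A_def
    by (intro tideal_sum[OF I] tidealD(4,5)[OF I] sum B_intros v)
  have "A = (\<Sum>m<n. \<Sum>i<n. op_c (\<mu> i ^ m) * (e i * v ^ n))"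
    unfolding A_def
  proof (rule sum.cong[OF refl])
    fix m assume "m \<in> {..<n}"
    then have vn: "v ^ m * v ^ (n - m) = v ^ n" by (simp flip: power_add)
    have "op_c (inverse (\<theta> ^ k) ^ m) * (v ^ m * ?S * v ^ (n - m)) =
      (\<Sum>i<n. op_c (inverse (\<theta> ^ k) ^ m) * (v ^ m * e i * v ^ (n - m)))"
      by (simp add: sum_distrib_left sum_distrib_right)
    also have "\<dots> = (\<Sum>i<n. op_c (\<mu> i ^ m) * (e i * v ^ n))"
    proof (rule sum.cong[OF refl])
      fix i assume "i \<in> {..<n}"
      then have "op_c (inverse (\<theta> ^ k) ^ m) * (v ^ m * e i * v ^ (n - m)) =
         op_c (inverse (\<theta> ^ k) ^ m * (\<theta> ^ i) ^ m) * (e i * (v ^ m * v ^ (n - m)))"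
        by (simp add: pw op_c_hom(2) mult.assoc)
      then show "op_c (inverse (\<theta> ^ k) ^ m) * (v ^ m * e i * v ^ (n - m)) = op_c (\<mu> i ^ m) * (e i * v ^ n)"
        unfolding vn by (simp add: \<mu>_def power_mult_distrib mult.commute)
    qed
    finally show "op_c (inverse (\<theta> ^ k) ^ m) * (v ^ m * ?S * v ^ (n - m)) =
      (\<Sum>i<n. op_c (\<mu> i ^ m) * (e i * v ^ n))" .
  qed
  also have "\<dots> = (\<Sum>i<n. (\<Sum>m<n. op_c (\<mu> i ^ m)) * (e i * v ^ n))"
    by (subst sum.swap) (simp add: sum_distrib_right)
  also have "\<dots> = (\<Sum>i<n. if i = k then op_c (of_nat n) * (e i * v ^ n) else 0)"
  proof (rule sum.cong[OF refl])
    have csum: "(\<Sum>m<n. op_c (f m)) = op_c (\<Sum>m<n. f m)" for f :: "nat \<Rightarrow> 'k"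
      by (induction n) (simp_all add: op_c_hom)
    fix i assume "i \<in> {..<n}"
    then show "(\<Sum>m<n. op_c (\<mu> i ^ m)) * (e i * v ^ n) = (if i = k then op_c (of_nat n) * (e i * v ^ n) else 0)"
      by (simp add: csum geo op_c_hom)
  qed
  also have "\<dots> = op_c (of_nat n) * (e k * v ^ n)" using k by (simp add: sum.delta')
  finally have "op_c (of_nat n) * (e k * v ^ n) \<in> I" using \<open>A \<in> I\<close> by simp
  then have "op_c (inverse (of_nat n)) * (op_c (of_nat n) * (e k * v ^ n)) \<in> I"
    by (rule tidealD(5)[OF I]) (rule qw.const)
  then show ?thesis by (simp add: op_c_cancel[OF of_nat_n_ne_0])
qed

end

lemma peval_diff: "peval a (f - g) = peval a f - peval a g"
  using peval_add[of a "f - g" g] by (simp add: algebra_simps)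

context root_of_unity
begin

lemma y_peval_h: "y * peval h f = peval h (pcompose f [:0, inverse q:]) * y"
proof (induction f)
  case (pCons c f)
  let ?g = "pcompose f [:0, inverse q:]"
  have "y * peval h (pCons c f) = y * op_c c + (y * h) * peval h f" by (simp add: distrib_left mult.assoc)
  also have "\<dots> = op_c c * y + op_c (inverse q) * (h * (y * peval h f))"
    by (simp add: yh mult.assoc const_comm[OF qw.y])
  also have "\<dots> = op_c c * y + h * (op_c (inverse q) * peval h ?g) * y"
    unfolding pCons by (simp add: const_comm2[OF h_in] mult.assoc)
  also have "\<dots> = peval h (pcompose (pCons c f) [:0, inverse q:]) * y"
    by (simp add: pcompose_pCons peval_smult[OF h_in] distrib_right)
  finally show ?case .
qed simp

text \<open>In y (y^k x^k) x the inner factor is a polynomial in h; moving y past it replaces h by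
  h/q and leaves the factor yx = h - c0.\<close>

lemma y_pow_x_pow: "y ^ k * x ^ k = peval h (\<Prod>j<k. [:- c0, inverse q ^ j:])"
proof (induction k)
  case (Suc k)
  let ?F = "\<Prod>j<k. [:- c0, inverse q ^ j:]"
  have c: "pcompose ?F [:0, inverse q:] = (\<Prod>j<k. [:- c0, inverse q ^ Suc j:])"
    by (simp add: pcompose_prod pcompose_pCons mult.commute)
  have "y ^ Suc k * x ^ Suc k = y * (y ^ k * x ^ k) * x"
    by (simp add: mult.assoc power_Suc2[of x] del: power_Suc) (simp add: mult.assoc)
  also have "\<dots> = peval h (pcompose ?F [:0, inverse q:]) * (y * x)"
    unfolding Suc y_peval_h by (simp add: mult.assoc)
  also have "y * x = peval h [:- c0, 1:]" by (simp add: yx op_c_hom)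
  also have "peval h (pcompose ?F [:0, inverse q:]) * peval h [:- c0, 1:] =
      peval h ([:- c0, 1:] * (\<Prod>j<k. [:- c0, inverse q ^ Suc j:]))"
    unfolding c by (simp only: peval_mult[OF h_in, symmetric] mult.commute)
  also have "[:- c0, 1:] * (\<Prod>j<k. [:- c0, inverse q ^ Suc j:]) = (\<Prod>j<Suc k. [:- c0, inverse q ^ j:])"
    by (simp add: prod.lessThan_Suc_shift del: prod.lessThan_Suc)
  finally show ?case .
qed simp

text \<open>This is q^(-n(n-1)/2), the inverse of the product of all n-th roots of unity, hence the
  sign (-1)^(n-1) in the formula for s.\<close>

definition \<alpha> :: 'k where "\<alpha> = (\<Prod>j<n. inverse q ^ j)"

lemma \<alpha>_ne_0: "\<alpha> \<noteq> 0" using q_ne_0 by (simp add: \<alpha>_def)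

text \<open>Equal coefficients at n leave a difference of degree below n, and it vanishes at the n
  distinct points c0 q^i.\<close>

lemma prod_linear: "(\<Prod>j<n. [:- c0, inverse q ^ j:]) = smult \<alpha> (monom 1 n - [:c0 ^ n:])"
proof -
  let ?F = "\<Prod>j<n. [:- c0, inverse q ^ j:]"
  define G where "G = ?F - smult \<alpha> (monom 1 n - [:c0 ^ n:])"
  have dF: "degree ?F = n"
  proof -
    have "degree ?F = (\<Sum>j<n. degree [:- c0, inverse q ^ j:])" using q_ne_0 by (intro degree_prod_eq_sum_degree) auto
    then show ?thesis using q_ne_0 by simp
  qed
  have "lead_coeff ?F = \<alpha>" unfolding lead_coeff_prod \<alpha>_def using q_ne_0 by (intro prod.cong) auto
  then have cF: "coeff ?F n = \<alpha>" unfolding dF .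
  have "coeff G n = 0" using cF n_pos by (simp add: G_def coeff_pCons split: nat.splits)
  moreover have "degree G \<le> n" unfolding G_def
    by (intro degree_diff_le) (auto simp: dF intro!: degree_diff_le order_trans[OF degree_smult_le] degree_monom_le)
  ultimately have dG: "degree G < n"
    using n_pos by (metis degree_0 leading_coeff_0_iff le_neq_implies_less)
  have "poly G (c0 * q ^ i) = 0" if "i < n" for i
  proof -
    have "inverse q ^ i * q ^ i = 1" using q_ne_0 by (simp flip: power_mult_distrib)
    then have "poly [:- c0, inverse q ^ i:] (c0 * q ^ i) = 0" by (simp add: algebra_simps)
    then have "poly ?F (c0 * q ^ i) = 0" using that by (auto simp: poly_prod intro!: prod_zero)
    moreover have "(c0 * q ^ i) ^ n = c0 ^ n"
    proof -
      have "(q ^ i) ^ n = (q ^ n) ^ i" by (simp add: power_mult[symmetric] mult.commute)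
      then show ?thesis using qn by (simp only: power_mult_distrib power_one mult_1_right)
    qed
    ultimately show ?thesis by (simp add: G_def poly_monom)
  qed
  then have "G = 0" using card_roots[OF c0_ne_0] dG
    by (intro poly_zero_by_roots[of "(\<lambda>j. c0 * q ^ j) ` {..<n}"]) auto
  then show ?thesis by (simp add: G_def)
qed

text \<open>The preimage of h^n under \<open>zm\<close>, obtained by solving y^n x^n = \<alpha> (h^n
  - c0^n) for h^n.\<close>

definition sS :: "'k poly poly" where "sS = [:[:c0 ^ n:], [:0, inverse \<alpha>:]:]"

lemma zm_sS: "zm sS = h ^ n"
proof -
  have "y ^ n * x ^ n = op_c \<alpha> * (h ^ n - op_c (c0 ^ n))"
    unfolding y_pow_x_pow prod_linear
    by (simp add: peval_smult[OF h_in] peval_diff peval_monom[OF h_in] op_c_hom(3))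
  then have e: "op_c (inverse \<alpha>) * (y ^ n * x ^ n) = h ^ n - op_c (c0 ^ n)"
    by (simp only: op_c_cancel[OF \<alpha>_ne_0])
  have "sS = [:[:c0 ^ n:]:] + monom (monom (inverse \<alpha>) 1) 1"
    by (simp add: sS_def monom_altdef)
  then have "zm sS = op_c (c0 ^ n) + op_c (inverse \<alpha>) * (y ^ n * x ^ n)"
    using zm_monom[of "inverse \<alpha>" 1 1] by (simp only: zm_hom zm_simps power_one_right)
  then show ?thesis unfolding e by simp
qed

lemma hn_central: "a \<in> B \<Longrightarrow> a * h ^ n = h ^ n * a"
  unfolding zm_sS[symmetric] by (rule zm_central)

lemma eig_power:
  assumes "u \<in> B" "v * u = op_c \<theta> * (u * v)"
  shows "v * u ^ j = op_c (\<theta> ^ j) * (u ^ j * v)"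
proof (induction j)
  case (Suc j)
  have "v * u ^ Suc j = v * u ^ j * u" by (simp only: power_Suc2 mult.assoc)
  also have "\<dots> = op_c (\<theta> ^ j) * (u ^ j * (v * u))" unfolding Suc by (simp only: mult.assoc)
  also have "\<dots> = op_c (\<theta> ^ j) * (op_c \<theta> * (u ^ j * (u * v)))"
    unfolding assms(2) const_comm2[OF qw_power[OF assms(1)]] ..
  also have "\<dots> = op_c (\<theta> ^ Suc j) * (u ^ Suc j * v)"
    unfolding power_Suc2[of \<theta>] power_Suc2[of u] by (simp only: op_c_hom(2) mult.assoc)
  finally show ?case .
qed (simp add: op_c_hom)

text \<open>Exponents below n are enough because h^n and u^n are central;
  \<open>hu_span_term\<close> absorbs the excess into the coefficients.\<close>

definition hu_span :: "'k poly poly endo \<Rightarrow> 'k poly poly endo set" where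
  "hu_span u = {a. \<exists>z. a = (\<Sum>i<n. \<Sum>j<n. zm (z i j) * (h ^ i * u ^ j))}"

lemma hu_span_add: "a \<in> hu_span u \<Longrightarrow> b \<in> hu_span u \<Longrightarrow> a + b \<in> hu_span u"
proof -
  assume "a \<in> hu_span u" "b \<in> hu_span u"
  then obtain z w where "a = (\<Sum>i<n. \<Sum>j<n. zm (z i j) * (h ^ i * u ^ j))" "b = (\<Sum>i<n. \<Sum>j<n. zm (w i j) * (h ^ i * u ^ j))"
    unfolding hu_span_def by blast
  then have "a + b = (\<Sum>i<n. \<Sum>j<n. zm (z i j + w i j) * (h ^ i * u ^ j))"
    by (simp add: zm_hom distrib_right sum.distrib)
  then show ?thesis unfolding hu_span_def by (intro CollectI exI[of _ "\<lambda>i j. z i j + w i j"])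
qed

lemma hu_span_term:
  assumes u: "u \<in> B" and un: "u ^ n = zm \<tau>"
  shows "zm z * (h ^ i * u ^ j) \<in> hu_span u"
proof -
  let ?w = "z * (sS ^ (i div n) * \<tau> ^ (j div n))"
  let ?a = "i mod n" and ?b = "j mod n"
  have hi: "h ^ i = zm (sS ^ (i div n)) * h ^ ?a"
    by (simp add: zm_power zm_sS power_mult[symmetric] power_add[symmetric])
  have uj: "u ^ j = zm (\<tau> ^ (j div n)) * u ^ ?b"
    by (simp add: zm_power un[symmetric] power_mult[symmetric] power_add[symmetric])
  have "zm z * (h ^ i * u ^ j) = zm ?w * (h ^ ?a * u ^ ?b)"
    unfolding hi uj by (simp only: zm_hom(2) mult.assoc zm_left[OF qw_power[OF h_in]])
  also have "\<dots> = (\<Sum>i'<n. if i' = ?a then (\<Sum>j'<n. if j' = ?b then zm ?w * (h ^ i' * u ^ j') else 0) else 0)"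
    using n_pos by (simp add: sum.delta)
  also have "\<dots> = (\<Sum>i'<n. \<Sum>j'<n. zm (if i' = ?a then if j' = ?b then ?w else 0 else 0) * (h ^ i' * u ^ j'))"
    by (rule sum.cong[OF refl]) (simp add: zm_hom if_distrib[of zm] if_distrib[of "\<lambda>a. a * _"] cong: if_cong)
  finally show ?thesis unfolding hu_span_def
    by (intro CollectI exI[of _ "\<lambda>i' j'. if i' = ?a then if j' = ?b then ?w else 0 else 0"])
qed

lemma hu_span_sum: "finite F \<Longrightarrow> (\<And>i. i \<in> F \<Longrightarrow> f i \<in> hu_span u) \<Longrightarrow> sum f F \<in> hu_span u"
proof (induction F rule: finite_induct)
  case empty
  show ?case unfolding hu_span_def by (auto simp: zm_hom intro!: exI[of _ "\<lambda>_ _. 0"])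
qed (auto intro: hu_span_add)

lemma hu_span_mult:
  assumes u: "u \<in> B" and un: "u ^ n = zm \<tau>" and hu: "h * u = op_c \<theta> * (u * h)" and \<theta>: "\<theta> \<noteq> 0"
    and ab: "a \<in> hu_span u" "b \<in> hu_span u"
  shows "a * b \<in> hu_span u"
proof -
  obtain z w where a: "a = (\<Sum>i<n. \<Sum>j<n. zm (z i j) * (h ^ i * u ^ j))"
    and b: "b = (\<Sum>k<n. \<Sum>l<n. zm (w k l) * (h ^ k * u ^ l))"
    using ab unfolding hu_span_def by blast
  have uh: "u * h = op_c (inverse \<theta>) * (h * u)" unfolding hu by (rule op_c_cancel[OF \<theta>, symmetric])
  have ujh: "h * u ^ j = op_c (\<theta> ^ j) * (u ^ j * h)" for j by (rule eig_power[OF u hu])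
  have ujh': "u ^ j * h = op_c (inverse (\<theta> ^ j)) * (h * u ^ j)" for j
    unfolding ujh using \<theta> by (intro op_c_cancel[symmetric]) simp
  have ujhk: "u ^ j * h ^ k = op_c (inverse (\<theta> ^ j) ^ k) * (h ^ k * u ^ j)" for j k
    by (rule eig_power[OF h_in ujh'])
  have "zm (z i j) * (h ^ i * u ^ j) * (zm (w k l) * (h ^ k * u ^ l)) \<in> hu_span u" for i j k l
  proof -
    have "zm (z i j) * (h ^ i * u ^ j) * (zm (w k l) * (h ^ k * u ^ l)) =
      zm (z i j) * (zm (w k l) * (h ^ i * ((u ^ j * h ^ k) * u ^ l)))"
      by (simp only: mult.assoc zm_left[OF qw_power[OF u]] zm_left[OF qw_power[OF h_in]])
    also have "\<dots> = zm (z i j * (w k l * [:[:inverse (\<theta> ^ j) ^ k:]:])) * (h ^ (i + k) * u ^ (j + l))"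
      unfolding ujhk by (simp only: mult.assoc const_comm2[OF qw_power[OF h_in]] zm_hom(2) zm_simps power_add)
    finally show ?thesis using hu_span_term[OF u un] by simp
  qed
  moreover have "a * b = (\<Sum>k<n. \<Sum>l<n. \<Sum>i<n. \<Sum>j<n. zm (z i j) * (h ^ i * u ^ j) * (zm (w k l) * (h ^ k * u ^ l)))"
    unfolding a b sum_distrib_left sum_distrib_right ..
  ultimately show ?thesis by (auto intro!: hu_span_sum)
qed

text \<open>
  Inverting \<open>u ^ n\<close> turns the ring into the span of the \<open>h ^ i * u ^ j\<close> over the centre, on
  which conjugation by \<open>h\<close> and \<open>u\<close> is diagonal; an ideal is then determined by its centre part.
\<close>

lemma ideal_le_ext:
  assumes u: "u \<in> B" and gens: "(u = x \<and> w = y) \<or> (u = y \<and> w = x)"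
    and un: "u ^ n = zm \<tau>" and hu: "h * u = op_c \<theta> * (u * h)"
    and \<theta>: "\<theta> ^ n = 1" "\<And>k. 0 < k \<Longrightarrow> k < n \<Longrightarrow> \<theta> ^ k \<noteq> 1"
    and wt: "zm \<tau> * w = (op_c a * h + op_c b) * u ^ (n - 1)"
    and I: "tideal B I" and p: "cprime p" "con I \<subseteq> p" "\<tau> \<notin> p" "sS \<notin> p"
  shows "I \<subseteq> ext p"
proof
  fix e assume eI: "e \<in> I"
  have \<theta>0: "\<theta> \<noteq> 0" using \<theta>(1) n_pos by (auto simp: power_0_left)
  have w: "w \<in> B" using gens qw.x qw.y by auto
  note D = hu_span_term[OF u un]
  have Dc: "op_c c * (h ^ i * u ^ j) \<in> hu_span u" for c i j using D[of "[:[:c:]:]"] by (simp add: zm_simps)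
  have Du: "u \<in> hu_span u" using Dc[of 1 0 1] by (simp add: op_c_hom)
  have Dw: "zm \<tau> * w \<in> hu_span u"
    using hu_span_add[OF Dc[of a 1 "n - 1"] Dc[of b 0 "n - 1"]] by (simp add: wt distrib_right mult.assoc)
  \<comment> \<open>The generator \<open>w\<close> need not lie in the span, but
    \<open>zm \<tau> * w\<close> does. Since \<tau> is central, the elements brought into the span
    by a power of \<tau> are closed under sums and products.\<close>
  have "\<exists>N. zm (\<tau> ^ N) * d \<in> hu_span u" if "d \<in> B" for d
    using that
  proof (induction)
    case (const c)
    show ?case using Dc[of c 0 0] by (intro exI[of _ 0]) (simp add: zm_hom)
  next
    case x
    show ?case using gens Du Dw by (elim disjE) (auto intro: exI[of _ 0] exI[of _ 1] simp: zm_hom)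
  next
    case y
    show ?case using gens Du Dw by (elim disjE) (auto intro: exI[of _ 0] exI[of _ 1] simp: zm_hom)
  next
    case (add d d')
    then obtain N M where N: "zm (\<tau> ^ N) * d \<in> hu_span u" and M: "zm (\<tau> ^ M) * d' \<in> hu_span u" by blast
    have tau: "zm (\<tau> ^ k) \<in> hu_span u" for k using D[of "\<tau> ^ k" 0 0] by simp
    have "zm (\<tau> ^ (N + M)) * (d + d') = zm (\<tau> ^ M) * (zm (\<tau> ^ N) * d) + zm (\<tau> ^ N) * (zm (\<tau> ^ M) * d')"
      by (simp add: power_add zm_hom distrib_left mult.assoc zm_left[OF zm_in])
    also have "\<dots> \<in> hu_span u" using N M tau hu_span_mult[OF u un hu \<theta>0] by (intro hu_span_add) auto
    finally show ?case by blast
  next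
    case (mult d d')
    then obtain N M where N: "zm (\<tau> ^ N) * d \<in> hu_span u" and M: "zm (\<tau> ^ M) * d' \<in> hu_span u" by blast
    have "zm (\<tau> ^ (N + M)) * (d * d') = (zm (\<tau> ^ N) * d) * (zm (\<tau> ^ M) * d')"
      by (simp only: power_add zm_hom(2) mult.assoc zm_left[OF mult.hyps(1)])
    then show ?case using hu_span_mult[OF u un hu \<theta>0 N M] by (intro exI[of _ "N + M"]) simp
  qed
  moreover have eB: "e \<in> B" using eI tidealD(1)[OF I] by blast
  ultimately obtain N z where z: "zm (\<tau> ^ N) * e = (\<Sum>i<n. \<Sum>j<n. zm (z i j) * (h ^ i * u ^ j))"
    unfolding hu_span_def by blast
  have zI: "(\<Sum>j<n. \<Sum>i<n. zm (z i j) * (h ^ i * u ^ j)) \<in> I"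
    using tidealD(5)[OF I eI zm_in, of "\<tau> ^ N"] unfolding z by (subst sum.swap)
  have inB: "zm (z i j) * (h ^ i * u ^ j) \<in> B" for i j by (intro B_intros zm_in u)
  have zp: "z i j \<in> p" if ij: "i < n" "j < n" for i j
  proof -
    have huj: "h * u ^ j = op_c (\<theta> ^ j) * (u ^ j * h)" for j by (rule eig_power[OF u hu])
    \<comment> \<open>Commuting with h scales a term by \<theta>^j, so averaging over powers of h
      separates the exponents j of u.\<close>
    have 1: "(\<Sum>i<n. zm (z i j) * (h ^ i * u ^ j)) * h ^ n \<in> I"
    proof (rule eigencomponent[OF I h_in _ \<theta> _ zI ij(2)])
      show "(\<Sum>i<n. zm (z i j) * (h ^ i * u ^ j)) \<in> B" for j by (intro qw_sum inB)
      have "h * (zm (z i j) * (h ^ i * u ^ j)) = op_c (\<theta> ^ j) * ((zm (z i j) * (h ^ i * u ^ j)) * h)" for i j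
      proof -
        have "h * (zm (z i j) * (h ^ i * u ^ j)) = zm (z i j) * (h * (h ^ i * u ^ j))"
          by (rule zm_left[OF h_in])
        also have "h * (h ^ i * u ^ j) = h ^ i * (h * u ^ j)"
          by (simp only: mult.assoc[symmetric] power_commutes)
        finally show ?thesis unfolding huj
          by (simp only: const_comm2[OF qw_power[OF h_in]] const_comm2[OF zm_in] mult.assoc)
      qed
      then show "h * (\<Sum>i<n. zm (z i j) * (h ^ i * u ^ j)) = op_c (\<theta> ^ j) * ((\<Sum>i<n. zm (z i j) * (h ^ i * u ^ j)) * h)" for j
        by (simp only: sum_distrib_left sum_distrib_right)
    qed
    have step1: "(\<Sum>i<n. zm (z i j) * (h ^ i * u ^ j) * h ^ n) \<in> I" using 1 by (simp only: sum_distrib_right)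
    have uh: "u * h = op_c (inverse \<theta>) * (h * u)" unfolding hu by (rule op_c_cancel[OF \<theta>0, symmetric])
    have uhi: "u * h ^ i = op_c (inverse \<theta> ^ i) * (h ^ i * u)" for i by (rule eig_power[OF h_in uh])
    \<comment> \<open>Commuting with u scales what remains by \<theta>^(-i), so a second average
      isolates a single monomial.\<close>
    have 2: "zm (z i j) * (h ^ i * u ^ j) * h ^ n * u ^ n \<in> I"
    proof (rule eigencomponent[OF I u _ _ _ _ step1 ij(1)])
      show "zm (z i j) * (h ^ i * u ^ j) * h ^ n \<in> B" for i by (intro qw.mult[OF inB] qw_power h_in)
      show "inverse \<theta> ^ n = 1" using \<theta>(1) by (simp add: power_inverse)
      show "inverse \<theta> ^ k \<noteq> 1" if "0 < k" "k < n" for k using \<theta>(2)[OF that] by (simp add: power_inverse)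
      fix i
      have "u * (zm (z i j) * (h ^ i * u ^ j) * h ^ n) = zm (z i j) * ((u * h ^ i) * (u ^ j * h ^ n))"
        by (simp only: mult.assoc zm_left[OF u])
      also have "\<dots> = op_c (inverse \<theta> ^ i) * (zm (z i j) * (h ^ i * (u * (u ^ j * h ^ n))))"
        unfolding uhi by (simp only: mult.assoc const_comm2[OF zm_in])
      also have "u * (u ^ j * h ^ n) = u ^ j * (h ^ n * u)"
        unfolding hn_central[OF u, symmetric] by (simp only: mult.assoc[symmetric] power_commutes)
      finally show "u * (zm (z i j) * (h ^ i * u ^ j) * h ^ n) = op_c (inverse \<theta> ^ i) * (zm (z i j) * (h ^ i * u ^ j) * h ^ n * u)"
        by (simp only: mult.assoc)
    qed
    \<comment> \<open>Completing h^i and u^j to n-th powers makes the monomial central. With one h^n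
      and one u^n from the averages this puts z s^2 \<tau>^2 into the centre part of I.\<close>
    have "h ^ (n - i) * (zm (z i j) * (h ^ i * u ^ j) * h ^ n * u ^ n) * u ^ (n - j) \<in> I"
      by (rule tidealD(4)[OF I tidealD(5)[OF I 2]]) (intro qw_power u h_in)+
    also have "h ^ (n - i) * (zm (z i j) * (h ^ i * u ^ j) * h ^ n * u ^ n) * u ^ (n - j) =
      zm (z i j) * (h ^ (n - i) * h ^ i * (u ^ j * (zm sS * (zm \<tau> * u ^ (n - j)))))"
      unfolding zm_sS[symmetric] un by (simp only: mult.assoc zm_left[OF qw_power[OF h_in]])
    also have "h ^ (n - i) * h ^ i = zm sS" using ij(1) by (simp add: power_add[symmetric] zm_sS)
    also have "u ^ j * (zm sS * (zm \<tau> * u ^ (n - j))) = zm sS * (zm \<tau> * (u ^ j * u ^ (n - j)))"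
      by (simp only: zm_left[OF qw_power[OF u]])
    also have "u ^ j * u ^ (n - j) = zm \<tau>" using ij(2) un by (simp flip: power_add)
    finally have "z i j * (sS * (sS * (\<tau> * \<tau>))) \<in> con I" by (simp add: con_def zm_hom)
    then have "z i j * (sS * (sS * (\<tau> * \<tau>))) \<in> p" using p(2) by blast
    then show ?thesis using p(3,4) cprimeD(3)[OF p(1)] by blast
  qed
  have tp: "tideal UNIV p" using p(1) by (rule cprimeD)
  have "zm (\<tau> ^ N) * e \<in> ext p" unfolding z
    using zp by (intro ext_sum[OF tp] zm_mult_ext[OF tp] B_intros u) auto
  then show "e \<in> ext p" using ext_torsion_free[OF p(1) _ eB] cprime_power[OF p(1)] p(3) by blast
qed

text \<open>The invertible generator u is x or y, according to which of t and r avoids p. The other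
  generator becomes a combination of h and u, from x^n y = (yx) x^(n-1) or y^n x = (xy)
  y^(n-1).\<close>

lemma ideal_le_ext_if_con_le:
  assumes I: "tideal B I" and p: "cprime p" "con I \<subseteq> p" "XX \<notin> p \<or> YY \<notin> p" "sS \<notin> p"
  shows "I \<subseteq> ext p"
proof (cases "XX \<notin> p")
  have ne: "inverse q ^ k \<noteq> 1" if "0 < k" "k < n" for k using q_power_ne[OF that] by (simp add: power_inverse)
  case True
  show ?thesis
  proof (rule ideal_le_ext[OF qw.x, of y XX "inverse q" 1 "- c0" I p])
    have "zm XX * y = y * x * x ^ (n - 1)"
      using n_pos by (simp add: zm_simps xn_y mult.assoc power_Suc[symmetric] del: power_Suc)
    then show "zm XX * y = (op_c 1 * h + op_c (- c0)) * x ^ (n - 1)" unfolding yx by (simp add: op_c_hom)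
  qed (use ne hx True I p in \<open>auto simp: zm_simps power_inverse qn\<close>)
next
  case False
  show ?thesis
  proof (rule ideal_le_ext[OF qw.y, of x YY q q "- c0" I p])
    have "zm YY * x = x * y * y ^ (n - 1)"
      using n_pos by (simp add: zm_simps yn_x[symmetric] mult.assoc power_Suc[symmetric] del: power_Suc)
    then show "zm YY * x = (op_c q * h + op_c (- c0)) * y ^ (n - 1)" unfolding xy by (simp add: op_c_hom)
  qed (use q_power_ne hy False I p in \<open>auto simp: zm_simps qn\<close>)
qed

end

section \<open>The ideals generated by t, r and by h\<close>

context root_of_unity
begin

text \<open>For b outside the extension, torsion-freeness puts the centre part of the colon ideal of
  b into p; the comparison of ideals then puts the whole colon ideal into the extension.\<close>

lemma tprime_ext:
  assumes p: "cprime p" "sS \<notin> p" "XX \<notin> p \<or> YY \<notin> p"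
  shows "tprime B (ext p)"
proof -
  have tp: "tideal UNIV p" using p(1) by (rule cprimeD)
  note te = tideal_ext[OF tp]
  have "1 \<notin> ext p" using con_ext[OF tp] cprimeD(2)[OF p(1)] zm_hom(3) by (auto simp: con_def)
  moreover have "a \<in> ext p \<or> b \<in> ext p" if ab: "a \<in> B" "b \<in> B" "\<forall>c\<in>B. a * c * b \<in> ext p" for a b
  proof (rule disjCI)
    assume b: "b \<notin> ext p"
    let ?I = "{a \<in> B. \<forall>c\<in>B. a * c * b \<in> ext p}"
    have "con ?I \<subseteq> p"
    proof
      fix z assume "z \<in> con ?I"
      then have "zm z * 1 * b \<in> ext p" using qwD(1) unfolding con_def by blast
      then show "z \<in> p" using ext_torsion_free[OF p(1) _ ab(2)] b by auto
    qed
    then have "?I \<subseteq> ext p"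
      using ideal_le_ext_if_con_le[OF tideal_left_colon[OF tsubring_qw te ab(2)] p(1) _ p(3,2)] by simp
    then show "a \<in> ext p" using ab by blast
  qed
  ultimately show ?thesis using te by (auto simp: tprime_def)
qed

lemma tprime_eq_ext:
  assumes P: "tprime B P" and "sS \<notin> con P" "XX \<notin> con P \<or> YY \<notin> con P"
  shows "P = ext (con P)"
proof
  show "P \<subseteq> ext (con P)"
    using ideal_le_ext_if_con_le[OF tprimeD(1)[OF P] cprime_con[OF P]] assms by simp
  show "ext (con P) \<subseteq> P" by (rule ext_least[OF tprimeD(1)[OF P]]) simp
qed

section \<open>The maximal ideal generated by t and r\<close>

definition mm :: "'k poly poly set" where "mm = tgen UNIV {YY, XX}"

lemma mem_mm: "z \<in> mm \<longleftrightarrow> cf z 0 0 = 0"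
  using monom_1_dvd_iff'[of 1 "coeff z 0"] by (simp add: mm_def ret_R.tgen_eq monom_altdef)

lemma cprime_mm: "cprime mm" and cmax_mm: "cmax mm"
  unfolding mm_def by (rule ret_R.cprime_tgen[OF X_Irr_m] ret_R.cmax_tgen[OF X_Irr_m])+

lemma tideal_mm: "tideal UNIV mm"
  by (rule cprimeD(1)[OF cprime_mm])

text \<open>Moving x past y^(m+1) x^(n-1) leaves [m+1] y^m x^(n-1) plus a multiple of x^n; as [m+1]
  is invertible for m + 1 < n, the exponent of y descends to 0. Commuting the powers of x obtained
  with y then lowers the exponent of x.\<close>

lemma corner_imp_one:
  assumes I: "tideal B I" and t: "x ^ n \<in> I" and r: "y ^ n \<in> I" and e: "y ^ (n - 1) * x ^ (n - 1) \<in> I"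
  shows "1 \<in> I"
proof -
  have scal: "b \<in> I" if "op_c a * b \<in> I" "a \<noteq> 0" for a b
    using tidealD(5)[OF I that(1) qw.const, of "inverse a"] by (simp add: op_c_cancel[OF that(2)])
  have 1: "y ^ m * x ^ (n - 1) \<in> I" if "m \<le> n - 1" for m
    using that
  proof (induction m rule: inc_induct)
    case (step m)
    have "y ^ Suc m * x ^ n \<in> I" by (intro tidealD(5)[OF I t] qw_power qw.y)
    moreover have "y ^ Suc m * x ^ n = y ^ Suc m * x * x ^ (n - 1)"
      using n_pos by (simp add: mult.assoc power_Suc[symmetric] del: power_Suc)
    ultimately have c: "y ^ Suc m * x * x ^ (n - 1) \<in> I" by simp
    have "x * (y ^ Suc m * x ^ (n - 1)) \<in> I" by (intro tidealD(5)[OF I step.IH] qw.x)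
    moreover have "x * (y ^ Suc m * x ^ (n - 1)) =
       op_c (q ^ Suc m) * (y ^ Suc m * x * x ^ (n - 1)) + op_c (qint q (Suc m)) * (y ^ m * x ^ (n - 1))"
      using x_ypow[of "Suc m"] by (simp only: mult.assoc[symmetric] distrib_right) simp
    moreover have "op_c (q ^ Suc m) * (y ^ Suc m * x * x ^ (n - 1)) \<in> I" by (intro tidealD(5)[OF I c] qw.const)
    ultimately have "op_c (qint q (Suc m)) * (y ^ m * x ^ (n - 1)) \<in> I"
      using tideal_diff[OF tsubring_qw I] by (metis add_diff_cancel_left')
    then show ?case using scal qint_ne_0[of "Suc m"] step.hyps by auto
  qed (rule e)
  have 2: "x ^ m \<in> I" if "m \<le> n - 1" for m
    using that
  proof (induction m rule: inc_induct)
    case base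
    show ?case using 1[of 0] by simp
  next
    case (step m)
    have "x ^ Suc m * y \<in> I" by (intro tidealD(4)[OF I step.IH] qw.y)
    moreover have "op_c (q ^ Suc m) * (y * x ^ Suc m) \<in> I" by (intro tidealD(5)[OF I] step.IH qw.y qw.const)
    ultimately have "op_c (qint q (Suc m)) * x ^ m \<in> I"
      using tideal_diff[OF tsubring_qw I] xpow_y[of "Suc m"] by (metis add_diff_cancel_left' diff_Suc_1)
    then show ?case using scal qint_ne_0[of "Suc m"] step.hyps by auto
  qed
  show ?thesis using 2[of 0] by simp
qed

text \<open>Modulo t and r the coordinates of b are scalars, not all zero. Multiplying by powers of
  y on the left and x on the right leaves only the lowest monomial, moved to the corner y^(n-1)
  x^(n-1).\<close>

lemma ext_mm_maximal:
  assumes I: "tideal B I" and tr: "XX \<in> con I" "YY \<in> con I" and b: "b \<in> I" "b \<notin> ext mm"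
  shows "1 \<in> I"
proof -
  have mmI: "mm \<subseteq> con I" unfolding mm_def using tr by (intro tgen_least[OF tideal_con[OF I]]) auto
  have tI: "x ^ n \<in> I" and rI: "y ^ n \<in> I" using tr by (simp_all only: con_def zm_simps mem_Collect_eq)
  have bB: "b \<in> B" using b(1) tidealD(1)[OF I] by blast
  define z where "z i j = comp i j (app b 1)" for i j
  define c where "c i j = cf (z i j) 0 0" for i j
  have e: "b = (\<Sum>i<n. \<Sum>j<n. zm (z i j) * (y ^ i * x ^ j))" unfolding z_def by (rule expansion[OF bB])
  have d: "zm (z i j) - op_c (c i j) \<in> I" for i j
  proof -
    have "z i j - [:[:c i j:]:] \<in> mm" by (simp add: mem_mm c_def)
    then have "zm (z i j - [:[:c i j:]:]) \<in> I" using mmI by (auto simp: con_def)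
    then show ?thesis by (simp only: zm_hom zm_simps)
  qed
  have "(\<Sum>i<n. \<Sum>j<n. (zm (z i j) - op_c (c i j)) * (y ^ i * x ^ j)) \<in> I"
    by (intro tideal_sum[OF I] tidealD(4)[OF I d] B_intros)
  then have "b - (\<Sum>i<n. \<Sum>j<n. (zm (z i j) - op_c (c i j)) * (y ^ i * x ^ j)) \<in> I"
    by (rule tideal_diff[OF tsubring_qw I b(1)])
  also have "b - (\<Sum>i<n. \<Sum>j<n. (zm (z i j) - op_c (c i j)) * (y ^ i * x ^ j)) =
      (\<Sum>i<n. \<Sum>j<n. op_c (c i j) * (y ^ i * x ^ j))"
    by (subst e) (simp add: sum_subtractf left_diff_distrib)
  finally have cI: "(\<Sum>i<n. \<Sum>j<n. op_c (c i j) * (y ^ i * x ^ j)) \<in> I" .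
  obtain i1 j1 where "i1 < n" "j1 < n" "c i1 j1 \<noteq> 0"
    using b(2) bB by (auto simp: ext_def mem_mm c_def z_def)
  then have "\<exists>j. j < n \<and> (\<exists>i<n. c i j \<noteq> 0)" by blast
  \<comment> \<open>The monomial is minimal first in the exponent of x and then, within that
    exponent, in that of y.\<close>
  then obtain j0 where j0: "j0 < n" "\<exists>i<n. c i j0 \<noteq> 0" and minj: "\<And>j i. j < j0 \<Longrightarrow> i < n \<Longrightarrow> c i j = 0"
    using exists_least_iff[of "\<lambda>j. j < n \<and> (\<exists>i<n. c i j \<noteq> 0)"] by (metis less_trans)
  have "\<exists>i. i < n \<and> c i j0 \<noteq> 0" using j0(2) by blast
  then obtain i0 where i0: "i0 < n" "c i0 j0 \<noteq> 0" and mini: "\<And>i. i < i0 \<Longrightarrow> c i j0 = 0"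
    using exists_least_iff[of "\<lambda>i. i < n \<and> c i j0 \<noteq> 0"] by (metis less_trans)
  \<comment> \<open>These shifts send (i0, j0) to (n-1, n-1). Every other monomial with a nonzero
    coefficient has an exponent that reaches n and so falls into I.\<close>
  let ?Y = "n - 1 - i0" and ?X = "n - 1 - j0"
  let ?T = "\<lambda>i j. op_c (c i j) * (y ^ (?Y + i) * x ^ (j + ?X))"
  have yI: "y ^ k \<in> I" if "k \<ge> n" for k
    using tidealD(4)[OF I rI qw_power[OF qw.y], of "k - n"] that by (simp flip: power_add)
  have xI: "x ^ k \<in> I" if "k \<ge> n" for k
    using tidealD(4)[OF I tI qw_power[OF qw.x], of "k - n"] that by (simp flip: power_add)
  have "y ^ ?Y * (\<Sum>i<n. \<Sum>j<n. op_c (c i j) * (y ^ i * x ^ j)) * x ^ ?X \<in> I"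
    by (intro tidealD(4)[OF I tidealD(5)[OF I cI]] qw_power qw.x qw.y)
  also have "y ^ ?Y * (\<Sum>i<n. \<Sum>j<n. op_c (c i j) * (y ^ i * x ^ j)) * x ^ ?X = (\<Sum>i<n. \<Sum>j<n. ?T i j)"
    by (simp only: sum_distrib_left sum_distrib_right const_comm2[OF qw_power[OF qw.y]] mult.assoc power_add)
  also have "(\<Sum>i<n. \<Sum>j<n. ?T i j) = (\<Sum>(i,j)\<in>{..<n} \<times> {..<n}. ?T i j)" by (rule sum.cartesian_product)
  also have "\<dots> = ?T i0 j0 + (\<Sum>(i,j)\<in>{..<n} \<times> {..<n} - {(i0, j0)}. ?T i j)"
    using i0 j0 by (subst sum.remove[of _ "(i0, j0)"]) auto
  finally have sI: "?T i0 j0 + (\<Sum>(i,j)\<in>{..<n} \<times> {..<n} - {(i0, j0)}. ?T i j) \<in> I" .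
  have "?T i j \<in> I" if ij: "i < n" "j < n" "(i, j) \<noteq> (i0, j0)" for i j
  proof -
    consider "j < j0" | "j > j0" | "j = j0" "i < i0" | "j = j0" "i > i0" using ij(3) by (cases j j0 rule: linorder_cases; cases i i0 rule: linorder_cases) auto
    then show ?thesis
    proof cases
      case 1
      then show ?thesis using minj ij tidealD(2)[OF I] by (simp add: op_c_hom)
    next
      case 2
      then have "x ^ (j + ?X) \<in> I" using j0 by (intro xI) simp
      then show ?thesis by (intro tidealD(5)[OF I] qw.const qw_power qw.y)
    next
      case 3
      then show ?thesis using mini tidealD(2)[OF I] by (simp add: op_c_hom)
    next
      case 4
      then have "y ^ (?Y + i) \<in> I" using i0 by (intro yI) simp
      then have "y ^ (?Y + i) * x ^ (j + ?X) \<in> I" by (rule tidealD(4)[OF I]) (intro qw_power qw.x)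
      then show ?thesis by (rule tidealD(5)[OF I]) (rule qw.const)
    qed
  qed
  then have "(\<Sum>(i,j)\<in>{..<n} \<times> {..<n} - {(i0, j0)}. ?T i j) \<in> I" by (intro tideal_sum[OF I]) auto
  from tideal_diff[OF tsubring_qw I sI this] have "?T i0 j0 \<in> I" by (simp only: add_diff_cancel_right')
  then have "op_c (inverse (c i0 j0)) * ?T i0 j0 \<in> I" by (rule tidealD(5)[OF I]) (rule qw.const)
  then have "y ^ (n - 1) * x ^ (n - 1) \<in> I" using i0 j0 by (simp add: op_c_cancel[OF i0(2)])
  then show ?thesis by (rule corner_imp_one[OF I tI rI])
qed

text \<open>If a and b lay outside although a B b lies inside, the colon ideal of b would contain t,
  r and a; maximality puts 1, and then b, into the ideal.\<close>

lemma tprime_ext_mm: "tprime B (ext mm)"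
proof -
  note te = tideal_ext[OF tideal_mm]
  have "1 \<notin> ext mm" using con_ext[OF tideal_mm] cprimeD(2)[OF cprime_mm] zm_hom(3) by (auto simp: con_def)
  moreover have "a \<in> ext mm \<or> b \<in> ext mm" if ab: "a \<in> B" "b \<in> B" "\<forall>c\<in>B. a * c * b \<in> ext mm" for a b
  proof (rule disjCI, rule ccontr)
    assume b: "b \<notin> ext mm" and a: "a \<notin> ext mm"
    let ?I = "{a \<in> B. \<forall>c\<in>B. a * c * b \<in> ext mm}"
    have I: "tideal B ?I" by (rule tideal_left_colon[OF tsubring_qw te ab(2)])
    have sub: "ext mm \<subseteq> ?I" using tidealD(1,4)[OF te] ab(2) by auto
    have "mm \<subseteq> con ?I" using con_mono[OF sub] con_ext[OF tideal_mm] by simp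
    then have "XX \<in> con ?I" "YY \<in> con ?I" by (auto simp: mem_mm)
    then have "1 \<in> ?I" using ext_mm_maximal[OF I _ _ _ a] ab by simp
    then have "1 * 1 * b \<in> ext mm" using qwD(1) by blast
    then show False using b by simp
  qed
  ultimately show ?thesis using te by (auto simp: tprime_def)
qed

lemma tprime_eq_ext_mm:
  assumes P: "tprime B P" and tr: "XX \<in> con P" "YY \<in> con P"
  shows "P = ext mm"
proof
  show "P \<subseteq> ext mm" using ext_mm_maximal[OF tprimeD(1)[OF P] tr] tprimeD(2)[OF P] by blast
  show "ext mm \<subseteq> P"
    unfolding mm_def using tr
    by (intro ext_least[OF tprimeD(1)[OF P]] tgen_least[OF tideal_con[OF tprimeD(1)[OF P]]]) auto
qed

section \<open>The ideal generated by h and the primes above it\<close>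

definition hB :: "'k poly poly endo set" where "hB = {h * b | b. b \<in> B}"

lemma h_normal: "b \<in> B \<Longrightarrow> \<exists>b'\<in>B. b * h = h * b'"
proof (induction rule: qw.induct)
  case (const c)
  show ?case using const_comm[OF h_in, of c] qw.const by (metis)
next
  case x
  show ?case using xh const_comm2[OF h_in, of q x] by (intro bexI[of _ "op_c q * x"]) (simp_all add: B_intros)
next
  case y
  show ?case using yh const_comm2[OF h_in, of "inverse q" y]
    by (intro bexI[of _ "op_c (inverse q) * y"]) (simp_all add: B_intros)
next
  case (add a b)
  then obtain a' b' where "a' \<in> B" "b' \<in> B" "a * h = h * a'" "b * h = h * b'" by blast
  then show ?case by (intro bexI[of _ "a' + b'"]) (simp_all add: B_intros algebra_simps)
next
  case (mult a b)
  then obtain a' b' where *: "a' \<in> B" "b' \<in> B" "a * h = h * a'" "b * h = h * b'" by blast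
  then have "a * b * h = h * (a' * b')" by (simp add: mult.assoc) (simp add: mult.assoc[symmetric])
  then show ?case using * by (intro bexI[of _ "a' * b'"]) (simp_all add: B_intros)
qed

lemma tideal_hB: "tideal B hB"
  unfolding tideal_def
proof (intro conjI ballI)
  show "hB \<subseteq> B" by (auto simp: hB_def intro: qw.mult h_in)
  show "0 \<in> hB" using qwD(3) by (auto simp: hB_def intro!: exI[of _ 0])
next
  fix a b assume "a \<in> hB" "b \<in> hB"
  then obtain a' b' where "a = h * a'" "b = h * b'" "a' \<in> B" "b' \<in> B" by (auto simp: hB_def)
  then show "a + b \<in> hB" unfolding hB_def by (intro CollectI exI[of _ "a' + b'"]) (simp add: qw.add distrib_left)
next
  fix a b assume "a \<in> hB" and b: "b \<in> B"
  then obtain a' where a': "a = h * a'" "a' \<in> B" by (auto simp: hB_def)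
  then show "a * b \<in> hB" unfolding hB_def using b by (intro CollectI exI[of _ "a' * b"]) (simp add: qw.mult mult.assoc)
  obtain b' where b': "b' \<in> B" "b * h = h * b'" using h_normal[OF b] by blast
  then have "b * a = h * (b' * a')" using a' by (simp add: mult.assoc[symmetric])
  then show "b * a \<in> hB" unfolding hB_def using a' b' by (intro CollectI exI[of _ "b' * a'"]) (simp add: qw.mult)
qed

lemma h_in_hB: "h \<in> hB"
  unfolding hB_def using qwD(1) by (intro CollectI exI[of _ 1]) simp

lemma hB_least: "tideal B I \<Longrightarrow> h \<in> I \<Longrightarrow> hB \<subseteq> I"
  by (auto simp: hB_def intro: tidealD(4))

lemma tgen_h: "tgen B {h} = hB"
  by (rule tgen_eqI) (auto simp: tideal_hB h_in_hB dest: hB_least)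

lemma hB_cong: "a - b \<in> hB \<Longrightarrow> c \<in> B \<Longrightarrow> c * a - c * b \<in> hB" "a - b \<in> hB \<Longrightarrow> c \<in> B \<Longrightarrow> a * c - b * c \<in> hB"
  using tidealD(4,5)[OF tideal_hB, of "a - b" c] by (simp_all add: algebra_simps)

lemma hB_trans: "a - b \<in> hB \<Longrightarrow> b - c \<in> hB \<Longrightarrow> a - c \<in> hB"
  using tidealD(3)[OF tideal_hB, of "a - b" "b - c"] by simp

lemma hB_sym: "a - b \<in> hB \<Longrightarrow> b - a \<in> hB"
  using tideal_minus[OF tsubring_qw tideal_hB, of "a - b"] by simp

text \<open>Modulo \<open>h\<close> the ring is the commutative ring of Laurent polynomials in \<open>x\<close>.\<close>

lemma hB_commute:
  assumes "a \<in> B" "b \<in> B"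
  shows "a * b - b * a \<in> hB"
proof -
  have z: "0 \<in> hB" using tidealD(2)[OF tideal_hB] .
  \<comment> \<open>The elements commuting with a modulo h are closed under sums and products, so it
    is enough to test x and y. This is used once for each argument of the commutator.\<close>
  have der: "a * b - b * a \<in> hB" if a: "a \<in> B" and ax: "a * x - x * a \<in> hB" and ay: "a * y - y * a \<in> hB" and b: "b \<in> B" for a b
    using b
  proof (induction)
    case (const c)
    show ?case using const_comm[OF a] z by simp
  next
    case (add b b')
    have "a * (b + b') - (b + b') * a = (a * b - b * a) + (a * b' - b' * a)" by (simp add: algebra_simps)
    then show ?case using tidealD(3)[OF tideal_hB] add by simp
  next
    case (mult b b')
    have "a * (b * b') - (b * b') * a = (a * b - b * a) * b' + b * (a * b' - b' * a)" by (simp add: algebra_simps)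
    then show ?case using tidealD(3,4,5)[OF tideal_hB] mult by simp
  qed (fact ax ay)+
  have xy': "x * y - y * x \<in> hB"
  proof -
    have "x * y - y * x = op_c q * h - h" by (simp add: xy yx)
    also have "\<dots> \<in> hB" using h_in_hB by (intro tideal_diff[OF tsubring_qw tideal_hB] tidealD(5)[OF tideal_hB] qw.const)
    finally show ?thesis .
  qed
  have x: "x * b - b * x \<in> hB" if "b \<in> B" for b by (rule der[OF qw.x _ xy' that]) (simp add: z)
  have y: "y * b - b * y \<in> hB" if "b \<in> B" for b
    by (rule der[OF qw.y hB_sym[OF xy'] _ that]) (simp add: z)
  show ?thesis using der[OF assms(1) hB_sym[OF x] hB_sym[OF y] assms(2)] assms(1) by simp
qed

text \<open>Modulo h the product yx is the nonzero scalar -c0, so x can be cancelled.\<close>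

lemma x_cancel:
  assumes P: "tideal B P" "h \<in> P" and a: "a \<in> B" "x ^ N * a \<in> P"
  shows "a \<in> P"
  using a
proof (induction N arbitrary: a)
  case (Suc N)
  have "x ^ N * (x * a) \<in> P" using Suc.prems(2) by (simp add: power_Suc2 mult.assoc del: power_Suc)
  then have xa: "x * a \<in> P" using Suc.IH[of "x * a"] Suc.prems(1) qw.mult qw.x by blast
  have "h * a - y * (x * a) \<in> P"
    by (intro tideal_diff[OF tsubring_qw P(1)] tidealD(4)[OF P] tidealD(5)[OF P(1) xa] qw.y Suc.prems)
  also have "h * a - y * (x * a) = op_c c0 * a" by (simp add: h_def distrib_right mult.assoc)
  finally have "op_c (inverse c0) * (op_c c0 * a) \<in> P" by (rule tidealD(5)[OF P(1)]) (rule qw.const)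
  then show ?case by (simp only: op_c_cancel[OF c0_ne_0])
qed simp

lemma peval_X_power: "peval x (monom 1 N) = x ^ N"
  by (simp add: peval_monom[OF qw.x] op_c_hom)

lemma hB_poly_add:
  assumes "x ^ N * a - peval x f \<in> hB" "x ^ M * b - peval x g \<in> hB"
  shows "x ^ (N + M) * (a + b) - peval x (monom 1 M * f + monom 1 N * g) \<in> hB"
proof -
  have "x ^ (N + M) = x ^ M * x ^ N" by (simp add: power_add[symmetric] add.commute)
  moreover have "x ^ (N + M) = x ^ N * x ^ M" by (rule power_add)
  ultimately have "x ^ (N + M) * (a + b) = x ^ M * x ^ N * a + x ^ N * x ^ M * b"
    by (metis distrib_left)
  then have "x ^ (N + M) * (a + b) - peval x (monom 1 M * f + monom 1 N * g) =
     x ^ M * (x ^ N * a - peval x f) + x ^ N * (x ^ M * b - peval x g)"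
    by (simp add: peval_add peval_mult[OF qw.x] peval_X_power right_diff_distrib mult.assoc)
  also have "\<dots> \<in> hB" using assms by (intro tidealD(3,5)[OF tideal_hB] qw_power qw.x)
  finally show ?thesis .
qed

lemma hB_poly_mult:
  assumes f: "x ^ N * a - peval x f \<in> hB" and g: "x ^ M * b - peval x g \<in> hB" and ab: "a \<in> B" "b \<in> B"
  shows "x ^ (N + M) * (a * b) - peval x (f * g) \<in> hB"
proof -
  have "x ^ N * (x ^ M * a - a * x ^ M) * b \<in> hB"
    by (intro tidealD(4,5)[OF tideal_hB] hB_commute B_intros ab)
  then have 1: "x ^ (N + M) * (a * b) - (x ^ N * a) * (x ^ M * b) \<in> hB"
    by (simp add: left_diff_distrib right_diff_distrib power_add mult.assoc)
  have 2: "(x ^ N * a) * (x ^ M * b) - peval x f * (x ^ M * b) \<in> hB"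
    by (rule hB_cong(2)[OF f]) (intro B_intros ab)
  have 3: "peval x f * (x ^ M * b) - peval x f * peval x g \<in> hB"
    by (rule hB_cong(1)[OF g]) (intro peval_in qw.x)
  show ?thesis using hB_trans[OF 1 hB_trans[OF 2 3]] by (simp add: peval_mult[OF qw.x])
qed

text \<open>Modulo h, y acts as -c0/x, and a power of x clears the denominators.\<close>

lemma mod_h_poly: "a \<in> B \<Longrightarrow> \<exists>N f. x ^ N * a - peval x f \<in> hB"
proof (induction rule: qw.induct)
  case (const c)
  show ?case using tidealD(2)[OF tideal_hB] by (intro exI[of _ 0] exI[of _ "[:c:]"]) simp
next
  case x
  show ?case using tidealD(2)[OF tideal_hB] by (intro exI[of _ 0] exI[of _ "[:0, 1:]"]) (simp add: op_c_hom)
next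
  case y
  have "x * y - op_c (- c0) = op_c q * h" by (simp add: xy op_c_hom)
  then show ?case using tidealD(5)[OF tideal_hB h_in_hB qw.const]
    by (intro exI[of _ 1] exI[of _ "[:- c0:]"]) simp
next
  case (add a b)
  then show ?case using hB_poly_add by blast
next
  case (mult a b)
  then show ?case using hB_poly_mult by blast
qed

lemma peval_app: "app (peval x f) 1 = [:f:]"
proof -
  have "app (peval x f) 1 = (\<Sum>i\<le>degree f. [:monom (coeff f i) i:])"
    unfolding peval_altdef[OF qw.x] app_endo_sum
  proof (rule sum.cong[OF refl])
    fix i
    have "app (x ^ i) 1 = [:monom 1 i:]" using nf_app[of 0 q i] by (simp add: monom_0)
    then show "app (op_c (coeff f i) * x ^ i) 1 = [:monom (coeff f i) i:]"
      by (simp add: op_c_def smult_monom)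
  qed
  also have "\<dots> = [:\<Sum>i\<le>degree f. monom (coeff f i) i:]"
  proof -
    have "(\<Sum>i\<in>F. [:g i:]) = [:sum g F:]" for g :: "nat \<Rightarrow> 'k poly" and F
      by (induction F rule: infinite_finite_induct) auto
    then show ?thesis .
  qed
  finally show ?thesis by (simp add: poly_as_sum_of_monoms)
qed

text \<open>So K[x] embeds in the quotient by h. Left multiplication by h raises the Y-degree: the
  coefficient of Y^(d+1) X^(j+1) in hv is q^d times that of Y^d X^j in v, whereas f has no Y at
  all.\<close>

lemma peval_in_hB: "peval x f \<in> hB \<Longrightarrow> f = 0"
proof -
  assume "peval x f \<in> hB"
  then obtain b where b: "peval x f = h * b" "b \<in> B" by (auto simp: hB_def)
  define v where "v = app b 1"
  have e: "[:f:] = app y (app x v) + app (op_c c0) v"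
    using arg_cong[OF b(1), of "\<lambda>a. app a 1"] by (simp add: peval_app h_def v_def)
  have "v = 0"
  proof (rule ccontr)
    assume "v \<noteq> 0"
    let ?d = "degree v"
    have "cf v ?d j = 0" for j
    proof -
      have "cf [:f:] (Suc ?d) (Suc j) = q ^ ?d * cf v ?d j"
        unfolding e by (simp add: cf_ops coeff_eq_0 del: coeff_0)
      then show ?thesis using q_ne_0 by simp
    qed
    then have "lead_coeff v = 0" by (simp add: poly_eq_iff)
    then show False using \<open>v \<noteq> 0\<close> by simp
  qed
  then show "f = 0" using e by simp
qed

text \<open>The ideal generated by F in Laurent polynomials in x, pulled back along the quotient by
  h: a power of x clears denominators.\<close>

definition xext :: "'k poly set \<Rightarrow> 'k poly poly endo set" where
  "xext F = {a \<in> B. \<exists>N. \<exists>f\<in>F. x ^ N * a - peval x f \<in> hB}"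

lemma xextI: "a \<in> B \<Longrightarrow> f \<in> F \<Longrightarrow> x ^ N * a - peval x f \<in> hB \<Longrightarrow> a \<in> xext F"
  by (auto simp: xext_def)

lemma tideal_xcon: "tideal B P \<Longrightarrow> tideal UNIV {f. peval x f \<in> P}"
  by (rule tideal_image_ideal) (auto simp: peval_add peval_mult[OF qw.x] intro: peval_in qw.x)

lemma tideal_xext:
  assumes F: "tideal UNIV F"
  shows "tideal B (xext F)"
  unfolding tideal_def
proof (intro conjI ballI)
  show "xext F \<subseteq> B" by (auto simp: xext_def)
  show "0 \<in> xext F" by (rule xextI[of _ 0 _ 0]) (use tidealD(2)[OF F] tidealD(2)[OF tideal_hB] qwD(3) in auto)
next
  fix a b assume "a \<in> xext F" "b \<in> xext F"
  then obtain N f M g where f: "x ^ N * a - peval x f \<in> hB" "f \<in> F" "a \<in> B"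
    and g: "x ^ M * b - peval x g \<in> hB" "g \<in> F" "b \<in> B" by (auto simp: xext_def)
  show "a + b \<in> xext F"
    using f g tidealD(3)[OF F] cideal_mult[OF F] by (intro xextI[OF _ _ hB_poly_add[OF f(1) g(1)]]) (auto intro: qw.add)
next
  fix a b assume "a \<in> xext F" and b: "b \<in> B"
  then obtain N f where f: "x ^ N * a - peval x f \<in> hB" "f \<in> F" "a \<in> B" by (auto simp: xext_def)
  obtain M g where g: "x ^ M * b - peval x g \<in> hB" using mod_h_poly[OF b] by blast
  have 5: "x ^ (N + M) * (a * b) - peval x (f * g) \<in> hB" by (rule hB_poly_mult[OF f(1) g f(3) b])
  have fg: "f * g \<in> F" using f cideal_mult[OF F] by auto
  show "a * b \<in> xext F" using 5 fg f b by (intro xextI) (auto intro: qw.mult)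
  have 6: "x ^ (N + M) * (b * a) - x ^ (N + M) * (a * b) \<in> hB"
    by (intro hB_cong(1) hB_commute b f qw_power qw.x)
  show "b * a \<in> xext F" using hB_trans[OF 6 5] fg f b by (intro xextI) (auto intro: qw.mult)
qed

lemma peval_in_xext:
  assumes "cprime F" "[:0, 1:] \<notin> F"
  shows "peval x f \<in> xext F \<longleftrightarrow> f \<in> F"
proof
  assume "peval x f \<in> xext F"
  then obtain N g where g: "g \<in> F" "x ^ N * peval x f - peval x g \<in> hB" by (auto simp: xext_def)
  then have "peval x (monom 1 N * f - g) \<in> hB" by (simp add: peval_diff peval_mult[OF qw.x] peval_X_power)
  then have "monom 1 N * f = g" using peval_in_hB[of "monom 1 N * f - g"] by simp
  then have "[:0, 1:] ^ N * f \<in> F" using g by (simp add: monom_altdef)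
  then show "f \<in> F" using cprimeD(3)[OF assms(1)] cprime_power[OF assms(1)] assms(2) by blast
next
  assume "f \<in> F"
  then show "peval x f \<in> xext F"
    using tidealD(2)[OF tideal_hB] by (intro xextI[of _ f _ 0] peval_in qw.x) simp_all
qed

lemma h_in_xext: "tideal UNIV F \<Longrightarrow> h \<in> xext F"
  using h_in_hB tidealD(2)[of UNIV F] by (intro xextI[of _ 0 _ 0]) (simp_all add: h_in)

text \<open>Powers of x turn a and b into polynomials f and g modulo h. The assumption, with x^M
  inserted between a and b, puts fg into F, where primeness applies.\<close>

lemma tprime_xext:
  assumes F: "cprime F" "[:0, 1:] \<notin> F"
  shows "tprime B (xext F)"
proof -
  have tF: "tideal UNIV F" using F(1) by (rule cprimeD)
  note T = tideal_xext[OF tF] and P = peval_in_xext[OF F]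
  have "1 \<notin> xext F" using P[of 1] cprimeD(2)[OF F(1)] by simp
  moreover have "a \<in> xext F \<or> b \<in> xext F" if ab: "a \<in> B" "b \<in> B" "\<forall>c\<in>B. a * c * b \<in> xext F" for a b
  proof -
    obtain N f M g where f: "x ^ N * a - peval x f \<in> hB" and g: "x ^ M * b - peval x g \<in> hB"
      using mod_h_poly ab by metis
    have "a * x ^ M * b \<in> xext F" using ab(3) qw_power[OF qw.x] by blast
    then have 1: "(x ^ N * a) * (x ^ M * b) \<in> xext F"
      using tidealD(5)[OF T _ qw_power[OF qw.x]] by (simp add: mult.assoc)
    have 2: "(x ^ N * a) * (x ^ M * b) - peval x f * (x ^ M * b) \<in> hB"
      by (rule hB_cong(2)[OF f]) (intro B_intros ab)
    have 3: "peval x f * (x ^ M * b) - peval x f * peval x g \<in> hB"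
      by (rule hB_cong(1)[OF g]) (intro peval_in qw.x)
    have "(x ^ N * a) * (x ^ M * b) - peval x (f * g) \<in> xext F"
      using hB_trans[OF 2 3] hB_least[OF T h_in_xext[OF tF]] by (auto simp: peval_mult[OF qw.x])
    from tideal_diff[OF tsubring_qw T 1 this] have "peval x (f * g) \<in> xext F" by simp
    then have "f * g \<in> F" by (simp only: P)
    then have "f \<in> F \<or> g \<in> F" by (rule cprimeD(3)[OF F(1)])
    then show ?thesis using f g ab by (auto intro: xextI)
  qed
  ultimately show ?thesis using T by (auto simp: tprime_def)
qed

text \<open>Modulo h the ring is commutative and x is a unit; hence such a prime is determined by
  the polynomials in x that it contains, and x is not one of them.\<close>

lemma tprime_h_eq_xext:
  assumes P: "tprime B P" "h \<in> P"
  shows "cprime {f. peval x f \<in> P} \<and> [:0, 1:] \<notin> {f. peval x f \<in> P} \<and> P = xext {f. peval x f \<in> P}"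
proof (intro conjI)
  note I = tprimeD(1)[OF P(1)]
  have hP: "hB \<subseteq> P" by (rule hB_least[OF I P(2)])
  show "cprime {f. peval x f \<in> P}"
    unfolding cprime_def
  proof (intro conjI allI impI)
    show "tideal UNIV {f. peval x f \<in> P}" by (rule tideal_xcon[OF I])
    show "1 \<notin> {f. peval x f \<in> P}" using tprimeD(2)[OF P(1)] by simp
    fix f g assume "f * g \<in> {f. peval x f \<in> P}"
    then have fg: "peval x f * peval x g \<in> P" by (simp add: peval_mult[OF qw.x])
    have pB: "peval x f \<in> B" "peval x g \<in> B" by (intro peval_in qw.x)+
    have "peval x f * c * peval x g \<in> P" if c: "c \<in> B" for c
    proof -
      have "peval x f * c * peval x g - c * peval x f * peval x g \<in> P"
        using hB_cong(2)[OF hB_commute[OF pB(1) c] pB(2)] hP by blast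
      moreover have "c * peval x f * peval x g \<in> P" using tidealD(5)[OF I fg c] by (simp add: mult.assoc)
      ultimately show ?thesis using tidealD(3)[OF I] by fastforce
    qed
    then show "f \<in> {f. peval x f \<in> P} \<or> g \<in> {f. peval x f \<in> P}" using tprimeD(3)[OF P(1) pB] by simp
  qed
  show "[:0, 1:] \<notin> {f. peval x f \<in> P}"
  proof
    assume "[:0, 1:] \<in> {f. peval x f \<in> P}"
    then have "x ^ 1 * 1 \<in> P" by (simp add: op_c_hom)
    then have "1 \<in> P" using x_cancel[OF I P(2) qwD(1)] by blast
    then show False using tprimeD(2)[OF P(1)] by simp
  qed
  show "P = xext {f. peval x f \<in> P}"
  proof
    show "P \<subseteq> xext {f. peval x f \<in> P}"
    proof
      fix a assume a: "a \<in> P"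
      then have aB: "a \<in> B" using tidealD(1)[OF I] by blast
      then obtain N f where f: "x ^ N * a - peval x f \<in> hB" using mod_h_poly by blast
      have 1: "x ^ N * a \<in> P" by (intro tidealD(5)[OF I a] qw_power qw.x)
      have 2: "x ^ N * a - peval x f \<in> P" using f hP by blast
      have "peval x f \<in> P" using tideal_diff[OF tsubring_qw I 1 2] by simp
      then show "a \<in> xext {f. peval x f \<in> P}" using f aB by (intro xextI) simp_all
    qed
    show "xext {f. peval x f \<in> P} \<subseteq> P"
    proof
      fix a assume "a \<in> xext {f. peval x f \<in> P}"
      then obtain N f where f: "a \<in> B" "peval x f \<in> P" "x ^ N * a - peval x f \<in> hB" by (auto simp: xext_def)
      then have "(x ^ N * a - peval x f) + peval x f \<in> P" using hP by (intro tidealD(3)[OF I]) auto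
      then show "a \<in> P" using x_cancel[OF I P(2) f(1)] by simp
    qed
  qed
qed

lemma tgen_h_poly: "tgen B {h, peval x f} = xext {g. f dvd g}"
proof (rule tgen_eqI)
  show "tideal B (xext {g. f dvd g})" by (rule tideal_xext[OF tideal_dvd])
  show "{h, peval x f} \<subseteq> xext {g. f dvd g}"
    using h_in_xext[OF tideal_dvd] tidealD(2)[OF tideal_hB]
    by (auto intro!: xextI[of "peval x f" f _ 0] peval_in qw.x)
  fix J assume J: "tideal B J" "{h, peval x f} \<subseteq> J"
  show "xext {g. f dvd g} \<subseteq> J"
  proof
    fix a assume "a \<in> xext {g. f dvd g}"
    then obtain N k where k: "a \<in> B" "x ^ N * a - peval x (f * k) \<in> hB" by (auto simp: xext_def elim!: dvdE)
    have "peval x (f * k) \<in> J"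
      using J(2) by (simp add: peval_mult[OF qw.x] tidealD(4)[OF J(1)] peval_in[OF qw.x])
    then have "(x ^ N * a - peval x (f * k)) + peval x (f * k) \<in> J"
      using k hB_least[OF J(1)] J(2) by (intro tidealD(3)[OF J(1)]) auto
    then show "a \<in> J" using x_cancel[OF J(1) _ k(1)] J(2) by simp
  qed
qed

lemma xext_zero: "xext {0} = hB"
proof -
  have "{g :: 'k poly. 0 dvd g} = {0}" by auto
  then have "xext {0} = tgen B {h, 0}" using tgen_h_poly[of 0] by simp
  also have "\<dots> = hB"
    by (rule tgen_eqI) (auto simp: tideal_hB h_in_hB tidealD(2)[OF tideal_hB] dest: hB_least)
  finally show ?thesis .
qed

end

section \<open>The spectrum\<close>

text \<open>Disjointness is symmetric, so only ordered pairs of positions matter; on an explicit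
  list \<open>sorted_wrt\<close> unfolds to finitely many intersections.\<close>

lemma is_disjoint_union_iff:
  "is_disjoint_union S Xs \<longleftrightarrow> S = \<Union> (set Xs) \<and> sorted_wrt (\<lambda>X Y. X \<inter> Y = {}) Xs"
proof -
  have "(\<forall>i<length Xs. \<forall>j<length Xs. i \<noteq> j \<longrightarrow> Xs ! i \<inter> Xs ! j = {}) \<longleftrightarrow>
    (\<forall>i j. i < j \<longrightarrow> j < length Xs \<longrightarrow> Xs ! i \<inter> Xs ! j = {})"
    (is "?L \<longleftrightarrow> ?R")
  proof
    show "?L \<Longrightarrow> ?R" by (simp add: less_imp_neq)
    assume R: ?R
    show ?L
    proof (intro allI impI)
      fix i j assume "i < length Xs" "j < length Xs" "i \<noteq> j"
      then show "Xs ! i \<inter> Xs ! j = {}"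
        using R[rule_format, of i j] R[rule_format, of j i] by (cases "i < j") (auto simp: Int_commute)
    qed
  qed
  then show ?thesis by (simp add: is_disjoint_union_def sorted_wrt_iff_nth_less)
qed

lemma is_disjoint_union_image:
  assumes "is_disjoint_union S Xs" "inj_on f S"
  shows "is_disjoint_union (f ` S) (map ((`) f) Xs)"
proof -
  have S: "S = \<Union> (set Xs)" and d: "sorted_wrt (\<lambda>X Y. X \<inter> Y = {}) Xs"
    using assms(1) by (auto simp: is_disjoint_union_iff)
  have "sorted_wrt (\<lambda>X Y. f ` X \<inter> f ` Y = {}) Xs"
  proof (rule sorted_wrt_mono_rel[OF _ d])
    fix X Y assume XY: "X \<in> set Xs" "Y \<in> set Xs" "X \<inter> Y = {}"
    then have "f ` X \<inter> f ` Y = f ` (X \<inter> Y)"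
      using S by (intro inj_on_image_Int[OF assms(2), symmetric]) auto
    then show "f ` X \<inter> f ` Y = {}" using XY by simp
  qed
  then show ?thesis by (auto simp: is_disjoint_union_iff S sorted_wrt_map)
qed

context root_of_unity
begin

section \<open>The strata of the spectrum\<close>

definition "PR = {P. tprime B P}"

lemma sS_eq: "sS = [:[:c0 ^ n:]:] + [:[:inverse \<alpha>:]:] * (XX * YY)"
  by (simp add: sS_def)

text \<open>Modulo t or r, s is the nonzero constant c0^n. This keeps the stratum of h apart from
  those of t and r.\<close>

lemma sS_notin:
  assumes p: "cprime p" and "XX \<in> p \<or> YY \<in> p"
  shows "sS \<notin> p"
proof
  assume s: "sS \<in> p"
  note I = cprimeD(1)[OF p]
  have "XX * YY \<in> p" using assms(2) cideal_mult[OF I] by blast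
  then have "[:[:inverse \<alpha>:]:] * (XX * YY) \<in> p" by (rule cideal_mult(2)[OF I])
  from cideal_diff[OF I s this] have "[:[:c0 ^ n:]:] \<in> p" unfolding sS_eq by (simp only: add_diff_cancel_right')
  then have "[:[:c0 ^ n:]:] * [:[:inverse (c0 ^ n):]:] \<in> p" by (rule cideal_mult(1)[OF I])
  moreover have "[:[:c0 ^ n:]:] * [:[:inverse (c0 ^ n):]:] = 1"
    using c0_ne_0 by (simp add: one_pCons field_simps)
  ultimately show False using cprimeD(2)[OF p] by simp
qed

text \<open>Normality gives h c h^k = h^(k+1) c', so h^(k+1) in P yields h B h^k inside P; primeness
  then removes the factors one at a time.\<close>

lemma h_in_iff:
  assumes P: "tprime B P"
  shows "sS \<in> con P \<longleftrightarrow> h \<in> P"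
proof -
  note I = tprimeD(1)[OF P]
  have pow: "\<exists>c'\<in>B. c * h ^ k = h ^ k * c'" if "c \<in> B" for c k
    using that
  proof (induction k arbitrary: c)
    case (Suc k)
    then obtain c1 where c1: "c1 \<in> B" "c * h = h * c1" using h_normal by blast
    obtain c2 where c2: "c2 \<in> B" "c1 * h ^ k = h ^ k * c2" using Suc.IH[OF c1(1)] by blast
    have "c * h ^ Suc k = h * (c1 * h ^ k)" using c1 by (simp add: mult.assoc[symmetric])
    also have "\<dots> = h ^ Suc k * c2" using c2 by (simp add: mult.assoc)
    finally show ?case using c2 by blast
  qed auto
  have "h ^ k \<in> P \<Longrightarrow> h \<in> P" for k
  proof (induction k)
    case 0
    then show ?case using tprimeD(2)[OF P] by simp
  next
    case (Suc k)
    have "h * c * h ^ k \<in> P" if c: "c \<in> B" for c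
    proof -
      obtain c' where c': "c' \<in> B" "c * h ^ k = h ^ k * c'" using pow[OF c] by blast
      then have "h * c * h ^ k = h ^ Suc k * c'" by (simp add: mult.assoc)
      then show ?thesis using tidealD(4)[OF I Suc.prems c'(1)] by simp
    qed
    then have "h \<in> P \<or> h ^ k \<in> P" by (intro tprimeD(3)[OF P] h_in qw_power) auto
    then show ?case using Suc.IH by blast
  qed
  moreover have "h ^ n \<in> P" if "h \<in> P"
    using tidealD(4)[OF I that qw_power[OF h_in], of "n - 1"] n_pos by (simp add: power_Suc[symmetric] del: power_Suc)
  ultimately show ?thesis by (auto simp: con_def zm_sS)
qed

text \<open>Where s is avoided, and t or r as well, extension and contraction are mutually inverse
  on primes; the predicate \<open>C\<close> selects a stratum.\<close>

lemma PR_ext: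
  assumes "\<And>p. cprime p \<Longrightarrow> C p \<Longrightarrow> sS \<notin> p \<and> (XX \<notin> p \<or> YY \<notin> p)"
  shows "{P \<in> PR. C (con P)} = ext ` {p. cprime p \<and> C p}"
proof (intro equalityI subsetI)
  fix P assume "P \<in> {P \<in> PR. C (con P)}"
  then have P: "tprime B P" "C (con P)" by (auto simp: PR_def)
  then show "P \<in> ext ` {p. cprime p \<and> C p}"
    using tprime_eq_ext[OF P(1)] cprime_con[OF P(1)] assms[OF cprime_con[OF P(1)]] by blast
next
  fix P assume "P \<in> ext ` {p. cprime p \<and> C p}"
  then obtain p where p: "cprime p" "C p" "P = ext p" by blast
  then show "P \<in> {P \<in> PR. C (con P)}"
    using tprime_ext assms[OF p(1,2)] con_ext[OF cprimeD(1)[OF p(1)]] by (simp add: PR_def)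
qed

definition "T_trs = {P \<in> PR. XX \<notin> con P \<and> YY \<notin> con P \<and> sS \<notin> con P}"
definition "T_t = {P \<in> PR. YY \<in> con P \<and> XX \<notin> con P}"
definition "T_r = {P \<in> PR. XX \<in> con P \<and> YY \<notin> con P}"
definition "T_tr = {P \<in> PR. XX \<in> con P \<and> YY \<in> con P}"
definition "T_h = {P \<in> PR. h \<in> P}"
definition "T_N = ext ` {p. height_one p \<and> p \<noteq> tgen UNIV {XX} \<and> p \<noteq> tgen UNIV {YY} \<and> p \<noteq> tgen UNIV {sS}}"
definition "T_M = ext ` {p. cmax p \<and> XX \<notin> p \<and> YY \<notin> p \<and> sS \<notin> p}"
definition "T_R = {ext (tgen UNIV {YY, [:f:]}) | f. f \<in> Irr_m - {[:0, 1:]}}"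
definition "T_T = {ext (tgen UNIV {XX, map_poly (\<lambda>c. [:c:]) f}) | f. f \<in> Irr_m - {[:0, 1:]}}"
definition "T_H = {xext {g. f dvd g} | f. f \<in> Irr_m - {[:0, 1:]}}"

lemma spec_decomposition: "is_disjoint_union PR [T_trs, T_t, T_r, T_tr, T_h]"
proof -
  have *: "sS \<notin> con P" if "P \<in> PR" "XX \<in> con P \<or> YY \<in> con P" for P
    using that sS_notin cprime_con by (auto simp: PR_def)
  have **: "sS \<in> con P \<longleftrightarrow> h \<in> P" if "P \<in> PR" for P using that h_in_iff by (auto simp: PR_def)
  show ?thesis
    unfolding is_disjoint_union_iff
    by (auto simp: T_trs_def T_t_def T_r_def T_tr_def T_h_def dest: * simp: **)
qed

lemma T_trs_eq: "T_trs = ext ` {p. cprime p \<and> XX \<notin> p \<and> YY \<notin> p \<and> sS \<notin> p}"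
  unfolding T_trs_def by (rule PR_ext) auto

lemma prime_XX: "prime_elem (XX :: 'k poly poly)"
  using Irr_mD(1)[OF X_Irr_m] by (simp add: prime_elem_const_poly_iff)

lemma prime_YY: "prime_elem (YY :: 'k poly poly)"
  using ret_R.cprime_tgen_a[where 'a = 'k] by (auto simp: tgen_single cprime_def prime_elem_def)

lemma height_one_notin:
  assumes "height_one p"
  shows "p \<noteq> tgen UNIV {XX} \<longleftrightarrow> XX \<notin> p" "p \<noteq> tgen UNIV {YY} \<longleftrightarrow> YY \<notin> p" "p \<noteq> tgen UNIV {sS} \<longleftrightarrow> sS \<notin> p"
proof -
  have inc: "a \<in> tgen UNIV {a}" for a :: "'k poly poly" using tgen_incl by blast
  show "p \<noteq> tgen UNIV {XX} \<longleftrightarrow> XX \<notin> p" "p \<noteq> tgen UNIV {YY} \<longleftrightarrow> YY \<notin> p"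
    using inc height_one_eq_dvd[OF assms prime_XX] height_one_eq_dvd[OF assms prime_YY]
    unfolding tgen_single by blast+
  show "p \<noteq> tgen UNIV {sS} \<longleftrightarrow> sS \<notin> p"
    using inc height_one_linear[OF assms sS_def] c0_ne_0 \<alpha>_ne_0 unfolding tgen_single by fastforce
qed

lemma con_ext_prime: "cprime p \<Longrightarrow> con (ext p) = p"
  by (intro con_ext cprimeD(1))

lemma cprime_zero_S: "cprime ({0} :: 'k poly poly set)"
  using tideal_zero[OF tsubring_UNIV] by (auto simp: cprime_def)

lemma sS_ne_0: "sS \<noteq> 0"
  using c0_ne_0 by (simp add: sS_def)

text \<open>Extension is injective on primes, so this is the division of the primes of K[r,t] into
  zero, height one and maximal.\<close>

lemma T_trs_decomposition: "is_disjoint_union T_trs [{{0}}, T_N, T_M]"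
proof -
  have N: "T_N = ext ` {p. height_one p \<and> XX \<notin> p \<and> YY \<notin> p \<and> sS \<notin> p}"
    unfolding T_N_def using height_one_notin by (intro image_cong Collect_cong) auto
  have Z: "{{0}} = ext ` {p. p = {0} \<and> XX \<notin> p \<and> YY \<notin> p \<and> sS \<notin> p}"
    using ext_zero_ideal sS_ne_0 by auto
  have inj: "inj_on ext {p. cprime p}"
    by (rule inj_onI) (metis con_ext_prime mem_Collect_eq)
  have "is_disjoint_union {p. cprime p \<and> XX \<notin> p \<and> YY \<notin> p \<and> sS \<notin> p}
     [{p. p = {0} \<and> XX \<notin> p \<and> YY \<notin> p \<and> sS \<notin> p}, {p. height_one p \<and> XX \<notin> p \<and> YY \<notin> p \<and> sS \<notin> p},
      {p. cmax p \<and> XX \<notin> p \<and> YY \<notin> p \<and> sS \<notin> p}]"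
  proof -
    have "height_one p \<Longrightarrow> cprime p \<and> p \<noteq> {0}" for p :: "'k poly poly set" by (simp add: height_one_def)
    then have "cprime p \<longleftrightarrow> p = {0} \<or> height_one p \<or> cmax p"
      "\<not> (p = {0} \<and> height_one p)" "\<not> (p = {0} \<and> cmax p)" "\<not> (height_one p \<and> cmax p)" for p :: "'k poly poly set"
      using prime_trichotomy[of p] cprime_zero_S cmax_imp_cprime[of p] cmax_imp_not_height_one[of p] by metis+
    then show ?thesis unfolding is_disjoint_union_iff by auto
  qed
  from is_disjoint_union_image[OF this inj_on_subset[OF inj]]
  show ?thesis unfolding T_trs_eq N Z T_M_def by auto
qed

lemma T_t_eq: "T_t = ext ` ({tgen UNIV {YY}} \<union> {tgen UNIV {YY, [:f:]} | f. f \<in> Irr_m - {[:0, 1:]}})"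
proof -
  have "T_t = ext ` {p. cprime p \<and> YY \<in> p \<and> XX \<notin> p}"
    unfolding T_t_def by (rule PR_ext) (auto dest: sS_notin)
  then show ?thesis by (simp only: ret_R.primes_above[of XX, OF refl])
qed

lemma T_r_eq: "T_r = ext ` ({tgen UNIV {XX}} \<union> {tgen UNIV {XX, map_poly (\<lambda>c. [:c:]) f} | f. f \<in> Irr_m - {[:0, 1:]}})"
proof -
  have "T_r = ext ` {p. cprime p \<and> XX \<in> p \<and> YY \<notin> p}"
    unfolding T_r_def by (rule PR_ext) (auto dest: sS_notin)
  moreover have "YY = map_poly (\<lambda>c. [:c:]) [:0, 1 :: 'k:]" by (simp add: map_poly_pCons one_pCons)
  note ret_T.primes_above[OF this]
  ultimately show ?thesis by (simp only:)
qed

lemma ext_psubset: "cprime p \<Longrightarrow> cprime p' \<Longrightarrow> p \<subset> p' \<Longrightarrow> ext p \<subset> ext p'"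
  using ext_mono[of p p'] con_ext_prime by (metis psubset_eq)

lemma R_strict: "f \<in> Irr_m \<Longrightarrow> ext (tgen UNIV {YY}) \<subset> ext (tgen UNIV {YY, [:f:]})"
  by (intro ext_psubset ret_R.cprime_tgen_a ret_R.cprime_tgen ret_R.tgen_strict)

lemma T_strict: "f \<in> Irr_m \<Longrightarrow> ext (tgen UNIV {XX}) \<subset> ext (tgen UNIV {XX, map_poly (\<lambda>c. [:c:]) f})"
  by (intro ext_psubset ret_T.cprime_tgen_a ret_T.cprime_tgen ret_T.tgen_strict)

lemma mm_alt: "mm = tgen UNIV {XX, map_poly (\<lambda>c. [:c:]) [:0, 1:]}"
  by (simp add: mm_def map_poly_pCons one_pCons insert_commute)

lemma tr_strict: "ext (tgen UNIV {YY}) \<subset> ext mm" "ext (tgen UNIV {XX}) \<subset> ext mm"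
proof -
  show "ext (tgen UNIV {YY}) \<subset> ext mm" unfolding mm_def by (rule R_strict[OF X_Irr_m])
  show "ext (tgen UNIV {XX}) \<subset> ext mm" unfolding mm_alt by (rule T_strict[OF X_Irr_m])
qed

lemma T_t_decomposition: "is_disjoint_union T_t [{ext (tgen UNIV {YY})}, T_R]"
  unfolding is_disjoint_union_iff T_t_eq T_R_def using R_strict by fastforce

lemma T_r_decomposition: "is_disjoint_union T_r [{ext (tgen UNIV {XX})}, T_T]"
  unfolding is_disjoint_union_iff T_r_eq T_T_def using T_strict by fastforce

lemma T_tr_eq: "T_tr = {ext mm}"
proof -
  have "XX \<in> mm" "YY \<in> mm" by (auto simp: mem_mm)
  then have "ext mm \<in> T_tr"
    using tprime_ext_mm con_ext_prime[OF cprime_mm] by (simp add: T_tr_def PR_def)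
  moreover have "P = ext mm" if "P \<in> T_tr" for P
    using that by (intro tprime_eq_ext_mm) (simp_all add: T_tr_def PR_def)
  ultimately show ?thesis by blast
qed

lemma X_notin_dvd: "f \<in> Irr_m - {[:0, 1:]} \<Longrightarrow> cprime {g. f dvd g} \<and> [:0, 1:] \<notin> {g. f dvd g}"
  using Irr_m_dvd_imp_eq[of f, OF _ X_Irr_m] cprime_dvd[OF Irr_mD(1)] by auto

lemma xext_subset_imp:
  assumes "cprime F" "[:0, 1:] \<notin> F" "cprime F'" "[:0, 1:] \<notin> F'" "xext F \<subseteq> xext F'"
  shows "F \<subseteq> F'"
proof
  fix f assume "f \<in> F"
  then have "peval x f \<in> xext F'" using peval_in_xext[OF assms(1,2), of f] assms(5) by auto
  then show "f \<in> F'" using peval_in_xext[OF assms(3,4), of f] by simp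
qed

lemma cprime_zero_poly: "cprime ({0} :: 'k poly set)" "[:0, 1:] \<notin> ({0} :: 'k poly set)"
  using tideal_zero[OF tsubring_UNIV] by (auto simp: cprime_def)

lemma T_h_eq: "T_h = {hB} \<union> T_H"
proof (intro equalityI subsetI)
  fix P assume "P \<in> T_h"
  then have P: "tprime B P" "h \<in> P" by (auto simp: T_h_def PR_def)
  define F where "F = {f. peval x f \<in> P}"
  have F: "cprime F" "[:0, 1:] \<notin> F" "P = xext F"
    using tprime_h_eq_xext[OF P] unfolding F_def by auto
  show "P \<in> {hB} \<union> T_H"
  proof (cases rule: cprime_poly_cases[OF F(1)])
    case 1
    then show ?thesis using F(3) xext_zero by simp
  next
    case (2 f)
    have "f \<noteq> [:0, 1:]" using F(2) unfolding 2(2) by auto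
    moreover have "P = xext {g. f dvd g}" using F(3) unfolding 2(2) .
    ultimately show ?thesis using 2(1) unfolding T_H_def by blast
  qed
next
  have 1: "xext F \<in> T_h" if "cprime F" "[:0, 1:] \<notin> F" for F
    using tprime_xext[OF that] h_in_xext[OF cprimeD(1)[OF that(1)]] by (simp add: T_h_def PR_def)
  have "hB \<in> T_h" using 1[OF cprime_zero_poly] by (simp add: xext_zero)
  moreover have "P \<in> T_h" if P: "P \<in> T_H" for P
  proof -
    obtain f where f: "f \<in> Irr_m - {[:0, 1:]}" "P = xext {g. f dvd g}" using P unfolding T_H_def by blast
    show ?thesis unfolding f(2) using X_notin_dvd[OF f(1)] by (intro 1) blast+
  qed
  ultimately show "P \<in> {hB} \<union> T_H \<Longrightarrow> P \<in> T_h" for P by blast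
qed

lemma H_strict: "P \<in> T_H \<Longrightarrow> hB \<subset> P"
proof -
  assume P: "P \<in> T_H"
  then obtain f where f: "f \<in> Irr_m - {[:0, 1:]}" "P = xext {g. f dvd g}" by (auto simp: T_H_def)
  note F = X_notin_dvd[OF f(1)]
  have "P \<in> T_h" using P T_h_eq by simp
  then have "hB \<subseteq> P" using hB_least tprimeD(1) by (auto simp: T_h_def PR_def)
  moreover have "P \<noteq> hB"
  proof
    assume "P = hB"
    then have "{g. f dvd g} \<subseteq> {0}"
      using xext_subset_imp[of "{g. f dvd g}" "{0}"] F cprime_zero_poly xext_zero f(2) by simp
    then have "f \<in> {0}" by (rule subsetD) simp
    then show False using f(1) Irr_mD(3)[of f] by auto
  qed
  ultimately show ?thesis by auto
qed

lemma T_h_decomposition: "is_disjoint_union T_h [{hB}, T_H]"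
  unfolding is_disjoint_union_iff T_h_eq using H_strict by auto

text \<open>Both are nonzero primes strictly below \<open>mm\<close>, so they are not maximal, and
  the trichotomy leaves height one.\<close>

lemma height_one_tgen: "height_one (tgen UNIV {YY :: 'k poly poly})" "height_one (tgen UNIV {XX :: 'k poly poly})"
proof -
  have 1: "height_one p" if p: "cprime p" "p \<noteq> {0}" "p \<subset> mm" for p
  proof -
    have "\<not> cmax p"
      using p(3) cprimeD(1,2)[OF cprime_mm] unfolding cmax_def by blast
    then show ?thesis using prime_trichotomy[OF p(1)] p(2) by blast
  qed
  have inc: "a \<in> tgen UNIV {a}" for a :: "'k poly poly" using tgen_incl by blast
  have ne: "tgen UNIV {YY} \<noteq> {0 :: 'k poly poly}" "tgen UNIV {XX} \<noteq> {0 :: 'k poly poly}"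
    using inc[of YY] inc[of XX] by auto
  have "tgen UNIV {YY} \<subset> mm" unfolding mm_def by (rule ret_R.tgen_strict[OF X_Irr_m])
  then show "height_one (tgen UNIV {YY :: 'k poly poly})" by (rule 1[OF ret_R.cprime_tgen_a ne(1)])
  have "tgen UNIV {XX} \<subset> mm" unfolding mm_alt by (rule ret_T.tgen_strict[OF X_Irr_m])
  then show "height_one (tgen UNIV {XX :: 'k poly poly})" by (rule 1[OF ret_T.cprime_tgen_a ne(2)])
qed

text \<open>
  The centre part of \<open>(h)\<close> is not maximal since that of the larger ideal \<open>(h, x - 1)\<close> contains \<open>t - 1\<close>.
\<close>

lemma con_hB_not_cmax: "\<not> cmax (con hB)"
proof
  assume M: "cmax (con hB)"
  let ?f = "[:-1, 1 :: 'k:]"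
  have zt: "zm (XX - 1) = peval x (monom 1 n - 1)"
    by (simp only: zm_hom zm_simps peval_diff peval_X_power peval_1)
  have "XX - 1 \<notin> con hB"
  proof
    assume "XX - 1 \<in> con hB"
    then have "peval x (monom 1 n - 1) \<in> hB" unfolding con_def mem_Collect_eq zt .
    then have "monom 1 n - 1 = (0 :: 'k poly)" by (rule peval_in_hB)
    then have "coeff (monom 1 n - 1) n = (0 :: 'k)" by simp
    then show False using n_pos by simp
  qed
  from cmax_coprime[OF M this] obtain e u where eu: "e \<in> con hB" "1 = e + u * (XX - 1)" by blast
  have f: "?f \<in> Irr_m" by (auto simp: Irr_m_def intro: irreducible_linear_field_poly)
  then have F: "cprime {g. ?f dvd g}" "[:0, 1:] \<notin> {g. ?f dvd g}" using X_notin_dvd[of ?f] by auto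
  note T = tprime_xext[OF F]
  note I = tprimeD(1)[OF T]
  have "zm e \<in> xext {g. ?f dvd g}"
    using eu(1) hB_least[OF I h_in_xext[OF tideal_dvd]] by (auto simp: con_def)
  moreover have "zm (XX - 1) \<in> xext {g. ?f dvd g}"
  proof -
    have "poly (monom 1 n - 1) (1 :: 'k) = 0" by (simp add: poly_monom)
    then have "?f dvd monom 1 n - 1" by (simp only: poly_eq_0_iff_dvd)
    then show ?thesis unfolding zt peval_in_xext[OF F] by simp
  qed
  ultimately have "zm e + zm u * zm (XX - 1) \<in> xext {g. ?f dvd g}"
    by (intro tidealD(3)[OF I] tidealD(5)[OF I] zm_in)
  moreover have "zm e + zm u * zm (XX - 1) = 1" using arg_cong[OF eu(2), of zm] by (simp only: zm_hom)
  ultimately show False using tprimeD(2)[OF T] by simp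
qed

lemma zero_in_PR: "{0} \<in> PR"
  using tprime_ext[of "{0}"] cprime_zero_S sS_ne_0 ext_zero_ideal by (simp add: PR_def)

lemma PR_zero: "P \<in> PR \<Longrightarrow> {0} \<subseteq> P"
  using tprimeD(1) tidealD(2) by (auto simp: PR_def)

text \<open>Above h the question is about ideals of K[x], and (t,r) has nothing above it. Otherwise
  P is extended from a prime p that turns out to have height one; the stratum of Q is then read off,
  height one being impossible for an extended Q.\<close>

lemma strict_inclusions:
  assumes P: "P \<in> PR" and Q: "Q \<in> PR" and sub: "P \<subset> Q" and P0: "P \<noteq> {0}"
  shows "(P = ext (tgen UNIV {XX}) \<and> Q \<in> {ext mm} \<union> T_T) \<or>
     (P = ext (tgen UNIV {YY}) \<and> Q \<in> {ext mm} \<union> T_R) \<or>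
     (P = hB \<and> Q \<in> T_H) \<or>
     (P \<in> T_N \<and> Q \<in> T_T \<union> {ext mm} \<union> T_R \<union> T_M \<union> T_H)"
proof -
  have tP: "tprime B P" and tQ: "tprime B Q" using P Q by (auto simp: PR_def)
  define p q where "p = con P" and "q = con Q"
  have p: "cprime p" and q: "cprime q" unfolding p_def q_def by (intro cprime_con tP tQ)+
  have pq: "p \<subseteq> q" unfolding p_def q_def using sub by (intro con_mono) auto
  have Qcases: "Q \<in> T_trs \<union> T_t \<union> T_r \<union> T_tr \<union> T_h"
    using spec_decomposition Q by (auto simp: is_disjoint_union_iff)
  consider (h) "P \<in> T_h" | (tr) "P \<in> T_tr" | (e) "sS \<notin> p" "XX \<notin> p \<or> YY \<notin> p"
    using P h_in_iff[OF tP] by (auto simp: T_h_def T_tr_def p_def)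
  then show ?thesis
  proof cases
    case h
    then have Qh: "Q \<in> T_h" using sub Q by (auto simp: T_h_def)
    show ?thesis
    proof (cases "P = hB")
      case True
      then show ?thesis using Qh sub T_h_eq by auto
    next
      case False
      then obtain f where f: "f \<in> Irr_m - {[:0, 1:]}" "P = xext {g. f dvd g}"
        using h T_h_eq by (auto simp: T_H_def)
      have "Q \<noteq> hB" using h sub hB_least tprimeD(1)[OF tP] by (auto simp: T_h_def)
      then obtain f' where f': "f' \<in> Irr_m - {[:0, 1:]}" "Q = xext {g. f' dvd g}"
        using Qh T_h_eq by (auto simp: T_H_def)
      have "{g. f dvd g} \<subseteq> {g. f' dvd g}"
        using xext_subset_imp[of "{g. f dvd g}" "{g. f' dvd g}"] X_notin_dvd f f' sub by auto
      then have "f \<in> {g. f' dvd g}" by (rule subsetD) simp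
      then have "f' dvd f" by simp
      then have "f' = f" using Irr_m_dvd_imp_eq f f' by auto
      then show ?thesis using f f' sub by simp
    qed
  next
    case tr
    then have "Q \<in> T_tr" using pq Q by (auto simp: T_tr_def p_def q_def)
    then show ?thesis using tr sub T_tr_eq by auto
  next
    case e
    have Pe: "P = ext p" unfolding p_def using tprime_eq_ext[OF tP] e by (simp add: p_def)
    have p0: "p \<noteq> {0}" using Pe P0 ext_zero_ideal by auto
    \<comment> \<open>Were p maximal, q would equal p, and P and Q would be the same
      extension.\<close>
    have "\<not> cmax p"
    proof
      assume m: "cmax p"
      have "q = p" using m pq cprimeD(1,2)[OF q] unfolding cmax_def by blast
      then have "Q = ext p" using tprime_eq_ext[OF tQ] e by (simp add: q_def)
      then show False using Pe sub by simp
    qed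
    then have hp: "height_one p" using prime_trichotomy[OF p] p0 by blast
    \<comment> \<open>A height-one prime has no nonzero prime strictly below it, so p and p' would
      coincide and Q would equal P.\<close>
    have below: "False" if "height_one p'" "Q = ext p'" for p'
    proof -
      have "cprime p'" using that(1) by (simp add: height_one_def)
      then have "q = p'" using that(2) con_ext_prime by (simp add: q_def)
      then have "p = p'" using that(1) pq p p0 unfolding height_one_def by blast
      then show False using Pe that(2) sub by simp
    qed
    show ?thesis
    proof (cases "XX \<in> p \<or> YY \<in> p")
      case True
      then show ?thesis
      proof
        assume X: "XX \<in> p"
        then have pX: "p = tgen UNIV {XX}" using height_one_notin(1)[OF hp] by blast
        have "Q \<in> T_r \<union> T_tr" using X pq Q by (auto simp: T_r_def T_tr_def q_def)
        moreover have "Q \<noteq> ext (tgen UNIV {XX})" using Pe pX sub by auto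
        ultimately have "Q \<in> {ext mm} \<union> T_T"
          using T_r_decomposition T_tr_eq by (auto simp: is_disjoint_union_iff)
        then show ?thesis using Pe pX by blast
      next
        assume Y: "YY \<in> p"
        then have pY: "p = tgen UNIV {YY}" using height_one_notin(2)[OF hp] by blast
        have "Q \<in> T_t \<union> T_tr" using Y pq Q by (auto simp: T_t_def T_tr_def q_def)
        moreover have "Q \<noteq> ext (tgen UNIV {YY})" using Pe pY sub by auto
        ultimately have "Q \<in> {ext mm} \<union> T_R"
          using T_t_decomposition T_tr_eq by (auto simp: is_disjoint_union_iff)
        then show ?thesis using Pe pY by blast
      qed
    next
      case False
      have "P \<in> T_N" using Pe hp height_one_notin[OF hp] False e by (auto simp: T_N_def)
      moreover have "Q \<in> T_T \<union> {ext mm} \<union> T_R \<union> T_M \<union> T_H"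
      proof -
        have "Q \<noteq> {0}" using sub PR_zero[OF P] by auto
        moreover have "Q \<notin> T_N" using below by (auto simp: T_N_def)
        ultimately have 1: "Q \<in> T_trs \<Longrightarrow> Q \<in> T_M"
          using T_trs_decomposition by (auto simp: is_disjoint_union_iff)
        have 2: "Q \<in> T_t \<Longrightarrow> Q \<in> T_R" "Q \<in> T_r \<Longrightarrow> Q \<in> T_T"
          using T_t_decomposition T_r_decomposition below[OF height_one_tgen(1)] below[OF height_one_tgen(2)]
          by (auto simp: is_disjoint_union_iff)
        \<comment> \<open>Since s lies in q but not in p, the chain 0 < p < q would make the centre
          part of (h) maximal.\<close>
        have "Q \<noteq> hB"
        proof
          assume Qh: "Q = hB"
          have "sS \<in> q" using h_in_iff[OF tQ] h_in_hB by (simp add: q_def Qh)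
          then have "p \<subset> q" using pq e by blast
          then have "cmax q" by (rule dim_two[OF p p0 q])
          then show False using con_hB_not_cmax by (simp add: q_def Qh)
        qed
        then have "Q \<in> T_h \<Longrightarrow> Q \<in> T_H" using T_h_eq by auto
        then show ?thesis using Qcases 1 2 T_tr_eq by auto
      qed
      ultimately show ?thesis by blast
    qed
  qed
qed

end

section \<open>The centre\<close>

text \<open>Finite support starts the recurrence at the far end, and a nonzero a lets it run
  downwards. It is applied along a diagonal of coefficients.\<close>

lemma shifted_recurrence_zero:
  fixes d :: "nat \<Rightarrow> 'a::field"
  assumes "\<And>k. a * d k + d (Suc k) = 0" "a \<noteq> 0" "\<And>k. N \<le> k \<Longrightarrow> d k = 0"
  shows "d k = 0"
proof (cases "k \<le> N")
  case True
  then show ?thesis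
  proof (induction k rule: inc_induct)
    case (step m)
    then show ?case using assms(1)[of m] assms(2) by simp
  qed (simp add: assms(3))
qed (simp add: assms(3))

context root_of_unity
begin

lemma qint_zero_iff: "qint q k = 0 \<longleftrightarrow> k mod n = 0"
proof -
  have "q ^ k = q ^ (k mod n)"
  proof -
    have "q ^ k = (q ^ n) ^ (k div n) * q ^ (k mod n)"
      by (simp add: power_mult[symmetric] power_add[symmetric])
    then show ?thesis by (simp add: qn)
  qed
  then have "qint q k = qint q (k mod n)" by (simp add: qint_eq)
  then show ?thesis using qint_ne_0[of "k mod n"] n_pos by (cases "k mod n = 0") auto
qed

text \<open>For central a, left and right multiplication by x agree on v = \<open>app a 1\<close>.
  Along the diagonal d_k = [i+k] v_(i+k,j+k) this reads (q-1) d_k + d_(k+1) = 0, so [i] v_ij = 0.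
  With y in place of x, [j] v_ij = 0. Only exponents divisible by n survive.\<close>

lemma central_is_zm:
  assumes a: "a \<in> B" and ax: "a * x = x * a" and ay: "a * y = y * a"
  shows "a \<in> range zm"
proof -
  define v where "v = app a 1"
  have rx: "app rop_x 1 = (app x 1 :: 'k poly poly)" and ry: "app (rop_y q) 1 = app y 1"
    by (rule cf_eqI, auto simp: cf_ops one_pCons coeff_pCons split: nat.split)+
  have ex: "app x v = app rop_x v"
  proof -
    have "app x v = app (a * x) 1" by (simp add: v_def ax)
    also have "\<dots> = app (a * rop_x) 1" by (simp add: rx)
    also have "\<dots> = app rop_x v" using qw_rop_commute[OF a] by (metis app_simps(6) v_def)
    finally show ?thesis .
  qed
  have ey: "app y v = app (rop_y q) v"
  proof -
    have "app y v = app (a * y) 1" by (simp add: v_def ay)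
    also have "\<dots> = app (a * rop_y q) 1" by (simp add: ry)
    also have "\<dots> = app (rop_y q) v" using qw_rop_commute[OF a] by (metis app_simps(6) v_def)
    finally show ?thesis .
  qed
  obtain N where N: "bnd v N" using ex_bnd by blast
  have zi: "qint q i * cf v i j = 0" for i j
  proof -
    have "(q - 1) * (qint q (i + k) * cf v (i + k) (j + k)) + qint q (i + Suc k) * cf v (i + Suc k) (j + Suc k) = 0" for k
    proof -
      have "q ^ (i + k) * cf v (i + k) (j + k) + qint q (Suc (i + k)) * cf v (Suc (i + k)) (Suc (j + k)) = cf v (i + k) (j + k)"
        using arg_cong[OF ex, of "\<lambda>w. cf w (i + k) (Suc (j + k))"] by (simp add: cf_ops)
      then show ?thesis unfolding mult.assoc[symmetric] qint_mult by (simp add: algebra_simps)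
    qed
    from shifted_recurrence_zero[of "q - 1" "\<lambda>k. qint q (i + k) * cf v (i + k) (j + k)", OF this, of N 0]
    show ?thesis using q_ne_1 N by (simp add: bnd_def)
  qed
  have zj: "qint q j * cf v i j = 0" for i j
  proof -
    have "(q - 1) * (qint q (j + k) * cf v (i + k) (j + k)) + qint q (j + Suc k) * cf v (i + Suc k) (j + Suc k) = 0" for k
    proof -
      have "q ^ (j + k) * cf v (i + k) (j + k) + qint q (Suc (j + k)) * cf v (Suc (i + k)) (Suc (j + k)) = cf v (i + k) (j + k)"
        using arg_cong[OF ey, of "\<lambda>w. cf w (Suc (i + k)) (j + k)"] by (simp add: cf_ops)
      then show ?thesis unfolding mult.assoc[symmetric] qint_mult by (simp add: algebra_simps)
    qed
    from shifted_recurrence_zero[of "q - 1" "\<lambda>k. qint q (j + k) * cf v (i + k) (j + k)", OF this, of N 0]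
    show ?thesis using q_ne_1 N by (simp add: bnd_def)
  qed
  have z: "comp i j v = 0" if "i < n" "j < n" "i \<noteq> 0 \<or> j \<noteq> 0" for i j
  proof (rule cf_eqI)
    fix k l
    have "qint q (i + n * k) \<noteq> 0 \<or> qint q (j + n * l) \<noteq> 0" using that by (simp add: qint_zero_iff)
    then show "cf (comp i j v) k l = cf 0 k l"
      using zi[of "i + n * k" "j + n * l"] zj[of "j + n * l" "i + n * k"] by (auto simp: cf_comp)
  qed
  have "a = (\<Sum>i<n. \<Sum>j<n. zm (comp i j v) * (y ^ i * x ^ j))" unfolding v_def by (rule expansion[OF a])
  also have "\<dots> = (\<Sum>i<n. \<Sum>j<n. if i = 0 then if j = 0 then zm (comp 0 0 v) else 0 else 0)"
    using z by (intro sum.cong refl) (auto simp: zm_hom)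
  also have "\<dots> = zm (comp 0 0 v)"
  proof -
    have "(\<Sum>i<n. \<Sum>j<n. if i = 0 then if j = 0 then zm (comp 0 0 v) else 0 else 0) =
      (\<Sum>i<n. if i = 0 then \<Sum>j<n. if j = 0 then zm (comp 0 0 v) else 0 else 0)"
      by (intro sum.cong refl) auto
    then show ?thesis using n_pos by simp
  qed
  finally show ?thesis by (rule range_eqI)
qed

lemma zm_inj: "zm z = zm w \<Longrightarrow> z = w"
proof -
  assume "zm z = zm w"
  then have "comp 0 0 (app (zm z) 1) = comp 0 0 (app (zm w) 1)" by simp
  then show "z = w" using comp_subst[of 0 0 z 1] comp_subst[of 0 0 w 1] n_pos by (simp add: zm_app comp_one)
qed

section \<open>The centre as a polynomial ring and the passage to cosets\<close>

abbreviation "A \<equiv> qWeyl q"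
abbreviation "g \<equiv> qw_iso q"

interpretation A: ring_model "qWeyl q" "qw q" "qw_iso q"
  by (rule qWeyl_model)

lemma centre_carrier: "carrier (centre_ring A) = g ` range zm"
proof -
  have "carrier (centre_ring A) = {z \<in> carrier A. \<forall>a\<in>carrier A. z \<otimes>\<^bsub>A\<^esub> a = a \<otimes>\<^bsub>A\<^esub> z}"
    by (simp add: centre_ring_def)
  also have "\<dots> = g ` {z \<in> B. \<forall>a\<in>B. z * a = a * z}"
  proof -
    have comm: "g z \<otimes>\<^bsub>A\<^esub> g a = g a \<otimes>\<^bsub>A\<^esub> g z \<longleftrightarrow> z * a = a * z" if "z \<in> B" "a \<in> B" for z a
      using that inj_on_eq_iff[OF A.inj, of "z * a" "a * z"] by (simp add: A.g_mult[symmetric] qw.mult)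
    show ?thesis unfolding A.surj[symmetric] using comm by auto
  qed
  also have "{z \<in> B. \<forall>a\<in>B. z * a = a * z} = range zm"
  proof (intro equalityI subsetI)
    fix a assume "a \<in> {z \<in> B. \<forall>a\<in>B. z * a = a * z}"
    then show "a \<in> range zm" using central_is_zm[of a] qw.x[of q] qw.y[of q] by simp
  next
    fix a assume "a \<in> range zm"
    then obtain z where "a = zm z" by blast
    then show "a \<in> {z \<in> B. \<forall>a\<in>B. z * a = a * z}" using zm_in zm_central by simp
  qed
  finally show ?thesis .
qed

lemma centre_model: "cring_model (centre_ring A) (\<lambda>z. g (zm z))"
proof -
  let ?Z = "centre_ring A"
  have ops: "mult ?Z = mult A" "one ?Z = one A" "add ?Z = add A" "zero ?Z = zero A"
    by (simp_all add: centre_ring_def)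
  have gz: "g (zm z) \<oplus>\<^bsub>A\<^esub> g (zm w) = g (zm (z + w))" "g (zm z) \<otimes>\<^bsub>A\<^esub> g (zm w) = g (zm (z * w))"
    "\<one>\<^bsub>A\<^esub> = g (zm 1)" "\<zero>\<^bsub>A\<^esub> = g (zm 0)" for z w
    by (simp_all add: zm_hom A.g_add[symmetric] A.g_mult[symmetric] zm_in A.g_one A.g_zero)
  have car: "carrier ?Z = range (\<lambda>z. g (zm z))" by (simp add: centre_carrier image_image)
  have cr: "cring ?Z"
  proof (intro cringI abelian_groupI comm_monoidI)
    fix a assume "a \<in> carrier ?Z"
    then obtain z where "a = g (zm z)" by (auto simp: car)
    then show "\<exists>b\<in>carrier ?Z. b \<oplus>\<^bsub>?Z\<^esub> a = \<zero>\<^bsub>?Z\<^esub>"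
      by (intro bexI[of _ "g (zm (- z))"]) (auto simp: ops gz car)
  qed (auto simp: car ops gz algebra_simps)
  then have rr: "ring ?Z" by (rule cring.axioms)
  have "inj (\<lambda>z. g (zm z))"
  proof (rule injI)
    fix z w assume "g (zm z) = g (zm w)"
    then have "zm z = zm w" using inj_on_eq_iff[OF A.inj zm_in zm_in] by simp
    then show "z = w" by (rule zm_inj)
  qed
  then have "bij_betw (\<lambda>z. g (zm z)) UNIV (carrier ?Z)" by (simp add: bij_betw_def car)
  then show ?thesis
    unfolding cring_model_def ring_model_def ring_model_axioms_def
    using cr rr by (auto simp: ops gz)
qed

interpretation Z: cring_model "centre_ring (qWeyl q)" "\<lambda>z. qw_iso q (zm z)"
  by (rule centre_model)

lemma qWeyl_eval_eq: "a \<in> B \<Longrightarrow> qWeyl_eval q f (g a) = g (peval a f)"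
proof -
  assume a: "a \<in> B"
  have "g (peval a f) = (\<Oplus>\<^bsub>A\<^esub>i\<in>{..degree f}. g (op_c (coeff f i) * a ^ i))"
    unfolding peval_altdef[OF a] by (rule A.g_sum) (auto intro: qw.intros qw_power a)
  also have "\<dots> = qWeyl_eval q f (g a)"
    unfolding qWeyl_eval_def
  proof (rule A.finsum_cong'[OF refl])
    fix i
    have gi: "g (op_c (coeff f i) * a ^ i) = qWeyl_const q (coeff f i) \<otimes>\<^bsub>A\<^esub> (g a [^]\<^bsub>A\<^esub> i)"
      by (simp add: A.g_mult[OF qw.const qw_power[OF a]] A.g_power[OF a] qw_iso_gens)
    then show "g (op_c (coeff f i) * a ^ i) = qWeyl_const q (coeff f i) \<otimes>\<^bsub>A\<^esub> (g a [^]\<^bsub>A\<^esub> i)" .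
  next
    show "(\<lambda>i. qWeyl_const q (coeff f i) \<otimes>\<^bsub>A\<^esub> g a [^]\<^bsub>A\<^esub> i) \<in> {..degree f} \<rightarrow> carrier A"
      unfolding qw_iso_gens A.g_power[OF a, symmetric]
      by (auto intro!: A.m_closed A.g_closed qw.const qw_power a)
  qed
  finally show ?thesis by simp
qed

lemma peval_t: "peval (x ^ n) f = zm [:f:]"
proof (induction f)
  case 0
  then show ?case by (simp add: zm_hom)
next
  case (pCons c f)
  have "[:pCons c f:] = [:[:c:]:] + XX * [:f:]" by simp
  then show ?case using pCons by (simp only: zm_hom zm_simps peval_pCons)
qed

lemma peval_r: "peval (y ^ n) f = zm (map_poly (\<lambda>c. [:c:]) f)"
proof (induction f)
  case 0
  then show ?case by (simp add: zm_hom)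
next
  case (pCons c f)
  have "map_poly (\<lambda>c. [:c:]) (pCons c f) = [:[:c:]:] + YY * map_poly (\<lambda>c. [:c:]) f" by (simp add: map_poly_pCons)
  then show ?case using pCons by (simp only: zm_hom zm_simps peval_pCons)
qed

text \<open>Expansion in the basis y^i x^j writes an element of the extension as a finite sum of
  products b z with z in p, which is what membership in the ideal product requires.\<close>

lemma carrier_prod: "tideal UNIV p \<Longrightarrow> carrier A \<cdot>\<^bsub>A\<^esub> ((\<lambda>z. g (zm z)) ` p) = g ` ext p"
proof -
  assume p: "tideal UNIV p"
  have "g ` B \<cdot>\<^bsub>A\<^esub> g ` (zm ` p) = g ` ext p"
  proof (rule A.ideal_prod_image)
    show "B \<subseteq> B" "zm ` p \<subseteq> B" "ext p \<subseteq> B" using zm_in tidealD(1)[OF tideal_ext[OF p]] by auto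
    show "i * j \<in> ext p" if i: "i \<in> B" and j: "j \<in> zm ` p" for i j
    proof -
      obtain z where "z \<in> p" "j = zm z" using j by blast
      then show ?thesis using zm_mult_ext[OF p _ i] zm_central[OF i] by simp
    qed
    show "a + b \<in> ext p" if "a \<in> ext p" "b \<in> ext p" for a b using ext_add[OF p that] .
    fix Q and a :: "'k poly poly endo"
    assume Q: "\<And>i j. i \<in> B \<Longrightarrow> j \<in> zm ` p \<Longrightarrow> Q (i * j)" "\<And>a b. Q a \<Longrightarrow> Q b \<Longrightarrow> Q (a + b)" and a: "a \<in> ext p"
    have "Q (1 * zm 0)" using Q(1)[OF qwD(1)] tidealD(2)[OF p] by blast
    then have Q0: "Q 0" by (simp add: zm_hom)
    have Qs: "Q (sum f F)" if "\<And>i. i \<in> F \<Longrightarrow> Q (f i)" for f :: "nat \<Rightarrow> 'k poly poly endo" and F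
      using that by (induction F rule: infinite_finite_induct) (auto intro: Q0 Q(2))
    have aB: "a \<in> B" using a by (simp add: ext_def)
    have "Q (\<Sum>i<n. \<Sum>j<n. zm (comp i j (app a 1)) * (y ^ i * x ^ j))"
    proof (intro Qs)
      fix i j assume ij: "i \<in> {..<n}" "j \<in> {..<n}"
      have m: "y ^ i * x ^ j \<in> B" by (intro B_intros)
      have "comp i j (app a 1) \<in> p" using a ij by (simp add: ext_def)
      then have "Q ((y ^ i * x ^ j) * zm (comp i j (app a 1)))" using Q(1)[OF m] by blast
      then show "Q (zm (comp i j (app a 1)) * (y ^ i * x ^ j))" by (simp only: zm_central[OF m])
    qed
    then show "Q a" using expansion[OF aB] by simp
  qed
  then show ?thesis by (simp add: A.surj image_image)
qed

abbreviation "G \<equiv> (`) g"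

lemma PR_subset: "P \<in> PR \<Longrightarrow> P \<subseteq> B"
  using tidealD(1)[OF tprimeD(1)] by (auto simp: PR_def)

lemma ext_subset: "ext p \<subseteq> B"
  by (auto simp: ext_def)

lemma hB_subset: "hB \<subseteq> B" by (rule tidealD(1)[OF tideal_hB])

lemma inj_G: "inj_on G PR"
  by (rule inj_onI) (metis PR_subset inj_on_image_eq_iff[OF A.inj])

lemma spec_quot_image:
  assumes "X \<subseteq> B"
  shows "nc_Spec_quot A (genideal A (g ` X)) = G ` {P \<in> PR. X \<subseteq> P}"
proof -
  have "genideal A (g ` X) \<subseteq> g ` P \<longleftrightarrow> X \<subseteq> P" if "P \<in> PR" for P
  proof -
    have tP: "tideal B P" using that tprimeD(1) by (auto simp: PR_def)
    show ?thesis
      unfolding A.genideal_image[OF assms]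
      using A.image_le_iff[OF tidealD(1)[OF tideal_tgen[OF tsubring_qw assms]] PR_subset[OF that]]
        tgen_subset_iff[OF tsubring_qw assms tP] by simp
  qed
  then show ?thesis unfolding nc_Spec_quot_def A.nc_Spec_image PR_def by auto
qed

lemma filter_image:
  assumes "a \<in> B" "S \<subseteq> PR"
  shows "{P \<in> G ` S. g a \<notin> P} = G ` {P \<in> S. a \<notin> P}"
  using A.mem_image[OF PR_subset assms(1)] assms(2) by auto

lemma mem_prod_iff:
  assumes "P \<in> PR"
  shows "x ^ n * y ^ n * h ^ n \<in> P \<longleftrightarrow> XX \<in> con P \<or> YY \<in> con P \<or> sS \<in> con P"
proof -
  have tP: "tprime B P" using assms by (simp add: PR_def)
  have c: "cprime (con P)" by (rule cprime_con[OF tP])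
  have "x ^ n * y ^ n * h ^ n \<in> P \<longleftrightarrow> XX * YY * sS \<in> con P"
    by (simp only: con_def zm_hom zm_simps zm_sS mem_Collect_eq)
  also have "\<dots> \<longleftrightarrow> XX \<in> con P \<or> YY \<in> con P \<or> sS \<in> con P"
    using cprimeD(3)[OF c] cideal_mult[OF cprimeD(1)[OF c]] by metis
  finally show ?thesis .
qed

lemma mem_con: "x ^ n \<in> P \<longleftrightarrow> XX \<in> con P" "y ^ n \<in> P \<longleftrightarrow> YY \<in> con P"
  by (simp_all only: con_def zm_simps mem_Collect_eq)

lemma gen_images:
  "genideal A {g (x ^ n)} = g ` ext (tgen UNIV {XX})"
  "genideal A {g (y ^ n)} = g ` ext (tgen UNIV {YY})"
  "genideal A {g (x ^ n), g (y ^ n)} = g ` ext mm"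
  "genideal A {g h} = g ` hB"
  "genideal A {g (y ^ n), g (peval (x ^ n) f)} = g ` ext (tgen UNIV {YY, [:f:]})"
  "genideal A {g (x ^ n), g (peval (y ^ n) f)} = g ` ext (tgen UNIV {XX, map_poly (\<lambda>c. [:c:]) f})"
  "genideal A {g h, g (peval x f)} = g ` xext {e. f dvd e}"
proof -
  have *: "genideal A (g ` zm ` E) = g ` ext (tgen UNIV E)" for E
    using A.genideal_image[of "zm ` E"] tgen_zm[OF refl, of E] zm_in by auto
  show "genideal A {g (x ^ n)} = g ` ext (tgen UNIV {XX})" using *[of "{XX}"] by (simp only: image_insert image_empty zm_simps)
  show "genideal A {g (y ^ n)} = g ` ext (tgen UNIV {YY})" using *[of "{YY}"] by (simp only: image_insert image_empty zm_simps)
  show "genideal A {g (x ^ n), g (y ^ n)} = g ` ext mm"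
    using *[of "{YY, XX}"] by (simp only: image_insert image_empty zm_simps mm_def insert_commute)
  show "genideal A {g (y ^ n), g (peval (x ^ n) f)} = g ` ext (tgen UNIV {YY, [:f:]})"
    using *[of "{YY, [:f:]}"] by (simp only: image_insert image_empty zm_simps peval_t)
  show "genideal A {g (x ^ n), g (peval (y ^ n) f)} = g ` ext (tgen UNIV {XX, map_poly (\<lambda>c. [:c:]) f})"
    using *[of "{XX, map_poly (\<lambda>c. [:c:]) f}"] by (simp only: image_insert image_empty zm_simps peval_r)
  show "genideal A {g h} = g ` hB" using A.genideal_image[of "{h}"] by (simp add: h_in tgen_h)
  show "genideal A {g h, g (peval x f)} = g ` xext {e. f dvd e}"
    using A.genideal_image[of "{h, peval x f}"] by (simp add: h_in tgen_h_poly peval_in qw.x)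
qed

lemma g_zm_gens: "g (x ^ n) = g (zm XX)" "g (y ^ n) = g (zm YY)" "g (h ^ n) = g (zm sS)"
  by (simp_all only: zm_simps zm_sS)

lemma mem_zm_image: "g (zm z) \<in> (\<lambda>z. g (zm z)) ` p \<longleftrightarrow> z \<in> p"
  using Z.mem_image[of p z] by simp

text \<open>A common transfer for the families over height-one, maximal and all admissible primes:
  \<open>C'\<close> is the condition on ideals of the centre, \<open>C\<close> its counterpart for
  polynomial ideals.\<close>

lemma centre_family_image:
  assumes C: "\<And>p. C' ((\<lambda>z. g (zm z)) ` p) \<longleftrightarrow> C p"
    and C': "\<And>I. C' I \<Longrightarrow> ideal I (centre_ring A)" and ideal: "\<And>p. C p \<Longrightarrow> tideal UNIV p"
  shows "{carrier A \<cdot>\<^bsub>A\<^esub> I | I. C' I} = G ` ext ` {p. C p}"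
proof (intro equalityI subsetI)
  fix K assume "K \<in> {carrier A \<cdot>\<^bsub>A\<^esub> I | I. C' I}"
  then obtain I where I: "K = carrier A \<cdot>\<^bsub>A\<^esub> I" "C' I" by blast
  obtain p where p: "tideal UNIV p" "I = (\<lambda>z. g (zm z)) ` p" using C'[OF I(2)] by (rule Z.ideal_preimage)
  have "C p" using I(2) unfolding p(2) C .
  moreover have "K = g ` ext p" unfolding I(1) p(2) by (rule carrier_prod[OF p(1)])
  ultimately show "K \<in> G ` ext ` {p. C p}" by blast
next
  fix K assume "K \<in> G ` ext ` {p. C p}"
  then obtain p where p: "C p" "K = g ` ext p" by blast
  have "K = carrier A \<cdot>\<^bsub>A\<^esub> ((\<lambda>z. g (zm z)) ` p)"
    unfolding p(2) by (rule carrier_prod[OF ideal[OF p(1)], symmetric])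
  moreover have "C' ((\<lambda>z. g (zm z)) ` p)" unfolding C by (rule p(1))
  ultimately show "K \<in> {carrier A \<cdot>\<^bsub>A\<^esub> I | I. C' I}" by blast
qed

lemma N_image:
  "{carrier A \<cdot>\<^bsub>A\<^esub> p | p. primeideal p (centre_ring A) \<and> prime_height (centre_ring A) p = 1 \<and>
     p \<noteq> genideal (centre_ring A) {g (x ^ n)} \<and> p \<noteq> genideal (centre_ring A) {g (y ^ n)} \<and>
     p \<noteq> genideal (centre_ring A) {g (h ^ n)}} = G ` T_N"
  unfolding g_zm_gens T_N_def
proof (rule centre_family_image)
  fix p
  let ?Z = "centre_ring A" and ?k = "\<lambda>z. g (zm z)"
  have "?k ` p = genideal ?Z {?k a} \<longleftrightarrow> p = tgen UNIV {a}" for a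
    using Z.genideal_image[of "{a}"] inj_on_image_eq_iff[OF Z.inj, of p "tgen UNIV {a}"] by simp
  moreover have "primeideal (?k ` p) ?Z \<and> prime_height ?Z (?k ` p) = 1 \<longleftrightarrow> height_one p"
    using Z.primeideal_image[of p] Z.prime_height_one_iff[of p] by (auto simp: height_one_def)
  ultimately show "(primeideal (?k ` p) ?Z \<and> prime_height ?Z (?k ` p) = 1 \<and>
      ?k ` p \<noteq> genideal ?Z {?k XX} \<and> ?k ` p \<noteq> genideal ?Z {?k YY} \<and> ?k ` p \<noteq> genideal ?Z {?k sS}) \<longleftrightarrow>
    (height_one p \<and> p \<noteq> tgen UNIV {XX} \<and> p \<noteq> tgen UNIV {YY} \<and> p \<noteq> tgen UNIV {sS})"
    by (simp only: conj_assoc[symmetric])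
qed (auto simp: height_one_def intro: primeideal.axioms(1) cprimeD(1))

lemma M_image:
  "{carrier A \<cdot>\<^bsub>A\<^esub> m | m. maximalideal m (centre_ring A) \<and> g (x ^ n) \<notin> m \<and> g (y ^ n) \<notin> m \<and> g (h ^ n) \<notin> m} = G ` T_M"
  unfolding g_zm_gens T_M_def
  by (rule centre_family_image) (auto simp only: Z.maximalideal_image mem_zm_image cmax_def intro: maximalideal.axioms(1))

lemma trs_image:
  "{carrier A \<cdot>\<^bsub>A\<^esub> p | p. primeideal p (centre_ring A) \<and> g (x ^ n) \<notin> p \<and> g (y ^ n) \<notin> p \<and> g (h ^ n) \<notin> p} = G ` T_trs"
  unfolding g_zm_gens T_trs_eq
  by (rule centre_family_image) (auto simp only: Z.primeideal_image mem_zm_image intro: primeideal.axioms(1) cprimeD(1))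

end

theorem theorem1p5:
  fixes q :: "'k::field" and n :: nat
  assumes "n \<ge> 2" and "primitive_root_of_unity n q"
    and "A = qWeyl q"
    and "Z = centre_ring A"
    and "x = qWeyl_x q"
    and "y = qWeyl_y q"
    and "h = (y \<otimes>\<^bsub>A\<^esub> x) \<oplus>\<^bsub>A\<^esub> qWeyl_const q (1 / (q - 1))"
    and "t = x [^]\<^bsub>A\<^esub> n"
    and "r = y [^]\<^bsub>A\<^esub> n"
    and "s = h [^]\<^bsub>A\<^esub> n"
    and "Spec_trs = {P \<in> nc_Spec A. t \<otimes>\<^bsub>A\<^esub> r \<otimes>\<^bsub>A\<^esub> s \<notin> P}"
    and "Spec_t_r = {P \<in> nc_Spec_quot A (genideal A {r}). t \<notin> P}"
    and "Spec_r_t = {P \<in> nc_Spec_quot A (genideal A {t}). r \<notin> P}"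
    and "Spec_tr = nc_Spec_quot A (genideal A {t, r})"
    and "Spec_h = nc_Spec_quot A (genideal A {h})"
    and "NN = {carrier A \<cdot>\<^bsub>A\<^esub> p | p. primeideal p Z \<and> prime_height Z p = 1 \<and>
                   p \<noteq> genideal Z {t} \<and> p \<noteq> genideal Z {r} \<and> p \<noteq> genideal Z {s}}"
    and "MM = {carrier A \<cdot>\<^bsub>A\<^esub> m | m. maximalideal m Z \<and> t \<notin> m \<and> r \<notin> m \<and> s \<notin> m}"
    and "RR = {genideal A {r, qWeyl_eval q f t} | f. f \<in> Irr_m - {[:0, 1:]}}"
    and "TT = {genideal A {t, qWeyl_eval q g r} | g. g \<in> Irr_m - {[:0, 1:]}}"
    and "HH = {genideal A {h, qWeyl_eval q f x} | f. f \<in> Irr_m - {[:0, 1:]}}"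
  shows
    "is_disjoint_union (nc_Spec A) [Spec_trs, Spec_t_r, Spec_r_t, Spec_tr, Spec_h] \<and>
     Spec_trs = {carrier A \<cdot>\<^bsub>A\<^esub> p | p. primeideal p Z \<and> t \<notin> p \<and> r \<notin> p \<and> s \<notin> p} \<and>
     is_disjoint_union Spec_trs [{{\<zero>\<^bsub>A\<^esub>}}, NN, MM] \<and>
     is_disjoint_union Spec_t_r [{genideal A {r}}, RR] \<and>
     is_disjoint_union Spec_r_t [{genideal A {t}}, TT] \<and>
     Spec_tr = {genideal A {t, r}} \<and>
     is_disjoint_union Spec_h [{genideal A {h}}, HH] \<and>
     (\<forall>P \<in> nc_Spec A. P \<noteq> {\<zero>\<^bsub>A\<^esub>} \<longrightarrow> {\<zero>\<^bsub>A\<^esub>} \<subset> P) \<and>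
     (\<forall>P \<in> {genideal A {t, r}} \<union> TT. genideal A {t} \<subset> P) \<and>
     (\<forall>P \<in> {genideal A {t, r}} \<union> RR. genideal A {r} \<subset> P) \<and>
     (\<forall>P \<in> HH. genideal A {h} \<subset> P) \<and>
     (\<forall>P \<in> nc_Spec A. \<forall>Q \<in> nc_Spec A. P \<subset> Q \<longrightarrow>
        P = {\<zero>\<^bsub>A\<^esub>} \<or>
        (P = genideal A {t} \<and> Q \<in> {genideal A {t, r}} \<union> TT) \<or>
        (P = genideal A {r} \<and> Q \<in> {genideal A {t, r}} \<union> RR) \<or>
        (P = genideal A {h} \<and> Q \<in> HH) \<or>
        (P \<in> NN \<and> Q \<in> TT \<union> {genideal A {t, r}} \<union> RR \<union> MM \<union> HH))"
proof -
  interpret root_of_unity q n using assms(1,2) by unfold_locales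
  interpret M: ring_model "qWeyl q" "qw q" "qw_iso q" by (rule qWeyl_model)
  note A = assms(3) and Z = assms(4)
  have x: "x = qw_iso q (op_x q)" and y: "y = qw_iso q op_y"
    using assms(5,6) by (simp_all add: qw_iso_gens)
  have hh: "h = qw_iso q (root_of_unity.h q)"
    using assms(7) unfolding A x y
    by (simp add: qw_iso_gens root_of_unity.h_def[OF root_of_unity_axioms] M.g_add M.g_mult qw.intros)
  have t: "t = qw_iso q (op_x q ^ n)" and r: "r = qw_iso q (op_y ^ n)"
    using assms(8,9) unfolding A x y by (simp_all add: M.g_power qw.intros)
  have s: "s = qw_iso q (root_of_unity.h q ^ n)"
    using assms(10) unfolding A hh by (simp add: M.g_power h_in)
  let ?G = "(`) (qw_iso q)"
  have spec: "nc_Spec A = ?G ` PR" unfolding A M.nc_Spec_image PR_def ..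
  have trs: "Spec_trs = ?G ` T_trs"
  proof -
    have e: "t \<otimes>\<^bsub>A\<^esub> r \<otimes>\<^bsub>A\<^esub> s = qw_iso q (op_x q ^ n * op_y ^ n * root_of_unity.h q ^ n)"
      unfolding A t r s by (simp add: M.g_mult qw_power qw.intros h_in)
    have m: "op_x q ^ n * op_y ^ n * root_of_unity.h q ^ n \<in> qw q" by (intro qw.mult qw_power qw.x qw.y h_in)
    show ?thesis
      unfolding assms(11) spec e filter_image[OF m subset_refl] T_trs_def
      by (intro arg_cong[of _ _ "(`) ?G"] Collect_cong) (auto simp: mem_prod_iff)
  qed
  have qt: "nc_Spec_quot A (genideal A {t}) = ?G ` {P \<in> PR. op_x q ^ n \<in> P}"
    using spec_quot_image[of "{op_x q ^ n}"] unfolding A t by (simp add: qw_power qw.x)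
  have qr: "nc_Spec_quot A (genideal A {r}) = ?G ` {P \<in> PR. op_y ^ n \<in> P}"
    using spec_quot_image[of "{op_y ^ n}"] unfolding A r by (simp add: qw_power qw.y)
  have st: "Spec_t_r = ?G ` T_t"
    unfolding assms(12) qr t T_t_def
    by (subst filter_image[OF qw_power[OF qw.x]]) (auto simp: mem_con)
  have sr: "Spec_r_t = ?G ` T_r"
    unfolding assms(13) qt r T_r_def
    by (subst filter_image[OF qw_power[OF qw.y]]) (auto simp: mem_con)
  have str: "Spec_tr = ?G ` T_tr"
  proof -
    have "{op_x q ^ n, op_y ^ n} \<subseteq> qw q" by (simp add: qw_power qw.x qw.y)
    from spec_quot_image[OF this] show ?thesis
      unfolding assms(14) A t r T_tr_def by (simp add: mem_con)
  qed
  have sh: "Spec_h = ?G ` T_h"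
    using spec_quot_image[of "{root_of_unity.h q}"] unfolding assms(15) A hh T_h_def by (simp add: h_in)
  have NN: "NN = ?G ` T_N" unfolding assms(16) A Z t r s by (rule N_image)
  have MM: "MM = ?G ` T_M" unfolding assms(17) A Z t r s by (rule M_image)
  have RR: "RR = ?G ` T_R"
    unfolding assms(18) T_R_def A t r qWeyl_eval_eq[OF qw_power[OF qw.x]] gen_images by blast
  have TT: "TT = ?G ` T_T"
    unfolding assms(19) T_T_def A t r qWeyl_eval_eq[OF qw_power[OF qw.y]] gen_images by blast
  have HH: "HH = ?G ` T_H"
    unfolding assms(20) T_H_def A x hh qWeyl_eval_eq[OF qw.x] gen_images by blast
  have gt: "genideal A {t} = ?G (ext (tgen UNIV {[:[:0, 1:]:]}))" and gr: "genideal A {r} = ?G (ext (tgen UNIV {[:0, 1:]}))"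
    and gtr: "genideal A {t, r} = ?G (ext mm)" and gh: "genideal A {h} = ?G hB"
    unfolding A t r hh by (rule gen_images)+
  have z: "{\<zero>\<^bsub>A\<^esub>} = ?G {0}" unfolding A by (simp add: M.g_zero)
  have subs: "T_trs \<subseteq> PR" "T_t \<subseteq> PR" "T_r \<subseteq> PR" "T_tr \<subseteq> PR" "T_h \<subseteq> PR"
    by (auto simp: T_trs_def T_t_def T_r_def T_tr_def T_h_def)
  \<comment> \<open>\<open>F\<close> carries ideals of the operator ring to ideals of the coset
    ring. It is injective on primes and preserves and reflects strict inclusions, so each clause
    reduces to its operator version.\<close>
  define F where "F = ?G"
  note folded = spec trs st sr str sh NN MM RR TT HH gt gr gtr gh z
  note folded = folded[folded F_def]
  have F_strict: "F P \<subset> F Q \<longleftrightarrow> P \<subset> Q" if "P \<subseteq> qw q" "Q \<subseteq> qw q" for P Q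
    unfolding F_def using M.image_psubset_iff[OF that] .
  have inj: "inj_on F S" if "S \<subseteq> PR" for S unfolding F_def using inj_on_subset[OF inj_G that] .
  have H: "P \<subseteq> qw q" if "P \<in> T_H" for P using that T_h_eq subs(5) PR_subset by blast
  show ?thesis
    unfolding folded
  proof (intro conjI)
    show "is_disjoint_union (F ` PR) [F ` T_trs, F ` T_t, F ` T_r, F ` T_tr, F ` T_h]"
      using is_disjoint_union_image[OF spec_decomposition inj] by simp
    show "F ` T_trs = {carrier A \<cdot>\<^bsub>A\<^esub> p |p. primeideal p Z \<and> t \<notin> p \<and> r \<notin> p \<and> s \<notin> p}"
      unfolding A Z t r s F_def by (rule trs_image[symmetric])
    show "is_disjoint_union (F ` T_trs) [{F {0}}, F ` T_N, F ` T_M]"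
      using is_disjoint_union_image[OF T_trs_decomposition inj[OF subs(1)]] by simp
    show "is_disjoint_union (F ` T_t) [{F (ext (tgen UNIV {[:0, 1:]}))}, F ` T_R]"
      using is_disjoint_union_image[OF T_t_decomposition inj[OF subs(2)]] by simp
    show "is_disjoint_union (F ` T_r) [{F (ext (tgen UNIV {[:[:0, 1:]:]}))}, F ` T_T]"
      using is_disjoint_union_image[OF T_r_decomposition inj[OF subs(3)]] by simp
    show "F ` T_tr = {F (ext mm)}" unfolding T_tr_eq by simp
    show "is_disjoint_union (F ` T_h) [{F hB}, F ` T_H]"
      using is_disjoint_union_image[OF T_h_decomposition inj[OF subs(5)]] by simp
    show "\<forall>P\<in>F ` PR. P \<noteq> F {0} \<longrightarrow> F {0} \<subset> P"
    proof (intro ballI impI)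
      fix P assume "P \<in> F ` PR" "P \<noteq> F {0}"
      then obtain P' where "P' \<in> PR" "P = F P'" "P' \<noteq> {0}" by blast
      then have "{0} \<subset> P'" using PR_zero[of P'] by blast
      then show "F {0} \<subset> P"
        unfolding \<open>P = F P'\<close> F_strict[OF PR_subset[OF zero_in_PR] PR_subset[OF \<open>P' \<in> PR\<close>]] .
    qed
    show "\<forall>P\<in>{F (ext mm)} \<union> F ` T_T. F (ext (tgen UNIV {[:[:0, 1:]:]})) \<subset> P"
    proof
      fix P assume "P \<in> {F (ext mm)} \<union> F ` T_T"
      then consider "P = F (ext mm)" | f where "f \<in> Irr_m" "P = F (ext (tgen UNIV {[:[:0, 1:]:], map_poly (\<lambda>c. [:c:]) f}))"
        unfolding T_T_def by blast
      then show "F (ext (tgen UNIV {[:[:0, 1:]:]})) \<subset> P"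
      proof cases
        case 1
        show ?thesis unfolding 1 F_strict[OF ext_subset ext_subset] by (rule tr_strict)
      next
        case 2
        show ?thesis unfolding 2(2) F_strict[OF ext_subset ext_subset] by (rule T_strict[OF 2(1)])
      qed
    qed
    show "\<forall>P\<in>{F (ext mm)} \<union> F ` T_R. F (ext (tgen UNIV {[:0, 1:]})) \<subset> P"
    proof
      fix P assume "P \<in> {F (ext mm)} \<union> F ` T_R"
      then consider "P = F (ext mm)" | f where "f \<in> Irr_m" "P = F (ext (tgen UNIV {[:0, 1:], [:f:]}))"
        unfolding T_R_def by blast
      then show "F (ext (tgen UNIV {[:0, 1:]})) \<subset> P"
      proof cases
        case 1
        show ?thesis unfolding 1 F_strict[OF ext_subset ext_subset] by (rule tr_strict)
      next
        case 2
        show ?thesis unfolding 2(2) F_strict[OF ext_subset ext_subset] by (rule R_strict[OF 2(1)])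
      qed
    qed
    show "\<forall>P\<in>F ` T_H. F hB \<subset> P"
    proof
      fix P assume "P \<in> F ` T_H"
      then obtain P' where P': "P = F P'" "P' \<in> T_H" by blast
      show "F hB \<subset> P" unfolding P'(1) F_strict[OF hB_subset H[OF P'(2)]] by (rule H_strict[OF P'(2)])
    qed
    show "\<forall>P\<in>F ` PR. \<forall>Q\<in>F ` PR. P \<subset> Q \<longrightarrow>
        P = F {0} \<or>
        P = F (ext (tgen UNIV {[:[:0, 1:]:]})) \<and> Q \<in> {F (ext mm)} \<union> F ` T_T \<or>
        P = F (ext (tgen UNIV {[:0, 1:]})) \<and> Q \<in> {F (ext mm)} \<union> F ` T_R \<or>
        P = F hB \<and> Q \<in> F ` T_H \<or>
        P \<in> F ` T_N \<and> Q \<in> F ` T_T \<union> {F (ext mm)} \<union> F ` T_R \<union> F ` T_M \<union> F ` T_H"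
    proof (intro ballI impI)
      fix P Q assume "P \<in> F ` PR" "Q \<in> F ` PR" and PQ: "P \<subset> Q"
      then obtain P' Q' where P': "P' \<in> PR" "P = F P'" and Q': "Q' \<in> PR" "Q = F Q'" by blast
      have "P' \<subset> Q'"
        using PQ F_strict[OF PR_subset[OF P'(1)] PR_subset[OF Q'(1)]] P'(2) Q'(2) by simp
      from strict_inclusions[OF P'(1) Q'(1) this]
      show "P = F {0} \<or>
        P = F (ext (tgen UNIV {[:[:0, 1:]:]})) \<and> Q \<in> {F (ext mm)} \<union> F ` T_T \<or>
        P = F (ext (tgen UNIV {[:0, 1:]})) \<and> Q \<in> {F (ext mm)} \<union> F ` T_R \<or>
        P = F hB \<and> Q \<in> F ` T_H \<or>
        P \<in> F ` T_N \<and> Q \<in> F ` T_T \<union> {F (ext mm)} \<union> F ` T_R \<union> F ` T_M \<union> F ` T_H"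
        unfolding P'(2) Q'(2) by blast
    qed
  qed
qed

end
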